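(* Let $\Omega$ be any open set in $\mathbb R^n$, $n\geq2$. Assume that $\mu$ is a Borel measure in $\Omega$ such that $\mu(B_r(x)\cap\Omega)\leq C_\mu r^\alpha$ for $x\in\Omega$ and $r>0$, for some exponent $\alpha\in(n-1,n]$ and some constant $C_\mu>0$, and let $1<p<n$. Assume, in addition, that $\mu(\Omega)<\infty$. If $1\leq q<\frac{\alpha p}{n-p}$, and $\{\mathbf u_m\}\subset C_b(\overline\Omega)$ is a bounded sequence in $E^{1,p}(\Omega)\cap L^{\frac{p(n-1)}{n-p}}(\partial\Omega)$, then $\{\mathbf u_m\}$ is a Cauchy sequence in $L^q(\Omega,\mu)$ (up to passing to a subsequence).
   Context: Functions $\mathbf u$ are $\mathbb R^n$-valued. $\mathcal E\mathbf u=\tfrac12(\nabla\mathbf u+(\nabla\mathbf u)^T)$ is the symmetric part of the distributional gradient. $E^{1,p}(\Omega)=\{\mathbf u\in L^1_{\rm loc}(\Omega):|\mathcal E\mathbf u|\in L^p(\Omega)\}$. $C_b(\overline\Omega)$ is the set of functions that are continuous in $\overline\Omega$ and have bounded support. $B_r(x)$ is the ball centered at $x$ with radius $r$. Norms over $\Omega$ with no measure indicated are with respect to Lebesgue measure; norms over $\partial\Omega$ are with respect to the $(n-1)$-dimensional Hausdorff measure $\mathcal H^{n-1}$ and are applied to the restriction of $\mathbf u$ to $\partial\Omega$. A sequence $\{\mathbf u_m\}$ is bounded in $E^{1,p}(\Omega)\cap L^{\frac{p(n-1)}{n-p}}(\partial\Omega)$ if $\sup_m\big(\|\mathcal E\mathbf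 u_m\|_{L^p(\Omega)}+\|\mathbf u_m\|_{L^{\frac{p(n-1)}{n-p}}(\partial\Omega)}\big)<\infty$. *)

theory Defs
  imports "HOL-Analysis.Analysis"
begin

section \<open>Hausdorff measure\<close>

text \<open>
  The factor \<open>unit_ball_vol s / 2 powr s\<close> is the usual normalisation, for which \<open>\<H>\<^sup>n\<close> on \<open>\<real>\<^sup>n\<close> is
  Lebesgue measure and \<open>\<H>\<^sup>n\<^sup>-\<^sup>1\<close> is surface area. The value \<open>\<infinity>\<close> excludes sets of diameter larger than
  \<open>\<delta>\<close> from the coverings below; boundedness is required because the library's \<open>diameter\<close> is
  unspecified on unbounded sets. The definitions are meant for \<open>s > 0\<close> (here \<open>0 powr 0 = 0\<close>).
\<close>

definition hausdorff_gauge :: "real \<Rightarrow> real \<Rightarrow> 'a::metric_space set \<Rightarrow> ennreal" where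
  "hausdorff_gauge s \<delta> U =
     (if bounded U \<and> diameter U \<le> \<delta> then ennreal (unit_ball_vol s * (diameter U / 2) powr s) else \<infinity>)"

definition hausdorff_content :: "real \<Rightarrow> real \<Rightarrow> 'a::metric_space set \<Rightarrow> ennreal" where
  "hausdorff_content s \<delta> A =
     (INF U \<in> {U :: nat \<Rightarrow> 'a set. A \<subseteq> (\<Union>i. U i)}. \<Sum>i. hausdorff_gauge s \<delta> (U i))"

definition hausdorff_outer :: "real \<Rightarrow> 'a::metric_space set \<Rightarrow> ennreal" where
  "hausdorff_outer s A = (SUP \<delta>\<in>{0<..}. hausdorff_content s \<delta> A)"

text \<open>
  \<open>measure_of\<close> returns the zero measure when its argument is not countably additive. That this does
  not happen here is \<open>emeasure_hausdorff_measure\<close> below.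
\<close>

definition hausdorff_measure :: "real \<Rightarrow> 'a::metric_space measure" where
  "hausdorff_measure s = measure_of UNIV (sets borel) (hausdorff_outer s)"

lemma sets_hausdorff_measure [simp, measurable_cong]: "sets (hausdorff_measure s) = sets borel"
  unfolding hausdorff_measure_def using sets.sigma_sets_eq[of borel] by simp

lemma space_hausdorff_measure [simp]: "space (hausdorff_measure s) = UNIV"
  unfolding hausdorff_measure_def by simp

lemma hausdorff_gauge_empty [simp]: "\<delta> > 0 \<Longrightarrow> hausdorff_gauge s \<delta> {} = 0"
  by (simp add: hausdorff_gauge_def)

lemma hausdorff_gauge_mono:
  assumes "s > 0" "A \<subseteq> B" shows "hausdorff_gauge s \<delta> A \<le> hausdorff_gauge s \<delta> B"
proof (cases "bounded B \<and> diameter B \<le> \<delta>")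
  case True
  then have "bounded A" "diameter A \<le> diameter B" "0 \<le> diameter A"
    using assms diameter_subset[of A B] bounded_subset[of B A] diameter_ge_0 by auto
  moreover from this have "(diameter A / 2) powr s \<le> (diameter B / 2) powr s"
    using assms by (intro powr_mono2) auto
  ultimately show ?thesis
    using True assms by (auto simp: hausdorff_gauge_def intro!: ennreal_leI mult_left_mono)
qed (auto simp: hausdorff_gauge_def)

lemma hausdorff_gauge_antimono:
  "\<delta>' \<le> \<delta> \<Longrightarrow> hausdorff_gauge s \<delta> A \<le> hausdorff_gauge s \<delta>' A"
  by (auto simp: hausdorff_gauge_def)

lemma hausdorff_content_antimono:
  "\<delta>' \<le> \<delta> \<Longrightarrow> hausdorff_content s \<delta> A \<le> hausdorff_content s \<delta>' A"
  unfolding hausdorff_content_def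
  by (intro INF_mono') (auto intro!: suminf_le hausdorff_gauge_antimono)

lemma hausdorff_content_eq_outer_measure:
  assumes "s > 0" "\<delta> > 0"
  shows "hausdorff_content s \<delta> A = outer_measure (Pow UNIV) (hausdorff_gauge s \<delta>) A"
proof (rule antisym)
  show "hausdorff_content s \<delta> A \<le> outer_measure (Pow UNIV) (hausdorff_gauge s \<delta>) A"
    unfolding hausdorff_content_def outer_measure_def by (rule INF_superset_mono) auto
  interpret P: ring_of_sets UNIV "Pow UNIV :: 'a set set"
    using algebra_Pow algebra.axioms(1) by blast
  show "outer_measure (Pow UNIV) (hausdorff_gauge s \<delta>) A \<le> hausdorff_content s \<delta> A"
    unfolding hausdorff_content_def using assms
    by (intro INF_greatest P.outer_measure_le)
       (auto simp: positive_def increasing_def intro: hausdorff_gauge_mono)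
qed

lemma outer_measure_space_content:
  assumes "s > 0" "\<delta> > 0"
  shows "outer_measure_space UNIV (hausdorff_content s \<delta> :: 'a::metric_space set \<Rightarrow> ennreal)"
proof -
  interpret P: ring_of_sets UNIV "Pow UNIV :: 'a set set"
    using algebra_Pow algebra.axioms(1) by blast
  have "(hausdorff_content s \<delta> :: 'a set \<Rightarrow> _) = outer_measure (Pow UNIV) (hausdorff_gauge s \<delta>)"
    using hausdorff_content_eq_outer_measure[OF assms] by blast
  moreover have "outer_measure_space (Pow UNIV)
      (outer_measure (Pow UNIV) (hausdorff_gauge s \<delta> :: 'a set \<Rightarrow> ennreal))"
    using assms by (intro P.outer_measure_space_outer_measure)
      (auto simp: positive_def increasing_def intro: hausdorff_gauge_mono)
  ultimately show ?thesis by simp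
qed

lemma outer_measure_space_hausdorff:
  assumes "s > 0"
  shows "outer_measure_space UNIV (hausdorff_outer s :: 'a::metric_space set \<Rightarrow> ennreal)"
proof -
  note C = outer_measure_space_content[OF assms, where ?'a='a, unfolded outer_measure_space_def positive_def
      increasing_def countably_subadditive_def, THEN conjunct2, THEN conjunct2]
  have "(SUP \<delta>\<in>{0<..}. hausdorff_content s \<delta> ({}::'a set)) = 0"
    using outer_measure_space_content[OF assms, where ?'a='a]
    by (auto simp: outer_measure_space_def positive_def SUP_constant intro!: antisym SUP_least)
  moreover have "increasing UNIV (hausdorff_outer s :: 'a set \<Rightarrow> ennreal)"
    unfolding increasing_def hausdorff_outer_def
    using outer_measure_space_content[OF assms, where ?'a='a]
    by (intro ballI impI SUP_mono) (auto simp: outer_measure_space_def increasing_def)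
  moreover have "countably_subadditive UNIV (hausdorff_outer s :: 'a set \<Rightarrow> ennreal)"
    unfolding countably_subadditive_def
  proof (intro allI impI)
    fix A :: "nat \<Rightarrow> 'a set" assume d: "range A \<subseteq> UNIV" "disjoint_family A"
    show "hausdorff_outer s (\<Union>i. A i) \<le> (\<Sum>i. hausdorff_outer s (A i))"
      unfolding hausdorff_outer_def[of s "\<Union>i. A i"]
    proof (rule SUP_least)
      fix \<delta> :: real assume "\<delta> \<in> {0<..}"
      then have "hausdorff_content s \<delta> (\<Union>i. A i) \<le> (\<Sum>i. hausdorff_content s \<delta> (A i))"
        using C[of \<delta>] d by simp
      also have "\<dots> \<le> (\<Sum>i. hausdorff_outer s (A i))"
        using \<open>\<delta> \<in> {0<..}\<close> by (intro suminf_le) (auto simp: hausdorff_outer_def intro: SUP_upper)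
      finally show "hausdorff_content s \<delta> (\<Union>i. A i) \<le> \<dots>" .
    qed
  qed
  ultimately show ?thesis
    by (simp add: outer_measure_space_def positive_def hausdorff_outer_def)
qed

lemma hausdorff_outer_mono: "s > 0 \<Longrightarrow> A \<subseteq> B \<Longrightarrow> hausdorff_outer s A \<le> hausdorff_outer s B"
  using outer_measure_space_hausdorff[of s] by (auto simp: outer_measure_space_def increasing_def)

lemma hausdorff_outer_empty: "s > 0 \<Longrightarrow> hausdorff_outer s {} = 0"
  using outer_measure_space_hausdorff[of s] by (auto simp: outer_measure_space_def positive_def)

lemma hausdorff_outer_UN:
  fixes A :: "nat \<Rightarrow> 'a::metric_space set"
  assumes "s > 0" shows "hausdorff_outer s (\<Union>i. A i) \<le> (\<Sum>i. hausdorff_outer s (A i))"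
proof -
  have "hausdorff_outer s (\<Union>i. disjointed A i) \<le> (\<Sum>i. hausdorff_outer s (disjointed A i))"
    using outer_measure_space_hausdorff[OF assms, where ?'a='a] disjoint_family_disjointed[of A]
    by (auto simp: outer_measure_space_def countably_subadditive_def)
  also have "\<dots> \<le> (\<Sum>i. hausdorff_outer s (A i))"
    by (intro suminf_le hausdorff_outer_mono assms disjointed_subset) auto
  finally show ?thesis by (simp add: UN_disjointed_eq)
qed

lemma hausdorff_outer_Un:
  assumes "s > 0" shows "hausdorff_outer s (A \<union> B) \<le> hausdorff_outer s A + hausdorff_outer s B"
proof -
  have "(\<Union>i::nat. if i = 0 then A else if i = 1 then B else {}) = A \<union> B"
    by (auto split: if_splits)
  then have "hausdorff_outer s (A \<union> B)
      \<le> (\<Sum>i::nat. hausdorff_outer s (if i = 0 then A else if i = 1 then B else {}))"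
    using hausdorff_outer_UN[OF assms, of "\<lambda>i. if i = 0 then A else if i = 1 then B else {}"] by simp
  also have "\<dots> = (\<Sum>i\<in>{0,1::nat}. hausdorff_outer s (if i = 0 then A else if i = 1 then B else {}))"
    by (rule suminf_finite) (auto simp: hausdorff_outer_empty assms)
  finally show ?thesis by simp
qed

lemma hausdorff_outer_separated:
  assumes s: "s > 0" and d: "d > 0" "\<And>x y. x \<in> A \<Longrightarrow> y \<in> B \<Longrightarrow> d \<le> dist x y"
  shows "hausdorff_outer s A + hausdorff_outer s B \<le> hausdorff_outer s (A \<union> B)"
proof -
  have small: "hausdorff_content s \<delta> A + hausdorff_content s \<delta> B \<le> hausdorff_content s \<delta> (A \<union> B)"
    if \<delta>: "0 < \<delta>" "\<delta> < d" for \<delta>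
    unfolding hausdorff_content_def[of s \<delta> "A \<union> B"]
  proof (safe intro!: INF_greatest)
    fix U :: "nat \<Rightarrow> 'a set" assume U: "A \<union> B \<subseteq> (\<Union>i. U i)"
    have g: "hausdorff_gauge s \<delta> (U i \<inter> A) + hausdorff_gauge s \<delta> (U i \<inter> B) \<le> hausdorff_gauge s \<delta> (U i)" for i
    proof (cases "bounded (U i) \<and> diameter (U i) \<le> \<delta>")
      case True
      have "U i \<inter> A = {} \<or> U i \<inter> B = {}"
      proof (rule ccontr)
        assume "\<not> ?thesis"
        then obtain x y where "x \<in> U i" "x \<in> A" "y \<in> U i" "y \<in> B" by auto
        then show False
          using diameter_bounded_bound[of "U i" x y] True d(2)[of x y] \<delta> by auto
      qed
      then show ?thesis using \<delta> s by (auto intro: hausdorff_gauge_mono)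
    qed (auto simp: hausdorff_gauge_def)
    have "hausdorff_content s \<delta> A + hausdorff_content s \<delta> B
        \<le> (\<Sum>i. hausdorff_gauge s \<delta> (U i \<inter> A)) + (\<Sum>i. hausdorff_gauge s \<delta> (U i \<inter> B))"
      unfolding hausdorff_content_def using U by (intro add_mono INF_lower) auto
    also have "\<dots> = (\<Sum>i. hausdorff_gauge s \<delta> (U i \<inter> A) + hausdorff_gauge s \<delta> (U i \<inter> B))"
      by (intro suminf_add) auto
    also have "\<dots> \<le> (\<Sum>i. hausdorff_gauge s \<delta> (U i))"
      by (intro suminf_le g) auto
    finally show "hausdorff_content s \<delta> A + hausdorff_content s \<delta> B \<le> \<dots>" .
  qed
  have "hausdorff_outer s A + hausdorff_outer s B
      = (SUP \<delta>\<in>{0<..}. hausdorff_content s \<delta> A + hausdorff_content s \<delta> B)"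
    unfolding hausdorff_outer_def
  proof (rule SUP_add_directed_ennreal[symmetric])
    fix i j :: real assume "i \<in> {0<..}" "j \<in> {0<..}"
    then show "\<exists>k\<in>{0<..}. hausdorff_content s i A + hausdorff_content s j B
        \<le> hausdorff_content s k A + hausdorff_content s k B"
      by (intro bexI[of _ "min i j"] add_mono hausdorff_content_antimono) auto
  qed
  also have "\<dots> \<le> hausdorff_outer s (A \<union> B)"
  proof (rule SUP_least)
    fix \<delta> :: real assume "\<delta> \<in> {0<..}"
    define \<eta> where "\<eta> = min \<delta> (d/2)"
    have \<eta>: "0 < \<eta>" "\<eta> < d" "\<eta> \<le> \<delta>" using \<open>\<delta> \<in> _\<close> d(1) by (auto simp: \<eta>_def)
    have "hausdorff_content s \<delta> A + hausdorff_content s \<delta> B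
        \<le> hausdorff_content s \<eta> A + hausdorff_content s \<eta> B"
      by (intro add_mono hausdorff_content_antimono \<eta>)
    also have "\<dots> \<le> hausdorff_content s \<eta> (A \<union> B)" by (rule small[OF \<eta>(1,2)])
    also have "\<dots> \<le> hausdorff_outer s (A \<union> B)"
      unfolding hausdorff_outer_def using \<eta> by (intro SUP_upper) auto
    finally show "hausdorff_content s \<delta> A + hausdorff_content s \<delta> B \<le> \<dots>" .
  qed
  finally show ?thesis .
qed

lemma hausdorff_outer_closed:
  fixes F :: "'a::metric_space set"
  assumes s: "s > 0" and F: "closed F"
  shows "hausdorff_outer s (X \<inter> F) + hausdorff_outer s (X - F) \<le> hausdorff_outer s X"
proof (cases "F = {} \<or> hausdorff_outer s X = \<infinity>")
  case True
  then show ?thesis by (auto simp: hausdorff_outer_empty s)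
next
  case False
  then have ne: "F \<noteq> {}" and fin: "hausdorff_outer s X < \<infinity>" by (auto simp: less_top)
  define C where "C n = {y \<in> X. 1 / real (Suc n) \<le> infdist y F}" for n
  define R where "R n = {y \<in> X. 1 / real (Suc (Suc n)) \<le> infdist y F \<and> infdist y F < 1 / real (Suc n)}" for n
  have alt: "(\<Sum>k<N. hausdorff_outer s (R (2*k+p))) \<le> hausdorff_outer s (\<Union>k<N. R (2*k+p))" for N p
  proof (induction N)
    case (Suc N)
    have "(\<Sum>k<Suc N. hausdorff_outer s (R (2*k+p)))
        \<le> hausdorff_outer s (\<Union>k<N. R (2*k+p)) + hausdorff_outer s (R (2*N+p))"
      using Suc by (simp add: add_right_mono)
    also have "\<dots> \<le> hausdorff_outer s ((\<Union>k<N. R (2*k+p)) \<union> R (2*N+p))"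
    proof (rule hausdorff_outer_separated[OF s])
      let ?m = "2*N+p"
      show "0 < 1 / (real ?m + 1/2) - 1 / (real ?m + 1)"
        using divide_strict_left_mono[of "real ?m + 1/2" "real ?m + 1" 1] by simp
      fix x y assume x: "x \<in> (\<Union>k<N. R (2*k+p))" and y: "y \<in> R ?m"
      then obtain k where k: "k < N" "x \<in> R (2*k+p)" by auto
      have "1 / (real ?m + 1/2) \<le> 1 / real (Suc (Suc (2*k+p)))"
        using k(1) by (intro divide_left_mono) auto
      moreover have "infdist x F \<le> infdist y F + dist x y" by (rule infdist_triangle)
      ultimately show "1 / (real ?m + 1/2) - 1 / (real ?m + 1) \<le> dist x y"
        using k(2) y by (simp add: R_def algebra_simps)
    qed
    also have "(\<Union>k<N. R (2*k+p)) \<union> R (2*N+p) = (\<Union>k<Suc N. R (2*k+p))"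
      by (auto simp: less_Suc_eq)
    finally show ?case .
  qed (simp add: hausdorff_outer_empty s)
  have altX: "(\<Sum>k<N. hausdorff_outer s (R (2*k+p))) \<le> hausdorff_outer s X" for N p
    using alt[where N=N and p=p] by (rule order_trans) (auto intro!: hausdorff_outer_mono s simp: R_def)
  have sum_fin: "(\<Sum>k. hausdorff_outer s (R k)) < \<infinity>"
  proof -
    have "(\<Sum>k<n. hausdorff_outer s (R k)) \<le> hausdorff_outer s X + hausdorff_outer s X" for n
    proof -
      have "(\<Sum>k<n. hausdorff_outer s (R k)) \<le> (\<Sum>k<2*n. hausdorff_outer s (R k))"
        by (rule sum_mono2) auto
      also have "\<dots> = (\<Sum>k<n. hausdorff_outer s (R (2*k+0))) + (\<Sum>k<n. hausdorff_outer s (R (2*k+1)))"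
        by (induction n) (auto simp: algebra_simps)
      also have "\<dots> \<le> hausdorff_outer s X + hausdorff_outer s X"
        by (intro add_mono altX)
      finally show ?thesis .
    qed
    then have "(\<Sum>k. hausdorff_outer s (R k)) \<le> hausdorff_outer s X + hausdorff_outer s X"
      by (intro suminf_le_const) auto
    also have "\<dots> < \<infinity>" using fin by simp
    finally show ?thesis .
  qed
  have step: "hausdorff_outer s (X \<inter> F) + hausdorff_outer s (X - F)
      \<le> hausdorff_outer s X + (\<Sum>k. hausdorff_outer s (R (k+n)))" for n
  proof -
    have "X - F \<subseteq> C n \<union> (\<Union>k. R (k+n))"
    proof
      fix y assume y: "y \<in> X - F"
      then have pos: "infdist y F > 0" using F ne by (simp add: infdist_pos_not_in_closed)
      show "y \<in> C n \<union> (\<Union>k. R (k+n))"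
      proof (cases "1 / real (Suc n) \<le> infdist y F")
        case False
        define P where "P j \<longleftrightarrow> 1 / real (Suc j) \<le> infdist y F" for j
        obtain j0 where "P j0"
          using pos reals_Archimedean[of "infdist y F"] by (auto simp: P_def inverse_eq_divide intro: less_imp_le)
        define j where "j = (LEAST j. P j)"
        have Pj: "P j" unfolding j_def using \<open>P j0\<close> by (rule LeastI)
        have nj: "\<not> P i" if "i < j" for i using not_less_Least that unfolding j_def by blast
        have "n < j"
        proof (rule ccontr)
          assume "\<not> n < j"
          then have "1 / real (Suc n) \<le> 1 / real (Suc j)" by (intro divide_left_mono) auto
          with Pj False show False by (simp add: P_def)
        qed
        then obtain i where i: "j = Suc (i + n)" by (metis add.commute less_imp_Suc_add)
        have "y \<in> R (i + n)" using Pj nj[of "i+n"] i y by (auto simp: R_def P_def)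
        then show ?thesis by auto
      qed (use y in \<open>auto simp: C_def\<close>)
    qed
    then have "hausdorff_outer s (X - F) \<le> hausdorff_outer s (C n \<union> (\<Union>k. R (k+n)))"
      by (rule hausdorff_outer_mono[OF s])
    also have "\<dots> \<le> hausdorff_outer s (C n) + (\<Sum>k. hausdorff_outer s (R (k+n)))"
      by (rule order_trans[OF hausdorff_outer_Un[OF s]]) (intro add_left_mono hausdorff_outer_UN s)
    finally have 1: "hausdorff_outer s (X - F) \<le> \<dots>" .
    have "hausdorff_outer s (X \<inter> F) + hausdorff_outer s (C n) \<le> hausdorff_outer s (X \<inter> F \<union> C n)"
    proof (rule hausdorff_outer_separated[OF s])
      show "1 / real (Suc n) \<le> dist x y" if "x \<in> X \<inter> F" "y \<in> C n" for x y
        using that infdist_le[of x F y] by (auto simp: C_def dist_commute)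
    qed auto
    also have "\<dots> \<le> hausdorff_outer s X"
      by (rule hausdorff_outer_mono[OF s]) (auto simp: C_def)
    finally have 2: "hausdorff_outer s (X \<inter> F) + hausdorff_outer s (C n) \<le> hausdorff_outer s X" .
    have "hausdorff_outer s (X \<inter> F) + hausdorff_outer s (X - F)
       \<le> (hausdorff_outer s (X \<inter> F) + hausdorff_outer s (C n)) + (\<Sum>k. hausdorff_outer s (R (k+n)))"
      using add_left_mono[OF 1] by (simp add: add.assoc)
    also have "\<dots> \<le> hausdorff_outer s X + (\<Sum>k. hausdorff_outer s (R (k+n)))"
      by (rule add_right_mono[OF 2])
    finally show ?thesis .
  qed
  show ?thesis
  proof (rule ennreal_le_epsilon)
    fix e :: real assume e: "e > 0"
    define r where "r k = enn2real (hausdorff_outer s (R k))" for k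
    have r: "hausdorff_outer s (R k) = ennreal (r k)" for k
    proof -
      have "hausdorff_outer s (R k) \<le> hausdorff_outer s X"
        by (rule hausdorff_outer_mono[OF s]) (auto simp: R_def)
      then show ?thesis using fin by (simp add: r_def le_less_trans)
    qed
    have r0: "r k \<ge> 0" for k by (simp add: r_def)
    have sr: "summable r"
      using sum_fin by (intro summable_suminf_not_top) (auto simp: r r0)
    obtain N where N: "\<And>n. n \<ge> N \<Longrightarrow> norm (\<Sum>k. r (k + n)) < e"
      using suminf_exist_split[OF e sr] by auto
    have "(\<Sum>k. hausdorff_outer s (R (k+N))) = ennreal (\<Sum>k. r (k + N))"
      unfolding r using sr r0 by (intro suminf_ennreal_eq summable_sums) (auto simp: summable_iff_shift)
    also have "\<dots> \<le> ennreal e" using N[of N] by (intro ennreal_leI) auto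
    finally show "hausdorff_outer s (X \<inter> F) + hausdorff_outer s (X - F) \<le> hausdorff_outer s X + ennreal e"
      using step[of N] by (meson add_left_mono order_trans)
  qed
qed

lemma emeasure_hausdorff_measure:
  assumes s: "s > 0" and A: "A \<in> sets borel"
  shows "emeasure (hausdorff_measure s) A = hausdorff_outer s A"
proof -
  interpret P: sigma_algebra UNIV "UNIV :: 'a set set"
    using sigma_algebra_Pow[of UNIV] by simp
  let ?L = "lambda_system UNIV UNIV (hausdorff_outer s :: 'a set \<Rightarrow> ennreal)"
  have L: "measure_space UNIV ?L (hausdorff_outer s)"
    by (rule P.caratheodory_lemma[OF outer_measure_space_hausdorff[OF s]])
  then interpret L: sigma_algebra UNIV ?L by (simp add: measure_space_def)
  have cl: "F \<in> ?L" if F: "closed F" for F :: "'a set"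
    unfolding P.lambda_system_eq
  proof (intro CollectI conjI ballI UNIV_I antisym)
    fix X :: "'a set"
    show "hausdorff_outer s (X \<inter> F) + hausdorff_outer s (X - F) \<le> hausdorff_outer s X"
      by (rule hausdorff_outer_closed[OF s F])
    have "hausdorff_outer s ((X \<inter> F) \<union> (X - F))
        \<le> hausdorff_outer s (X \<inter> F) + hausdorff_outer s (X - F)"
      by (rule hausdorff_outer_Un[OF s])
    then show "hausdorff_outer s X \<le> hausdorff_outer s (X \<inter> F) + hausdorff_outer s (X - F)"
      by (simp add: Int_Diff_Un)
  qed
  have "sets (borel :: 'a measure) \<subseteq> ?L"
    unfolding borel_eq_closed using L.sigma_sets_subset[of "Collect closed"] cl by auto
  then have "measure_space UNIV (sets borel) (hausdorff_outer s :: 'a set \<Rightarrow> ennreal)"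
    using measure_down[OF L] sets.sigma_algebra_axioms[of "borel :: 'a measure"] by simp
  then show ?thesis
    unfolding hausdorff_measure_def using A
    by (intro emeasure_measure_of_sigma) (auto simp: measure_space_def)
qed


section \<open>Lebesgue spaces\<close>

text \<open>The norm takes the value \<open>\<infinity>\<close> on functions outside the space. Elements are functions, not classes.\<close>

definition Lp_norm :: "real \<Rightarrow> 'a measure \<Rightarrow> ('a \<Rightarrow> 'b::real_normed_vector) \<Rightarrow> ennreal" where
  "Lp_norm p M f =
     (let I = (\<integral>\<^sup>+ x. ennreal (norm (f x) powr p) \<partial>M)
      in if I = \<infinity> then \<infinity> else ennreal (enn2real I powr (1 / p)))"

definition Lp_space :: "real \<Rightarrow> 'a measure \<Rightarrow> ('a \<Rightarrow> 'b::real_normed_vector) set" where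
  "Lp_space p M = {f \<in> borel_measurable M. Lp_norm p M f < \<infinity>}"

definition Lp_Cauchy :: "real \<Rightarrow> 'a measure \<Rightarrow> (nat \<Rightarrow> 'a \<Rightarrow> 'b::real_normed_vector) \<Rightarrow> bool" where
  "Lp_Cauchy p M f \<longleftrightarrow>
     (\<forall>k. f k \<in> Lp_space p M) \<and>
     (\<forall>\<epsilon>>0. \<exists>N. \<forall>j\<ge>N. \<forall>k\<ge>N. Lp_norm p M (\<lambda>x. f j x - f k x) < ennreal \<epsilon>)"

definition L1_loc :: "'a::euclidean_space set \<Rightarrow> ('a \<Rightarrow> 'b::euclidean_space) set" where
  "L1_loc \<Omega> = {f. \<forall>K. compact K \<and> K \<subseteq> \<Omega> \<longrightarrow> f absolutely_integrable_on K}"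


section \<open>Distributional symmetric gradient\<close>

definition partial :: "'n \<Rightarrow> (real^'n \<Rightarrow> real) \<Rightarrow> real^'n \<Rightarrow> real" where
  "partial i \<phi> x = frechet_derivative \<phi> (at x) (axis i 1)"

primrec C_k :: "nat \<Rightarrow> (real^'n \<Rightarrow> real) \<Rightarrow> bool" where
  "C_k 0 \<phi> \<longleftrightarrow> continuous_on UNIV \<phi>"
| "C_k (Suc k) \<phi> \<longleftrightarrow> (\<forall>x. \<phi> differentiable (at x)) \<and> (\<forall>i. C_k k (partial i \<phi>))"

definition test_functions :: "(real^'n) set \<Rightarrow> (real^'n \<Rightarrow> real) set" where
  "test_functions \<Omega> =
     {\<phi>. (\<forall>k. C_k k \<phi>) \<and> compact (closure {x. \<phi> x \<noteq> 0}) \<and> closure {x. \<phi> x \<noteq> 0} \<subseteq> \<Omega>}"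

text \<open>The entry \<open>\<partial>\<^sub>j u\<^sub>i\<close> of the distributional gradient, as a functional on test functions.\<close>

definition dist_grad ::
  "(real^'n) set \<Rightarrow> (real^'n \<Rightarrow> real^'n) \<Rightarrow> 'n \<Rightarrow> 'n \<Rightarrow> (real^'n \<Rightarrow> real) \<Rightarrow> real" where
  "dist_grad \<Omega> u i j \<phi> = - (LINT x:\<Omega>|lebesgue. u x $ i * partial j \<phi> x)"

definition dist_sym_grad ::
  "(real^'n) set \<Rightarrow> (real^'n \<Rightarrow> real^'n) \<Rightarrow> 'n \<Rightarrow> 'n \<Rightarrow> (real^'n \<Rightarrow> real) \<Rightarrow> real" where
  "dist_sym_grad \<Omega> u i j \<phi> = (dist_grad \<Omega> u i j \<phi> + dist_grad \<Omega> u j i \<phi>) / 2"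

text \<open>The distribution \<open>\<E>u\<close> is given by the locally integrable matrix field \<open>E\<close>.\<close>

definition represents_sym_grad ::
  "(real^'n) set \<Rightarrow> (real^'n \<Rightarrow> real^'n) \<Rightarrow> (real^'n \<Rightarrow> real^'n^'n) \<Rightarrow> bool" where
  "represents_sym_grad \<Omega> u E \<longleftrightarrow>
     E \<in> L1_loc \<Omega> \<and>
     (\<forall>\<phi>\<in>test_functions \<Omega>. \<forall>i j.
        dist_sym_grad \<Omega> u i j \<phi> = (LINT x:\<Omega>|lebesgue. E x $ i $ j * \<phi> x))"

text \<open>
  Representatives of \<open>\<E>u\<close> agree almost everywhere in \<open>\<Omega>\<close>, so the choice does not affect integrals. It is
  only meaningful if a representative exists, as it does for \<open>u\<close> in the space \<open>E1p\<close> below.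
\<close>

definition sym_grad :: "(real^'n) set \<Rightarrow> (real^'n \<Rightarrow> real^'n) \<Rightarrow> real^'n \<Rightarrow> real^'n^'n" where
  "sym_grad \<Omega> u = (SOME E. represents_sym_grad \<Omega> u E)"

text \<open>The norm of \<open>real^'n^'n\<close>, used for \<open>|\<E>u|\<close>, is the Frobenius norm.\<close>

definition E1p :: "real \<Rightarrow> (real^'n) set \<Rightarrow> (real^'n \<Rightarrow> real^'n) set" where
  "E1p p \<Omega> =
     {u \<in> L1_loc \<Omega>. \<exists>E. represents_sym_grad \<Omega> u E \<and> E \<in> Lp_space p (lebesgue_on \<Omega>)}"


section \<open>Functions up to the boundary\<close>

text \<open>Functions on \<open>closure \<Omega>\<close> are total functions whose values outside \<open>closure \<Omega>\<close> are irrelevant.\<close>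

definition C_b :: "'a::metric_space set \<Rightarrow> ('a \<Rightarrow> 'b::real_normed_vector) set" where
  "C_b S = {u. continuous_on S u \<and> bounded {x \<in> S. u x \<noteq> 0}}"

definition boundary_measure :: "(real^'n) set \<Rightarrow> (real^'n) measure" where
  "boundary_measure \<Omega> =
     restrict_space (hausdorff_measure (real CARD('n) - 1)) (frontier \<Omega>)"

end

(*
  Along a segment from x in direction v, the derivative of u . v is v . (Eu) v. Following each ray from x to
  its first exit point from Omega and averaging over v in the unit ball gives

    |u(x)| <= C ( int_Omega |Eu(y)| |x - y|^(1-n) dy  +  average over v of |u(exit point)| ).

  The cone with vertex x over a piece of the boundary of diameter d at distance R has measure of order
  (d/R)^(n-1), so by Jensen's inequality the power p(n-1)/(n-p) of the second term is bounded by the Riesz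
  potential of |u|^(p(n-1)/(n-p)) with respect to the Hausdorff measure on the boundary. As mu has growth
  exponent alpha > n-1, both terms are bounded in L^s(mu) for every s < alpha p/(n-p), and this is used for
  some s > q. It remains to extract a subsequence that is Cauchy in L^1(K,mu) for compact K inside Omega:
  following the rays only up to distance e, u differs from a local average, up to an invertible matrix, by
  the potential of |Eu| truncated at distance 2e, which is O(e^(alpha-n+1)) in L^1(K,mu), and the local
  averages are equicontinuous because the same L^s bound holds with Lebesgue measure in place of mu.
  The segments are first handled for mollifications of u. Averaging over the unit ball instead of the
  sphere makes polar coordinates unnecessary.
*)

theory Submission
  imports Defs "HOL-Library.Diagonal_Subsequence" "HOL-Complex_Analysis.Great_Picard"
begin

section \<open>Smooth cut-off functions and mollifiers\<close>

text \<open>The symmetric gradient bounds only the component of \<open>u\<close> along the direction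
  of travel, and on a general open set it does not control the full gradient. So all estimates
  concern \<open>u \<bullet> v\<close> along \<open>v\<close>. The Hausdorff measure on the boundary
  need not be sigma-finite, so Fubini's theorem cannot be applied to it directly. Instead
  |u|^\<sigma> times this measure, with \<sigma> = p(n-1)/(n-p), is treated as one finite measure,
  and kernels are integrated against it; the symmetric gradient enters in the same way, through the
  finite measure with density |Eu|^p. Jensen's inequality for the first measure raises the kernel
  |z|^(1-n) to the power s/\<sigma>, which has exponent (n-1)s/\<sigma> = s(n-p)/p. Its
  integrability under a growth exponent \<alpha> is the condition s < \<alpha>p/(n-p). The gap
  between q and s gives equi-integrability: it absorbs the large values of differences, and also the
  part of Omega outside a compact set, where nothing is known about convergence.\<close>

definition exp_cutoff :: "nat \<Rightarrow> real \<Rightarrow> real" where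
  "exp_cutoff j t = (if t > 0 then exp (- 1 / t) / t ^ j else 0)"

text \<open>Keeps one term of the exponential series at \<open>1 / t\<close>, that of order
  \<open>j + 2\<close>. Two orders more than the denominator leave the factor \<open>t ^ 2\<close>,
  so that the difference quotient at \<open>0\<close> still tends to \<open>0\<close>.\<close>

lemma exp_cutoff_bound:
  assumes "t > 0" shows "exp_cutoff j t \<le> fact (j + 2) * t ^ 2"
proof -
  define y where "y = 1 / t"
  have y: "y > 0" using assms by (simp add: y_def)
  have "y ^ (j + 2) / fact (j + 2) \<le> exp y"
  proof -
    have s: "summable (\<lambda>n. y ^ n /\<^sub>R fact n)" by (rule summable_exp_generic)
    have "(\<Sum>n\<in>{j+2}. y ^ n /\<^sub>R fact n) \<le> (\<Sum>n. y ^ n /\<^sub>R fact n)"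
      by (rule sum_le_suminf[OF s]) (use y in auto)
    thus ?thesis by (simp add: exp_def divide_inverse mult.commute)
  qed
  hence "exp (- y) * y ^ (j + 2) \<le> fact (j + 2)"
    by (simp add: exp_minus divide_simps mult_ac)
  moreover have "exp_cutoff j t = exp (- y) * y ^ (j + 2) * t ^ 2"
    using assms by (simp add: exp_cutoff_def y_def power_add power_divide power2_eq_square)
  ultimately show ?thesis by (simp add: mult_right_mono)
qed

lemma exp_cutoff_nonneg: "exp_cutoff j t \<ge> 0"
  by (simp add: exp_cutoff_def)

text \<open>The power of \<open>t\<close> in the denominator is there for this formula: up to
  constants, derivatives stay in the family. At \<open>0\<close> the quadratic bound gives the
  derivative \<open>0\<close>, which is also the value of the right side there.\<close>

lemma DERIV_exp_cutoff:
  "(exp_cutoff j has_real_derivative (exp_cutoff (j + 2) t - real j * exp_cutoff (j + 1) t)) (at t)"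
proof (cases "t = 0")
  case True
  have "(exp_cutoff j has_real_derivative 0) (at 0)"
    unfolding has_field_derivative_def has_derivative_at_within
  proof (intro conjI)
    define c :: real where "c = fact (j + 2)"
    have c: "c \<ge> 0" by (simp add: c_def del: fact_Suc)
    have *: "\<bar>exp_cutoff j y / y\<bar> \<le> c * \<bar>y\<bar>" for y
    proof (cases "y > 0")
      case True
      have "\<bar>exp_cutoff j y / y\<bar> = exp_cutoff j y / y" using True by (simp add: exp_cutoff_def)
      also have "\<dots> \<le> (c * y ^ 2) / y"
        by (intro divide_right_mono exp_cutoff_bound[of y j, folded c_def]) (use True in auto)
      also have "\<dots> = c * \<bar>y\<bar>" using True by (simp add: power2_eq_square)
      finally show ?thesis .
    next
      case False
      have "0 \<le> c * \<bar>y\<bar>" using c by (intro mult_nonneg_nonneg) auto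
      thus ?thesis using False by (simp only: exp_cutoff_def if_False)
    qed
    have lim: "((\<lambda>y. c * \<bar>y\<bar>) \<longlongrightarrow> 0) (at 0)"
      using tendsto_mult_left[OF tendsto_rabs[OF tendsto_ident_at[of 0 UNIV]], of c] by simp
    have "\<forall>y. norm (exp_cutoff j y / y) \<le> c * \<bar>y\<bar>"
      using * unfolding real_norm_def by blast
    hence "((\<lambda>y. exp_cutoff j y / y) \<longlongrightarrow> 0) (at (0::real))"
      by (rule Lim_null_comparison[OF always_eventually lim])
    hence "((\<lambda>y. norm (exp_cutoff j y / y)) \<longlongrightarrow> 0) (at (0::real))"
      using tendsto_norm_zero by blast
    thus "((\<lambda>y. (exp_cutoff j y - exp_cutoff j 0 - 0 * (y - 0)) /\<^sub>R norm (y - 0)) \<longlongrightarrow> 0) (at 0)"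
      by (subst tendsto_norm_zero_iff[symmetric])
         (simp add: exp_cutoff_def[of _ 0] divide_inverse abs_mult mult.commute)
  qed (rule bounded_linear_mult_right)
  thus ?thesis using True by (simp add: exp_cutoff_def)
next
  case False
  show ?thesis
  proof (cases "t > 0")
    case True
    have "((\<lambda>t. exp (- 1 / t) / t ^ j) has_real_derivative
        (exp_cutoff (j + 2) t - real j * exp_cutoff (j + 1) t)) (at t)"
    proof (cases j)
      case 0
      show ?thesis unfolding 0 using True
        by (auto intro!: derivative_eq_intros simp: exp_cutoff_def power2_eq_square divide_simps)
    next
      case (Suc i)
      have "((\<lambda>t. exp (- 1 / t) / t ^ j) has_real_derivative
        ((exp (-1/t) * (1 / t^2) * t ^ j - exp (-1/t) * (real j * t ^ (j - 1))) / (t ^ j * t ^ j))) (at t)"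
        using True by (auto intro!: derivative_eq_intros simp: power2_eq_square)
      moreover have "(exp (-1/t) * (1 / t^2) * t ^ j - exp (-1/t) * (real j * t ^ (j - 1))) / (t ^ j * t ^ j)
         = exp_cutoff (j + 2) t - real j * exp_cutoff (j + 1) t"
        using True by (simp add: exp_cutoff_def Suc divide_simps power2_eq_square) (simp add: algebra_simps)
      ultimately show ?thesis by simp
    qed
    thus ?thesis
      by (rule DERIV_cong_ev[THEN iffD1, rotated -1, OF _ refl])
         (use eventually_nhds_in_open[of "{0<..}" t] True in
           \<open>auto elim!: eventually_mono simp: exp_cutoff_def\<close>)
  next
    case F: False
    have "((\<lambda>t. 0) has_real_derivative (exp_cutoff (j + 2) t - real j * exp_cutoff (j + 1) t)) (at t)"
      using F by (simp add: exp_cutoff_def)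
    thus ?thesis
      by (rule DERIV_cong_ev[THEN iffD1, rotated -1, OF _ refl])
         (use eventually_nhds_in_open[of "{..<0}" t] F False in
           \<open>auto elim!: eventually_mono simp: exp_cutoff_def\<close>)
  qed
qed

lemma DERIV_exp_cutoff_0: "(exp_cutoff 0 has_real_derivative exp_cutoff 2 t) (at t)"
  using DERIV_exp_cutoff[of 0 t] by (simp only: add_0 of_nat_0 mult_zero_left diff_0_right)

lemma continuous_on_exp_cutoff: "continuous_on S (exp_cutoff j)"
  by (intro continuous_at_imp_continuous_on ballI DERIV_isCont[OF DERIV_exp_cutoff])

text \<open>A class of expressions that contains the mollifier and whose partial derivatives are
  again expressions. Membership in every \<open>C_k\<close> then follows by induction on
  \<open>k\<close> with the function kept arbitrary.\<close>

inductive smooth_expr :: "(real^'n \<Rightarrow> real) \<Rightarrow> bool" where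
  const: "smooth_expr (\<lambda>x. c)"
| coord: "smooth_expr (\<lambda>x. x $ i)"
| add: "smooth_expr f \<Longrightarrow> smooth_expr g \<Longrightarrow> smooth_expr (\<lambda>x. f x + g x)"
| mult: "smooth_expr f \<Longrightarrow> smooth_expr g \<Longrightarrow> smooth_expr (\<lambda>x. f x * g x)"
| cutoff: "smooth_expr f \<Longrightarrow> smooth_expr (\<lambda>x. exp_cutoff j (f x))"

lemma smooth_expr_sum: "(\<And>i. i \<in> A \<Longrightarrow> smooth_expr (f i)) \<Longrightarrow> smooth_expr (\<lambda>x. \<Sum>i\<in>A. f i x)"
  by (induction A rule: infinite_finite_induct) (auto intro: smooth_expr.intros)

lemma smooth_expr_deriv:
  assumes "smooth_expr f"
  shows "\<exists>D. (\<forall>x. (f has_derivative D x) (at x)) \<and> (\<forall>i. smooth_expr (\<lambda>x. D x (axis i 1)))"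
  using assms
proof induction
  case (const c)
  show ?case by (rule exI[of _ "\<lambda>x h. 0"]) (auto intro: smooth_expr.intros)
next
  case (coord i)
  show ?case
    by (rule exI[of _ "\<lambda>x h. h $ i"])
       (auto intro!: smooth_expr.intros bounded_linear_imp_has_derivative bounded_linear_vec_nth)
next
  case (add f g)
  then obtain D E where *: "\<And>x. (f has_derivative D x) (at x)" "\<And>x. (g has_derivative E x) (at x)"
    "\<And>i. smooth_expr (\<lambda>x. D x (axis i 1))" "\<And>i. smooth_expr (\<lambda>x. E x (axis i 1))" by blast
  show ?case
    by (rule exI[of _ "\<lambda>x h. D x h + E x h"])
       (auto intro!: smooth_expr.intros * has_derivative_add)
next
  case (mult f g)
  then obtain D E where *: "\<And>x. (f has_derivative D x) (at x)" "\<And>x. (g has_derivative E x) (at x)"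
    "\<And>i. smooth_expr (\<lambda>x. D x (axis i 1))" "\<And>i. smooth_expr (\<lambda>x. E x (axis i 1))" by blast
  show ?case
    by (rule exI[of _ "\<lambda>x h. f x * E x h + D x h * g x"])
       (auto intro!: smooth_expr.intros mult * has_derivative_mult)
next
  case (cutoff f j)
  then obtain D where *: "\<And>x. (f has_derivative D x) (at x)"
    "\<And>i. smooth_expr (\<lambda>x. D x (axis i 1))" by blast
  have "((\<lambda>x. exp_cutoff j (f x)) has_derivative
      (\<lambda>h. (exp_cutoff (j + 2) (f x) + (- real j) * exp_cutoff (j + 1) (f x)) * D x h)) (at x)" for x
    using DERIV_compose_FDERIV[OF DERIV_exp_cutoff[of j "f x"] *(1)[of x]]
    by (simp add: mult.commute)
  moreover have "smooth_expr (\<lambda>x. (exp_cutoff (j + 2) (f x) + (- real j) * exp_cutoff (j + 1) (f x)) * D x (axis i 1))" for i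
    by (intro smooth_expr.intros cutoff *)
  ultimately show ?case
    by (intro exI[of _ "\<lambda>x h. (exp_cutoff (j + 2) (f x) + (- real j) * exp_cutoff (j + 1) (f x)) * D x h"])
       blast
qed

lemma smooth_expr_C_k: "smooth_expr f \<Longrightarrow> C_k k f"
proof (induction k arbitrary: f)
  case 0
  then obtain D where "\<And>x. (f has_derivative D x) (at x)" using smooth_expr_deriv by blast
  then show ?case
    by (auto intro!: continuous_at_imp_continuous_on has_derivative_continuous)
next
  case (Suc k)
  then obtain D where D: "\<And>x. (f has_derivative D x) (at x)" "\<And>i. smooth_expr (\<lambda>x. D x (axis i 1))"
    using smooth_expr_deriv by blast
  have "partial i f = (\<lambda>x. D x (axis i 1))" for i
    using frechet_derivative_at[OF D(1)] by (auto simp: partial_def fun_eq_iff)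
  then show ?case using D Suc.IH by (auto simp: differentiable_def)
qed


section \<open>The standard mollifier\<close>

definition moll_const :: "'a::euclidean_space itself \<Rightarrow> real" where
  "moll_const _ = (LINT z::'a|lborel. exp_cutoff 0 (1 - (norm z)\<^sup>2))"

text \<open>The norm enters squared, hence as a polynomial in the coordinates, which keeps the bump
  smooth at the origin. It vanishes where \<open>norm z\<close> is at least \<open>d\<close>, and
  its integral is \<open>1\<close>.\<close>

definition moll :: "real \<Rightarrow> 'a::euclidean_space \<Rightarrow> real" where
  "moll d z = exp_cutoff 0 (1 - (norm z / d)\<^sup>2) / (d ^ DIM('a) * moll_const TYPE('a))"

definition moll_deriv :: "real \<Rightarrow> 'a::euclidean_space \<Rightarrow> 'a \<Rightarrow> real" where
  "moll_deriv d z h = exp_cutoff 2 (1 - (norm z / d)\<^sup>2) * (- 2 * (z \<bullet> h) / d\<^sup>2)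
     / (d ^ DIM('a) * moll_const TYPE('a))"

lemma exp_cutoff_eq_0: "t \<le> 0 \<Longrightarrow> exp_cutoff j t = 0"
  by (simp add: exp_cutoff_def)

lemma exp_cutoff_0_le_1: "exp_cutoff 0 t \<le> 1"
  by (simp add: exp_cutoff_def)

lemma bump_integrable: "integrable lborel (\<lambda>z::'a::euclidean_space. exp_cutoff 0 (1 - (norm z)\<^sup>2))"
proof -
  have "integrable lborel (\<lambda>z::'a. indicator (cball 0 1) z *\<^sub>R exp_cutoff 0 (1 - (norm z)\<^sup>2))"
    by (intro borel_integrable_compact continuous_on_compose2[OF continuous_on_exp_cutoff[of UNIV]]
        continuous_intros) auto
  moreover have "(\<lambda>z::'a. indicator (cball 0 1) z *\<^sub>R exp_cutoff 0 (1 - (norm z)\<^sup>2)) = (\<lambda>z. exp_cutoff 0 (1 - (norm z)\<^sup>2))"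
  proof
    fix z :: 'a
    have "1 - (norm z)\<^sup>2 \<le> 0" if "norm z > 1" using that one_le_power[of "norm z" 2] by simp
    thus "indicator (cball 0 1) z *\<^sub>R exp_cutoff 0 (1 - (norm z)\<^sup>2) = exp_cutoff 0 (1 - (norm z)\<^sup>2)"
      by (cases "norm z \<le> 1") (auto simp: exp_cutoff_eq_0 simp del: diff_le_0_iff_le)
  qed
  ultimately show ?thesis by (rule back_subst[of "integrable lborel"])
qed

lemma moll_const_pos: "moll_const TYPE('a::euclidean_space) > 0"
proof -
  \<comment> \<open>On the ball of radius \<open>1/2\<close> the argument of the cut-off is at least
    \<open>3/4\<close>, where its value is \<open>exp (- 4 / 3)\<close>.\<close>
  have "(LINT z::'a|lborel. indicator (ball 0 (1/2)) z * exp (- 4 / 3)) \<le> moll_const TYPE('a)"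
    unfolding moll_const_def
  proof (rule integral_mono[OF _ bump_integrable])
    show "integrable lborel (\<lambda>z::'a. indicator (ball 0 (1/2)) z * exp (- 4 / 3) :: real)"
      by (intro integrable_mult_left integrable_real_indicator) (use emeasure_lborel_ball_finite[of 0 "1/2"] in auto)
    fix z :: 'a
    show "indicator (ball 0 (1/2)) z * exp (- 4 / 3) \<le> exp_cutoff 0 (1 - (norm z)\<^sup>2)"
    proof (cases "norm z < 1 / 2")
      case True
      hence "(norm z)\<^sup>2 \<le> (1/2)\<^sup>2" by (intro power_mono) auto
      hence *: "1 - (norm z)\<^sup>2 \<ge> 3 / 4" by (simp add: power2_eq_square)
      hence "1 / (1 - (norm z)\<^sup>2) \<le> 4 / 3" by (simp add: field_simps)
      thus ?thesis using * True by (simp add: exp_cutoff_def)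
    qed (simp add: exp_cutoff_nonneg)
  qed
  moreover have "(LINT z::'a|lborel. indicator (ball 0 (1/2)) z * exp (- 4 / 3)) > (0::real)"
    by (simp add: content_ball_pos mult_pos_pos)
  ultimately show ?thesis by linarith
qed

lemma moll_nonneg: "d > 0 \<Longrightarrow> moll d z \<ge> 0"
  unfolding moll_def using moll_const_pos[where 'a='a]
  by (intro divide_nonneg_nonneg exp_cutoff_nonneg mult_nonneg_nonneg) (auto intro: less_imp_le)

lemma moll_le:
  "d > 0 \<Longrightarrow> moll d (z::'a::euclidean_space) \<le> 1 / (d ^ DIM('a) * moll_const TYPE('a))"
  unfolding moll_def using moll_const_pos[where 'a='a]
  by (intro divide_right_mono exp_cutoff_0_le_1 mult_nonneg_nonneg) (auto intro: less_imp_le)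

lemma moll_arg_nonpos: "d > 0 \<Longrightarrow> norm z \<ge> d \<Longrightarrow> 1 - (norm z / d)\<^sup>2 \<le> 0"
  by (simp add: power_divide divide_simps power_mono)

lemma moll_eq_0: "d > 0 \<Longrightarrow> norm z \<ge> d \<Longrightarrow> moll d z = 0"
  by (simp add: moll_def exp_cutoff_eq_0 moll_arg_nonpos del: diff_le_0_iff_le)

lemma moll_deriv_eq_0: "d > 0 \<Longrightarrow> norm z \<ge> d \<Longrightarrow> moll_deriv d z h = 0"
  by (simp add: moll_deriv_def exp_cutoff_eq_0 moll_arg_nonpos del: diff_le_0_iff_le)

lemma moll_minus [simp]: "moll d (- z) = moll d z"
  by (simp add: moll_def)

lemma moll_measurable [measurable]: "moll d \<in> borel_measurable borel"
  unfolding moll_def divide_inverse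
  by (intro borel_measurable_times borel_measurable_continuous_onI
      continuous_on_compose2[OF continuous_on_exp_cutoff[of UNIV]] continuous_intros) auto

lemma continuous_on_moll_deriv: "continuous_on S f \<Longrightarrow> continuous_on S (\<lambda>z. moll_deriv d (f z) h)"
  unfolding moll_deriv_def divide_inverse
  by (intro continuous_intros continuous_on_compose2[OF continuous_on_exp_cutoff[of UNIV]]) auto

lemma nn_integral_lborel_scale:
  fixes f :: "'a::euclidean_space \<Rightarrow> ennreal"
  assumes [measurable]: "f \<in> borel_measurable borel" and c: "c \<noteq> 0"
  shows "(\<integral>\<^sup>+z. f z \<partial>lborel) = ennreal (\<bar>c\<bar> ^ DIM('a)) * (\<integral>\<^sup>+z. f (a + c *\<^sub>R z) \<partial>lborel)"
  by (subst lborel_affine[OF c, of a])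
     (simp add: nn_integral_density nn_integral_distr nn_integral_cmult)

lemma moll_integral:
  assumes d: "d > 0"
  shows "(\<integral>\<^sup>+z. ennreal (moll d (z::'a::euclidean_space)) \<partial>lborel) = 1"
proof -
  let ?c = "moll_const TYPE('a)"
  have c: "?c > 0" by (rule moll_const_pos)
  have "(\<integral>\<^sup>+z. ennreal (moll d (z::'a)) \<partial>lborel)
     = ennreal (d ^ DIM('a)) * (\<integral>\<^sup>+z. ennreal (moll d (0 + d *\<^sub>R z::'a)) \<partial>lborel)"
    using d by (subst nn_integral_lborel_scale[of _ d 0]) auto
  also have "(\<integral>\<^sup>+z. ennreal (moll d (0 + d *\<^sub>R z::'a)) \<partial>lborel)
     = (\<integral>\<^sup>+z. ennreal (1 / (d ^ DIM('a) * ?c)) * ennreal (exp_cutoff 0 (1 - (norm (z::'a))\<^sup>2)) \<partial>lborel)"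
    using d c by (intro nn_integral_cong) (simp add: moll_def exp_cutoff_nonneg flip: ennreal_mult)
  also have "\<dots> = ennreal (1 / (d ^ DIM('a) * ?c)) * (\<integral>\<^sup>+z. ennreal (exp_cutoff 0 (1 - (norm (z::'a))\<^sup>2)) \<partial>lborel)"
    by (intro nn_integral_cmult measurable_compose[OF _ measurable_ennreal]
        borel_measurable_integrable[OF bump_integrable])
  also have "(\<integral>\<^sup>+z. ennreal (exp_cutoff 0 (1 - (norm (z::'a))\<^sup>2)) \<partial>lborel) = ennreal ?c"
    unfolding moll_const_def by (rule nn_integral_eq_integral[OF bump_integrable]) (simp add: exp_cutoff_nonneg)
  also have "ennreal (d ^ DIM('a)) * (ennreal (1 / (d ^ DIM('a) * ?c)) * ennreal ?c) = 1"
    using d c by (simp flip: ennreal_mult)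
  finally show ?thesis .
qed

lemma moll_has_derivative:
  assumes d: "d > 0"
  shows "(moll d has_derivative moll_deriv d z) (at (z::'a::euclidean_space))"
proof -
  let ?K = "d ^ DIM('a) * moll_const TYPE('a)"
  have "((\<lambda>z::'a. 1 - (z \<bullet> z) / d\<^sup>2) has_derivative (\<lambda>h. - 2 * (z \<bullet> h) / d\<^sup>2)) (at z)"
    unfolding divide_inverse
    by (rule derivative_eq_intros refl)+ (simp add: inner_commute algebra_simps)
  from DERIV_compose_FDERIV[OF DERIV_exp_cutoff_0 this]
  have "((\<lambda>z. exp_cutoff 0 (1 - (z \<bullet> z) / d\<^sup>2) * (1 / ?K)) has_derivative
      (\<lambda>h. (- 2 * (z \<bullet> h) / d\<^sup>2) * exp_cutoff 2 (1 - (z \<bullet> z) / d\<^sup>2) * (1 / ?K))) (at z)"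
    by (rule has_derivative_mult_left)
  moreover have "moll d = (\<lambda>z::'a. exp_cutoff 0 (1 - (z \<bullet> z) / d\<^sup>2) * (1 / ?K))"
    by (simp add: moll_def fun_eq_iff power_divide power2_norm_eq_inner)
  moreover have "moll_deriv d z = (\<lambda>h. (- 2 * (z \<bullet> h) / d\<^sup>2) * exp_cutoff 2 (1 - (z \<bullet> z) / d\<^sup>2) * (1 / ?K))"
    by (simp add: moll_deriv_def fun_eq_iff power_divide power2_norm_eq_inner)
  ultimately show ?thesis by simp
qed

lemma moll_translate_has_derivative:
  assumes d: "d > 0"
  shows "((\<lambda>w. moll d (y - w)) has_derivative (\<lambda>h. - moll_deriv d (y - w) h)) (at (w::'a::euclidean_space))"
proof -
  have "((\<lambda>w. moll d (y - w)) has_derivative (\<lambda>h. moll_deriv d (y - w) (- h))) (at w)"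
    by (rule has_derivative_compose[OF _ moll_has_derivative[OF d]]) (rule derivative_eq_intros refl | simp)+
  thus ?thesis by (simp add: moll_deriv_def)
qed

lemma smooth_expr_moll: "smooth_expr (\<lambda>w::real^'n. moll d (y - w))"
proof -
  \<comment> \<open>Differences and quotients are expressed by constant factors, since
    \<open>smooth_expr\<close> provides only sums and products.\<close>
  have "smooth_expr (\<lambda>w::real^'n. exp_cutoff 0 (1 + (- 1 / d\<^sup>2) * (\<Sum>i\<in>UNIV. (y $ i + (-1) * w $ i) * (y $ i + (-1) * w $ i)))
     * (1 / (d ^ DIM(real^'n) * moll_const TYPE(real^'n))))"
    by (intro smooth_expr.intros smooth_expr_sum)
  also have "(\<lambda>w::real^'n. exp_cutoff 0 (1 + (- 1 / d\<^sup>2) * (\<Sum>i\<in>UNIV. (y $ i + (-1) * w $ i) * (y $ i + (-1) * w $ i)))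
     * (1 / (d ^ DIM(real^'n) * moll_const TYPE(real^'n)))) = (\<lambda>w. moll d (y - w))"
    by (rule ext) (simp add: moll_def power_divide power2_norm_eq_inner inner_vec_def)
  finally show ?thesis .
qed

lemma moll_test_function:
  assumes "d > 0" "cball y d \<subseteq> \<Omega>"
  shows "(\<lambda>w::real^'n. moll d (y - w)) \<in> test_functions \<Omega>"
proof -
  have "closure {w. moll d (y - w) \<noteq> 0} \<subseteq> cball y d"
  proof (rule closure_minimal)
    show "{w. moll d (y - w) \<noteq> 0} \<subseteq> cball y d"
    proof clarify
      fix w assume "moll d (y - w) \<noteq> 0"
      thus "w \<in> cball y d" using moll_eq_0[OF assms(1), of "y - w"] by (cases "d \<le> norm (y - w)") (auto simp: dist_norm)
    qed
  qed auto
  moreover from this have "compact (closure {w. moll d (y - w) \<noteq> 0})"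
    using compact_Int_closed[OF compact_cball[of y d] closed_closure, of "{w. moll d (y - w) \<noteq> 0}"]
    by (simp add: Int_absorb1)
  ultimately show ?thesis
    using assms smooth_expr_C_k[OF smooth_expr_moll] by (auto simp: test_functions_def)
qed

section \<open>The symmetric gradient along segments\<close>

text \<open>All that is used of the distribution \<open>\<E>u\<close>: tested with \<open>v v\<^sup>T\<close> it is dominated by a function \<open>g\<close>.\<close>

definition sym_grad_bound ::
  "(real^'n) set \<Rightarrow> (real^'n \<Rightarrow> real^'n) \<Rightarrow> (real^'n \<Rightarrow> ennreal) \<Rightarrow> bool" where
  "sym_grad_bound \<Omega> u g \<longleftrightarrow>
     (\<forall>\<phi>\<in>test_functions \<Omega>. (\<forall>x. 0 \<le> \<phi> x) \<longrightarrow>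
       (\<forall>v. ennreal \<bar>LINT w:\<Omega>|lebesgue. (u w \<bullet> v) * frechet_derivative \<phi> (at w) v\<bar>
          \<le> ennreal ((norm v)\<^sup>2) * (\<integral>\<^sup>+w. g w * ennreal (\<phi> w) \<partial>lborel)))"

definition moll_fun :: "real \<Rightarrow> ('a::euclidean_space \<Rightarrow> ennreal) \<Rightarrow> 'a \<Rightarrow> ennreal" where
  "moll_fun d g y = (\<integral>\<^sup>+w. g w * ennreal (moll d (y - w)) \<partial>lborel)"

lemma moll_fun_measurable [measurable]:
  assumes [measurable]: "g \<in> borel_measurable borel"
  shows "moll_fun d g \<in> borel_measurable borel"
  unfolding moll_fun_def by measurable

text \<open>Distributions are tested with Lebesgue measure on \<Omega>, while Fubini's theorem is
  used for Borel functions and \<open>lborel\<close>. Nothing is known of \<open>f\<close> off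
  \<Omega>, so it is cut off to \<open>K\<close>, outside which \<open>h\<close> vanishes.\<close>

lemma set_lebesgue_integral_eq_compact:
  fixes f h :: "'a::euclidean_space \<Rightarrow> real"
  assumes "K \<subseteq> \<Omega>" "(\<lambda>w. indicator K w * f w) \<in> borel_measurable borel" "h \<in> borel_measurable borel"
    and "\<And>w. w \<notin> K \<Longrightarrow> h w = 0"
  shows "(LINT w:\<Omega>|lebesgue. f w * h w) = (LINT w|lborel. (indicator K w * f w) * h w)"
proof -
  have "(LINT w:\<Omega>|lebesgue. f w * h w) = (LINT w|lebesgue. (indicator K w * f w) * h w)"
    unfolding set_lebesgue_integral_def
    by (rule Bochner_Integration.integral_cong) (use assms(1,4) in \<open>auto split: split_indicator\<close>)
  also have "\<dots> = (LINT w|lborel. (indicator K w * f w) * h w)"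
    by (rule integral_completion) (use assms in simp)
  finally show ?thesis .
qed

lemma moll_deriv_measurable [measurable]: "(\<lambda>z. moll_deriv d z h) \<in> borel_measurable borel"
  by (intro borel_measurable_continuous_onI continuous_on_moll_deriv continuous_intros)

lemma moll_line_integral:
  assumes "d > 0" "T \<ge> 0"
  shows "(LINT t|lborel. indicator {0..T} t * moll_deriv d (x + t *\<^sub>R v - w) v)
     = moll d (x + T *\<^sub>R v - w) - moll d (x - w)"
proof -
  have "((\<lambda>t. moll d (x + t *\<^sub>R v - w)) has_vector_derivative moll_deriv d (x + t *\<^sub>R v - w) v)
      (at t within {0..T})" for t
  proof -
    have "((\<lambda>t. x + t *\<^sub>R v - w) has_derivative (\<lambda>h. h *\<^sub>R v)) (at t within {0..T})"
      by (auto intro!: derivative_eq_intros)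
    from has_derivative_compose[OF this moll_has_derivative[OF assms(1)]]
    show ?thesis by (simp add: has_vector_derivative_def moll_deriv_def mult_ac)
  qed
  from integral_FTC_Icc[OF assms(2) this continuous_on_moll_deriv]
  have "(LINT t|lborel. indicator {0..T} t *\<^sub>R moll_deriv d (x + t *\<^sub>R v - w) v)
     = moll d (x + T *\<^sub>R v - w) - moll d (x + 0 *\<^sub>R v - w)"
    by (simp add: continuous_intros)
  thus ?thesis by simp
qed

text \<open>The \<open>t\<close>-derivative of the mollifier centred at
  \<open>x + t *\<^sub>R v\<close> is its derivative in direction \<open>v\<close>. By Fubini's
  theorem the difference of the mollified values at the two ends is an integral over
  \<open>t\<close> of \<open>u \<bullet> v\<close> tested with a derivative in the same direction
  \<open>v\<close>, which is what \<open>sym_grad_bound\<close> controls.\<close>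

lemma mollified_line_bound:
  fixes u :: "real^'n \<Rightarrow> real^'n"
  assumes sgb: "sym_grad_bound \<Omega> u g" and u: "continuous_on \<Omega> u"
    and [measurable]: "g \<in> borel_measurable borel"
    and d: "d > 0" and T: "T \<ge> 0" and K: "\<And>t. t \<in> {0..T} \<Longrightarrow> cball (x + t *\<^sub>R v) d \<subseteq> \<Omega>"
  shows "ennreal \<bar>(LINT w:\<Omega>|lebesgue. (u w \<bullet> v) * moll d (x + T *\<^sub>R v - w))
       - (LINT w:\<Omega>|lebesgue. (u w \<bullet> v) * moll d (x - w))\<bar>
     \<le> ennreal ((norm v)\<^sup>2) * (\<integral>\<^sup>+t. indicator {0..T} t * moll_fun d g (x + t *\<^sub>R v) \<partial>lborel)"
proof -
  \<comment> \<open>The closed \<open>d\<close>-neighbourhood of the segment: it contains the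
    supports of all mollifiers centred on the segment, and it is compact.\<close>
  define K where "K = (\<Union>t\<in>{0..T}. cball (x + t *\<^sub>R v) d)"
  have K_eq: "K = (\<lambda>(t, z). x + t *\<^sub>R v + z) ` ({0..T} \<times> cball 0 d)"
    unfolding K_def by (force simp: dist_norm image_iff norm_minus_commute Bex_def)
  have cK: "compact K"
    unfolding K_eq split_beta by (intro compact_continuous_image continuous_intros compact_Times compact_Icc compact_cball)
  have KO: "K \<subseteq> \<Omega>" using K unfolding K_def by blast
  define U where "U w = indicator K w * (u w \<bullet> v)" for w
  have contU: "continuous_on K (\<lambda>w. u w \<bullet> v)"
    by (intro continuous_intros continuous_on_subset[OF u KO])
  have iU: "integrable lborel U"
    using borel_integrable_compact[OF cK contU] by (simp add: U_def[abs_def])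
  hence [measurable]: "U \<in> borel_measurable borel" by (simp add: borel_measurable_integrable)
  have conv: "(LINT w:\<Omega>|lebesgue. (u w \<bullet> v) * h w) = (LINT w|lborel. U w * h w)"
    if "h \<in> borel_measurable borel" "\<And>w. w \<notin> cball (x + t *\<^sub>R v) d \<Longrightarrow> h w = 0" "t \<in> {0..T}" for h t
    unfolding U_def
  proof (rule set_lebesgue_integral_eq_compact[OF KO])
    show "(\<lambda>w. indicator K w * (u w \<bullet> v)) \<in> borel_measurable borel"
      using \<open>U \<in> borel_measurable borel\<close> by (simp add: U_def[abs_def])
    show "h w = 0" if "w \<notin> K" for w using that \<open>t \<in> _\<close> by (intro \<open>\<And>w. w \<notin> _ \<Longrightarrow> h w = 0\<close>) (auto simp: K_def)
  qed fact
  define H where "H t w = indicator {0..T} t * (U w * moll_deriv d (x + t *\<^sub>R v - w) v)" for t w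
  \<comment> \<open>The integrand is continuous on the compact set \<open>{0..T} \<times> K\<close>,
    hence integrable for the product measure; this is the hypothesis of Fubini's theorem
    below.\<close>
  have Hint: "integrable (lborel \<Otimes>\<^sub>M lborel) (\<lambda>(t, w). H t w)"
  proof -
    have "integrable lborel (\<lambda>p::real \<times> (real^'n). indicator ({0..T} \<times> K) p *\<^sub>R
        ((u (snd p) \<bullet> v) * moll_deriv d (x + fst p *\<^sub>R v - snd p) v))"
      by (intro borel_integrable_compact compact_Times compact_Icc cK continuous_on_mult
           continuous_on_moll_deriv continuous_intros continuous_on_compose2[OF contU]) auto
    also have "(\<lambda>p::real \<times> (real^'n). indicator ({0..T} \<times> K) p *\<^sub>R
        ((u (snd p) \<bullet> v) * moll_deriv d (x + fst p *\<^sub>R v - snd p) v)) = (\<lambda>(t, w). H t w)"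
      by (auto simp: H_def U_def fun_eq_iff split: split_indicator)
    finally show ?thesis by (simp add: lborel_prod)
  qed
  have "(LINT w:\<Omega>|lebesgue. (u w \<bullet> v) * moll d (x + T *\<^sub>R v - w))
       - (LINT w:\<Omega>|lebesgue. (u w \<bullet> v) * moll d (x - w))
     = (LINT w|lborel. U w * moll d (x + T *\<^sub>R v - w)) - (LINT w|lborel. U w * moll d (x - w))"
    using T d moll_eq_0[OF d]
    by (subst (1) conv[of _ T], simp, force simp: dist_norm, simp)
       (subst (1) conv[of _ 0], simp, force simp: dist_norm, simp, simp)
  also have "\<dots> = (LINT w|lborel. U w * moll d (x + T *\<^sub>R v - w) - U w * moll d (x - w))"
  proof (rule Bochner_Integration.integral_diff[symmetric])
    have "integrable lborel (\<lambda>w. U w * moll d (y - w))" for y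
    proof (rule Bochner_Integration.integrable_bound)
      show "integrable lborel (\<lambda>w. U w * (1 / (d ^ DIM(real^'n) * moll_const TYPE(real^'n))))"
        by (intro integrable_mult_left iU)
      show "AE w in lborel. norm (U w * moll d (y - w))
          \<le> norm (U w * (1 / (d ^ DIM(real^'n) * moll_const TYPE(real^'n))))"
      proof (intro AE_I2)
        fix w
        have "norm (moll d (y - w)) \<le> norm (1 / (d ^ DIM(real^'n) * moll_const TYPE(real^'n)))"
          unfolding real_norm_def abs_of_nonneg[OF moll_nonneg[OF d]]
          by (rule order_trans[OF moll_le[OF d] abs_ge_self])
        thus "norm (U w * moll d (y - w)) \<le> norm (U w * (1 / (d ^ DIM(real^'n) * moll_const TYPE(real^'n))))"
          unfolding norm_mult by (rule mult_left_mono) simp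
      qed
    qed simp
    thus "integrable lborel (\<lambda>w. U w * moll d (x + T *\<^sub>R v - w))" "integrable lborel (\<lambda>w. U w * moll d (x - w))"
      by auto
  qed
  also have "\<dots> = (LINT w|lborel. LINT t|lborel. H t w)"
  proof (intro Bochner_Integration.integral_cong refl)
    fix w
    have "(LINT t|lborel. H t w) = U w * (LINT t|lborel. indicator {0..T} t * moll_deriv d (x + t *\<^sub>R v - w) v)"
      by (simp add: H_def mult.left_commute[of _ "U w"])
    thus "U w * moll d (x + T *\<^sub>R v - w) - U w * moll d (x - w) = (LINT t|lborel. H t w)"
      by (simp add: moll_line_integral[OF d T] right_diff_distrib)
  qed
  also have "\<dots> = (LINT t|lborel. LINT w|lborel. H t w)"
    by (rule lborel_pair.Fubini_integral[OF Hint])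
  finally have eq: "(LINT w:\<Omega>|lebesgue. (u w \<bullet> v) * moll d (x + T *\<^sub>R v - w))
       - (LINT w:\<Omega>|lebesgue. (u w \<bullet> v) * moll d (x - w)) = (LINT t|lborel. LINT w|lborel. H t w)" .
  have "integrable lborel (\<lambda>t. LINT w|lborel. H t w)"
    using lborel_pair.integrable_fst'[OF Hint] by simp
  hence "ennreal (norm (LINT t|lborel. LINT w|lborel. H t w))
      \<le> (\<integral>\<^sup>+t. ennreal (norm (LINT w|lborel. H t w)) \<partial>lborel)"
    by (rule integral_norm_bound_ennreal)
  also have "\<dots> \<le> (\<integral>\<^sup>+t. ennreal ((norm v)\<^sup>2) * (indicator {0..T} t * moll_fun d g (x + t *\<^sub>R v)) \<partial>lborel)"
  proof (rule nn_integral_mono)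
    fix t :: real
    show "ennreal (norm (LINT w|lborel. H t w)) \<le> ennreal ((norm v)\<^sup>2) * (indicator {0..T} t * moll_fun d g (x + t *\<^sub>R v))"
    proof (cases "t \<in> {0..T}")
      case True
      let ?y = "x + t *\<^sub>R v"
      \<comment> \<open>Here \<open>w\<close> enters through \<open>?y - w\<close>; the resulting
        sign disappears under the absolute value.\<close>
      have "frechet_derivative (\<lambda>w. moll d (?y - w)) (at w) v = - moll_deriv d (?y - w) v" for w
        using frechet_derivative_at[OF moll_translate_has_derivative[OF d, of ?y w]] by (simp add: fun_eq_iff)
      moreover have "(LINT w:\<Omega>|lebesgue. (u w \<bullet> v) * (- moll_deriv d (?y - w) v)) = - (LINT w|lborel. H t w)"
      proof -
        have "(LINT w:\<Omega>|lebesgue. (u w \<bullet> v) * (- moll_deriv d (?y - w) v))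
            = (LINT w|lborel. U w * (- moll_deriv d (?y - w) v))"
          by (rule conv[OF _ _ True]) (simp_all add: dist_norm moll_deriv_eq_0[OF d])
        also have "\<dots> = - (LINT w|lborel. H t w)" using True by (simp add: H_def)
        finally show ?thesis .
      qed
      ultimately have "\<bar>LINT w:\<Omega>|lebesgue. (u w \<bullet> v) * frechet_derivative (\<lambda>w. moll d (?y - w)) (at w) v\<bar>
          = norm (LINT w|lborel. H t w)" by simp
      moreover have "(\<lambda>w. moll d (?y - w)) \<in> test_functions \<Omega>"
        by (rule moll_test_function[OF d K[OF True]])
      ultimately show ?thesis
        using sgb[unfolded sym_grad_bound_def, rule_format, of "\<lambda>w. moll d (?y - w)" v, OF _ moll_nonneg[OF d]] True
        by (simp add: moll_fun_def)
    qed (simp add: H_def)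
  qed
  also have "\<dots> = ennreal ((norm v)\<^sup>2) * (\<integral>\<^sup>+t. indicator {0..T} t * moll_fun d g (x + t *\<^sub>R v) \<partial>lborel)"
    by (rule nn_integral_cmult) measurable
  finally show ?thesis unfolding eq by simp
qed

section \<open>Riesz kernels\<close>

text \<open>The value at the origin is \<open>0\<close>; it only matters up to null sets.\<close>

definition riesz :: "real \<Rightarrow> 'a::euclidean_space \<Rightarrow> ennreal" where
  "riesz \<gamma> z = ennreal (norm z powr (- \<gamma>))"

lemma riesz_measurable [measurable]: "riesz \<gamma> \<in> borel_measurable borel"
  unfolding riesz_def by measurable

lemma riesz_minus_commute: "riesz \<gamma> (x - y) = riesz \<gamma> (y - x)"
  by (simp add: riesz_def norm_minus_commute)

lemma suminf_geometric_ennreal: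
  fixes b :: real
  assumes "0 \<le> b" "b < 1" "0 \<le> c"
  shows "(\<Sum>k. ennreal (c * b ^ k)) = ennreal (c / (1 - b))"
proof (rule suminf_ennreal_eq)
  show "(\<lambda>k. c * b ^ k) sums (c / (1 - b))"
    using sums_mult[OF geometric_sums[of b], of c] assms by simp
qed (use assms in auto)

text \<open>The summation common to the two dyadic estimates below: \<open>c k\<close> bounds the
  kernel on the shell with index \<open>k\<close>, \<open>m k\<close> the measure of a ball
  containing it, and their products form a geometric series.\<close>

lemma nn_integral_suminf_indicator_le:
  assumes meas: "sets M = sets (borel :: 'a::euclidean_space measure)"
    and pt: "\<And>x. f x \<le> (\<Sum>k. ennreal (c k) * indicator (ball y (r k)) x)"
    and ball: "\<And>k. emeasure M (ball y (r k)) \<le> ennreal (m k)"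
    and nonneg: "\<And>k. 0 \<le> c k" "\<And>k. 0 \<le> m k" and prod: "\<And>k. c k * m k = C * b ^ k"
    and b: "0 \<le> b" "b < 1" "0 \<le> C"
  shows "(\<integral>\<^sup>+x. f x \<partial>M) \<le> ennreal (C / (1 - b))"
proof -
  note [measurable_cong] = meas
  have "(\<integral>\<^sup>+x. f x \<partial>M) \<le> (\<integral>\<^sup>+x. (\<Sum>k. ennreal (c k) * indicator (ball y (r k)) x) \<partial>M)"
    by (intro nn_integral_mono pt)
  also have "\<dots> = (\<Sum>k. \<integral>\<^sup>+x. ennreal (c k) * indicator (ball y (r k)) x \<partial>M)"
    by (intro nn_integral_suminf borel_measurable_times_ennreal borel_measurable_const borel_measurable_indicator)
       (simp add: meas)
  also have "\<dots> = (\<Sum>k. ennreal (c k) * emeasure M (ball y (r k)))"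
    by (intro suminf_cong nn_integral_cmult_indicator) (simp add: meas)
  also have "\<dots> \<le> (\<Sum>k. ennreal (c k) * ennreal (m k))"
    by (intro suminf_le mult_left_mono ball) auto
  also have "\<dots> = (\<Sum>k. ennreal (C * b ^ k))"
    by (intro suminf_cong) (simp only: ennreal_mult[OF nonneg, symmetric] prod)
  also have "\<dots> = ennreal (C / (1 - b))" by (rule suminf_geometric_ennreal[OF b])
  finally show ?thesis .
qed

lemma ennreal_term_le_suminf: "(f :: nat \<Rightarrow> ennreal) k \<le> (\<Sum>k. f k)"
  using sum_le_suminf[of f "{k}"] by simp

text \<open>Dyadic shells \<open>e / 2 ^ Suc k \<le> norm (x - y) < e / 2 ^ k\<close>: the kernel is
  bounded by its value at the inner radius and the measure by the growth condition at the outer one.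
  The ratio \<open>2 powr (\<gamma> - \<alpha>)\<close> is below \<open>1\<close>; the factor
  \<open>2 powr \<gamma>\<close> is the price of using two radii.\<close>

lemma riesz_near:
  fixes y :: "'a::euclidean_space"
  assumes meas: "sets M = sets borel" and M: "\<And>r. r > 0 \<Longrightarrow> emeasure M (ball y r) \<le> ennreal (C * r powr \<alpha>)"
    and C: "0 \<le> C" and \<gamma>: "0 \<le> \<gamma>" "\<gamma> < \<alpha>" and e: "e > 0"
  shows "(\<integral>\<^sup>+x. indicator (ball y e) x * riesz \<gamma> (x - y) \<partial>M)
     \<le> ennreal (C * 2 powr \<gamma> * e powr (\<alpha> - \<gamma>) / (1 - 2 powr (\<gamma> - \<alpha>)))"
proof (rule nn_integral_suminf_indicator_le[OF meas])
  let ?c = "\<lambda>k. (e / 2 ^ Suc k) powr (- \<gamma>)" and ?r = "\<lambda>k. e / 2 ^ k"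
  show "indicator (ball y e) x * riesz \<gamma> (x - y) \<le> (\<Sum>k. ennreal (?c k) * indicator (ball y (?r k)) x)" for x
  proof (cases "x \<in> ball y e \<and> x \<noteq> y")
    case True
    define P where "P k \<longleftrightarrow> e / 2 ^ Suc k \<le> norm (x - y)" for k
    have pos: "norm (x - y) > 0" using True by simp
    obtain j where "(1 / 2) ^ j < norm (x - y) / e"
      using real_arch_pow_inv[of "norm (x - y) / e" "1/2"] pos e by auto
    hence "e / 2 ^ j < norm (x - y)" using e by (simp add: field_simps power_divide)
    moreover have "e / 2 ^ Suc j \<le> e / 2 ^ j" using e by (intro divide_left_mono) auto
    ultimately have "P j" by (simp add: P_def)
    define k where "k = (LEAST k. P k)"
    have Pk: "P k" unfolding k_def using \<open>P j\<close> by (rule LeastI)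
    have "norm (x - y) < ?r k"
    proof (cases k)
      case 0 thus ?thesis using True by (simp add: dist_norm norm_minus_commute)
    next
      case (Suc i)
      have "\<not> P i" using not_less_Least[of i P] Suc k_def by auto
      thus ?thesis by (simp add: P_def Suc)
    qed
    hence "x \<in> ball y (?r k)" by (simp add: dist_norm norm_minus_commute)
    moreover have "norm (x - y) powr (- \<gamma>) \<le> ?c k"
      using Pk e \<gamma> by (intro powr_mono2') (auto simp: P_def)
    ultimately have "indicator (ball y e) x * riesz \<gamma> (x - y) \<le> ennreal (?c k) * indicator (ball y (?r k)) x"
      using True by (simp add: riesz_def ennreal_leI)
    also have "\<dots> \<le> (\<Sum>k. ennreal (?c k) * indicator (ball y (?r k)) x)"
      by (rule ennreal_term_le_suminf)
    finally show ?thesis .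
  qed (auto simp: riesz_def)
  show "emeasure M (ball y (?r k)) \<le> ennreal (C * ?r k powr \<alpha>)" for k
    by (rule M) (use e in simp)
  show "?c k * (C * ?r k powr \<alpha>) = (C * 2 powr \<gamma> * e powr (\<alpha> - \<gamma>)) * (2 powr (\<gamma> - \<alpha>)) ^ k" for k
  proof -
    have 1: "?c k = e powr (- \<gamma>) * (2 powr \<gamma> * (2 powr \<gamma>) ^ k)"
    proof -
      have "2 ^ Suc k = (2::real) powr (real k + 1)" by (simp add: powr_add powr_realpow)
      moreover have "(2 powr \<gamma>) ^ k = 2 powr (\<gamma> * real k)"
        by (simp add: powr_realpow[symmetric] powr_powr)
      ultimately show ?thesis using e
        by (simp only: powr_divide powr_powr powr_minus powr_add[symmetric])
           (simp add: powr_add powr_minus powr_divide powr_powr algebra_simps field_simps)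
    qed
    have 2: "?r k powr \<alpha> = e powr \<alpha> * (2 powr (- \<alpha>)) ^ k"
      using e by (simp add: powr_divide powr_minus powr_realpow[symmetric] powr_powr mult.commute divide_simps)
    have 3: "(2 powr (\<gamma> - \<alpha>)) ^ k = (2 powr \<gamma>) ^ k * (2 powr (- \<alpha>)) ^ k"
      by (simp add: powr_diff powr_minus power_mult_distrib[symmetric] divide_inverse)
    have 4: "e powr (\<alpha> - \<gamma>) = e powr \<alpha> * e powr (- \<gamma>)"
      by (simp add: powr_diff powr_minus divide_inverse)
    show ?thesis unfolding 1 2 3 4 by (simp add: mult_ac)
  qed
qed (use C \<gamma> in \<open>auto simp: powr_less_one\<close>)

text \<open>The same with shells growing outwards,
  \<open>e * 2 ^ k \<le> norm (x - y) < e * 2 ^ Suc k\<close>. Now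
  \<open>\<alpha> < \<gamma>\<close> makes the series converge, and the extra factor
  \<open>2 powr \<alpha>\<close> comes from the measure of the ball of the outer radius.\<close>

lemma riesz_far:
  fixes y :: "'a::euclidean_space"
  assumes meas: "sets M = sets borel" and M: "\<And>r. r > 0 \<Longrightarrow> emeasure M (ball y r) \<le> ennreal (C * r powr \<alpha>)"
    and C: "0 \<le> C" and \<gamma>: "0 \<le> \<alpha>" "\<alpha> < \<gamma>" and e: "e > 0"
  shows "(\<integral>\<^sup>+x. indicator (- ball y e) x * riesz \<gamma> (x - y) \<partial>M)
     \<le> ennreal (C * 2 powr \<alpha> * e powr (\<alpha> - \<gamma>) / (1 - 2 powr (\<alpha> - \<gamma>)))"
proof (rule nn_integral_suminf_indicator_le[OF meas])
  let ?c = "\<lambda>k. (e * 2 ^ k) powr (- \<gamma>)" and ?r = "\<lambda>k. e * 2 ^ Suc k"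
  show "indicator (- ball y e) x * riesz \<gamma> (x - y) \<le> (\<Sum>k. ennreal (?c k) * indicator (ball y (?r k)) x)" for x
  proof (cases "x \<in> ball y e")
    case False
    define P where "P k \<longleftrightarrow> norm (x - y) < e * 2 ^ Suc k" for k
    obtain j where "norm (x - y) / e < 2 ^ j"
      using real_arch_pow[of 2 "norm (x - y) / e"] by auto
    hence "norm (x - y) < e * 2 ^ j" using e by (simp add: field_simps)
    also have "\<dots> \<le> e * 2 ^ Suc j" using e by auto
    finally have "P j" by (simp add: P_def)
    define k where "k = (LEAST k. P k)"
    have Pk: "P k" unfolding k_def using \<open>P j\<close> by (rule LeastI)
    have le: "e * 2 ^ k \<le> norm (x - y)"
    proof (cases k)
      case 0 thus ?thesis using False by (simp add: dist_norm norm_minus_commute)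
    next
      case (Suc i)
      have "\<not> P i" using not_less_Least[of i P] Suc k_def by auto
      thus ?thesis by (simp add: P_def Suc)
    qed
    have "x \<in> ball y (?r k)" using Pk by (simp add: P_def dist_norm norm_minus_commute)
    moreover have "norm (x - y) powr (- \<gamma>) \<le> ?c k"
      using le e \<gamma> by (intro powr_mono2') auto
    ultimately have "indicator (- ball y e) x * riesz \<gamma> (x - y) \<le> ennreal (?c k) * indicator (ball y (?r k)) x"
      using False by (simp add: riesz_def ennreal_leI)
    also have "\<dots> \<le> (\<Sum>k. ennreal (?c k) * indicator (ball y (?r k)) x)"
      by (rule ennreal_term_le_suminf)
    finally show ?thesis .
  qed auto
  show "emeasure M (ball y (?r k)) \<le> ennreal (C * ?r k powr \<alpha>)" for k
    by (rule M) (use e in simp)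
  show "?c k * (C * ?r k powr \<alpha>) = (C * 2 powr \<alpha> * e powr (\<alpha> - \<gamma>)) * (2 powr (\<alpha> - \<gamma>)) ^ k" for k
  proof -
    have 1: "?c k = e powr (- \<gamma>) * (2 powr (- \<gamma>)) ^ k"
      using e by (simp add: powr_mult powr_realpow[symmetric] powr_powr mult.commute)
    have 2: "?r k powr \<alpha> = e powr \<alpha> * (2 powr \<alpha> * (2 powr \<alpha>) ^ k)"
      using e by (simp add: powr_mult powr_realpow[symmetric] powr_powr mult.commute)
    have 3: "(2 powr (\<alpha> - \<gamma>)) ^ k = (2 powr \<alpha>) ^ k * (2 powr (- \<gamma>)) ^ k"
      by (simp add: powr_diff powr_minus power_mult_distrib[symmetric] divide_inverse)
    have 4: "e powr (\<alpha> - \<gamma>) = e powr \<alpha> * e powr (- \<gamma>)"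
      by (simp add: powr_diff powr_minus divide_inverse)
    show ?thesis unfolding 1 2 3 4 by (simp add: mult_ac)
  qed
qed (use C \<gamma> in \<open>auto simp: powr_less_one\<close>)

lemma lborel_ball_growth:
  fixes y :: "'a::euclidean_space"
  assumes "r > 0"
  shows "emeasure lborel (ball y r) \<le> ennreal (unit_ball_vol (real DIM('a)) * r powr real DIM('a))"
  using assms by (simp add: emeasure_ball powr_realpow)

section \<open>Averages over rays\<close>

lemma moll_integral_translate:
  fixes x :: "'a::euclidean_space"
  assumes d: "d > 0"
  shows "(\<integral>\<^sup>+w. ennreal (moll d (x - w)) \<partial>lborel) = 1"
proof -
  have "(\<integral>\<^sup>+w. ennreal (moll d (w::'a)) \<partial>lborel) = (\<integral>\<^sup>+w. ennreal (moll d (x + (-1) *\<^sub>R w)) \<partial>lborel)"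
    by (subst nn_integral_lborel_scale[of _ "-1" x]) auto
  thus ?thesis using moll_integral[OF d, where 'a='a] by simp
qed

lemma
  fixes x :: "'a::euclidean_space"
  assumes d: "d > 0"
  shows moll_integrable: "integrable lborel (\<lambda>w. moll d (x - w))"
    and moll_lebesgue_integral: "(LINT w|lborel. moll d (x - w)) = 1"
proof -
  have nn: "AE w in lborel. 0 \<le> moll d (x - w)" by (intro AE_I2 moll_nonneg d)
  show "integrable lborel (\<lambda>w. moll d (x - w))"
    by (rule integrableI_nonneg[OF _ nn]) (simp_all add: moll_integral_translate[OF d])
  show "(LINT w|lborel. moll d (x - w)) = 1"
    by (subst integral_eq_nn_integral[OF _ nn]) (simp_all add: moll_integral_translate[OF d])
qed

lemma moll_limit:
  fixes f :: "'a::euclidean_space \<Rightarrow> real"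
  assumes \<Omega>: "open \<Omega>" and x: "x \<in> \<Omega>" and f: "continuous_on \<Omega> f"
    and D: "\<And>k. D k > 0" "D \<longlonglongrightarrow> 0"
  shows "(\<lambda>k. LINT w:\<Omega>|lebesgue. f w * moll (D k) (x - w)) \<longlonglongrightarrow> f x"
proof (rule LIMSEQ_I)
  fix e :: real assume e: "e > 0"
  obtain r1 where r1: "r1 > 0" "cball x r1 \<subseteq> \<Omega>" using \<Omega> x open_contains_cball by blast
  have "isCont f x" using f \<Omega> x continuous_on_eq_continuous_at by blast
  then obtain r2 where r2: "r2 > 0" "\<And>w. dist w x < r2 \<Longrightarrow> dist (f w) (f x) < e / 2"
    using e unfolding continuous_at_eps_delta by (meson half_gt_zero)
  have "min r1 r2 > 0" using r1 r2 by simp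
  with D(2) obtain N where N: "\<And>k. k \<ge> N \<Longrightarrow> norm (D k - 0) < min r1 r2"
    using LIMSEQ_D by blast
  show "\<exists>no. \<forall>n\<ge>no. norm ((LINT w:\<Omega>|lebesgue. f w * moll (D n) (x - w)) - f x) < e"
  proof (intro exI[of _ N] allI impI)
    fix k assume "k \<ge> N"
    define d where "d = D k"
    have d: "d > 0" "d < r1" "d < r2" using N[OF \<open>k \<ge> N\<close>] D(1)[of k] by (auto simp: d_def)
    let ?K = "cball x d"
    have KO: "?K \<subseteq> \<Omega>" using r1 d by (meson order_trans cball_subset_cball_iff less_imp_le subset_cball)
    have iK: "integrable lborel (\<lambda>w. indicator ?K w * f w)"
      using borel_integrable_compact[OF compact_cball continuous_on_subset[OF f KO]] by simp
    have meas[measurable]: "(\<lambda>w. indicator ?K w * f w) \<in> borel_measurable borel"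
      using borel_measurable_integrable[OF iK] by simp
    have 1: "(LINT w:\<Omega>|lebesgue. f w * moll d (x - w)) = (LINT w|lborel. (indicator ?K w * f w) * moll d (x - w))"
      by (rule set_lebesgue_integral_eq_compact[OF KO meas]) (simp_all add: dist_norm moll_eq_0[OF d(1)])
    have bound: "norm (indicator ?K w * f w * moll d (x - w) - f x * moll d (x - w)) \<le> e / 2 * moll d (x - w)" for w
    proof (cases "w \<in> ?K")
      case True
      hence "dist (f w) (f x) < e / 2" using d by (intro r2) (auto simp: dist_commute)
      hence "norm (f w - f x) * moll d (x - w) \<le> e / 2 * moll d (x - w)"
        using moll_nonneg[OF d(1)] by (intro mult_right_mono) (auto simp: dist_norm)
      thus ?thesis using True moll_nonneg[OF d(1), of "x - w"]
        by (simp add: left_diff_distrib[symmetric] abs_mult)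
    qed (simp add: dist_norm moll_eq_0[OF d(1)])
    have ix: "integrable lborel (\<lambda>w. f x * moll d (x - w))" by (intro integrable_mult_right moll_integrable d)
    have ie: "integrable lborel (\<lambda>w. e / 2 * moll d (x - w))" by (intro integrable_mult_right moll_integrable d)
    have idiff: "integrable lborel (\<lambda>w. indicator ?K w * f w * moll d (x - w) - f x * moll d (x - w))"
      by (rule Bochner_Integration.integrable_bound[OF ie]) (use bound in \<open>auto intro!: AE_I2 intro: order_trans[OF _ abs_ge_self]\<close>)
    have "integrable lborel (\<lambda>w. (indicator ?K w * f w * moll d (x - w) - f x * moll d (x - w)) + f x * moll d (x - w))"
      by (rule Bochner_Integration.integrable_add[OF idiff ix])
    hence iK2: "integrable lborel (\<lambda>w. indicator ?K w * f w * moll d (x - w))" by simp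
    have "(LINT w:\<Omega>|lebesgue. f w * moll d (x - w)) - f x
       = (LINT w|lborel. (indicator ?K w * f w) * moll d (x - w)) - (LINT w|lborel. f x * moll d (x - w))"
      by (simp add: 1 moll_lebesgue_integral[OF d(1)])
    also have "\<dots> = (LINT w|lborel. indicator ?K w * f w * moll d (x - w) - f x * moll d (x - w))"
      by (rule Bochner_Integration.integral_diff[OF iK2 ix, symmetric])
    finally have "norm ((LINT w:\<Omega>|lebesgue. f w * moll d (x - w)) - f x)
      \<le> (LINT w|lborel. norm (indicator ?K w * f w * moll d (x - w) - f x * moll d (x - w)))"
      by simp
    also have "\<dots> \<le> (LINT w|lborel. e / 2 * moll d (x - w))"
      by (rule integral_mono[OF integrable_norm[OF idiff] ie bound])
    also have "\<dots> = e / 2" by (simp add: moll_lebesgue_integral[OF d(1)])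
    also have "\<dots> < e" using e by simp
    finally show "norm ((LINT w:\<Omega>|lebesgue. f w * moll (D k) (x - w)) - f x) < e" by (simp add: d_def)
  qed
qed

definition step :: "nat \<Rightarrow> real" where "step k = inverse (real (Suc k))"

lemma step_pos: "step k > 0" by (simp add: step_def)
lemma step_tendsto: "step \<longlonglongrightarrow> 0" unfolding step_def by (rule LIMSEQ_inverse_real_of_nat)

text \<open>The left side of the mollified estimate converges, the right side need not; the lower
  limit is the form in which Fatou's lemma can be applied. The set \<open>A\<close> replaces
  \<open>{0..T}\<close> so that one set serves all directions, although \<open>T\<close> will depend
  on \<open>v\<close>.\<close>

lemma line_bound_liminf:
  fixes u :: "real^'n \<Rightarrow> real^'n"
  assumes sgb: "sym_grad_bound \<Omega> u g" and u: "continuous_on \<Omega> u" and \<Omega>: "open \<Omega>"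
    and [measurable]: "g \<in> borel_measurable borel"
    and T: "T \<ge> 0" and seg: "\<And>t. t \<in> {0..T} \<Longrightarrow> x + t *\<^sub>R v \<in> \<Omega>" and A: "{0..T} \<subseteq> A"
  shows "ennreal \<bar>u (x + T *\<^sub>R v) \<bullet> v - u x \<bullet> v\<bar>
     \<le> liminf (\<lambda>k. ennreal ((norm v)\<^sup>2) * (\<integral>\<^sup>+t. indicator A t * moll_fun (step k) g (x + t *\<^sub>R v) \<partial>lborel))"
proof -
  define S where "S = (\<lambda>t. x + t *\<^sub>R v) ` {0..T}"
  have "compact S" unfolding S_def by (intro compact_continuous_image continuous_intros compact_Icc)
  moreover have "S \<subseteq> \<Omega>" using seg by (auto simp: S_def)
  ultimately obtain e where e: "e > 0" "(\<Union>y\<in>S. cball y e) \<subseteq> \<Omega>"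
    using compact_subset_open_imp_cball_epsilon_subset[OF _ \<Omega>] by blast
  have x: "x \<in> \<Omega>" using seg[of 0] T by simp
  have xT: "x + T *\<^sub>R v \<in> \<Omega>" using seg[of T] T by simp
  have f: "continuous_on \<Omega> (\<lambda>w. u w \<bullet> v)" by (intro continuous_intros u)
  let ?L = "\<lambda>k. \<bar>(LINT w:\<Omega>|lebesgue. (u w \<bullet> v) * moll (step k) (x + T *\<^sub>R v - w))
       - (LINT w:\<Omega>|lebesgue. (u w \<bullet> v) * moll (step k) (x - w))\<bar>"
  have "?L \<longlonglongrightarrow> \<bar>u (x + T *\<^sub>R v) \<bullet> v - u x \<bullet> v\<bar>"
    by (intro tendsto_intros moll_limit[OF \<Omega> _ f] step_pos step_tendsto x xT)
  hence "(\<lambda>k. ennreal (?L k)) \<longlonglongrightarrow> ennreal \<bar>u (x + T *\<^sub>R v) \<bullet> v - u x \<bullet> v\<bar>"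
    by (rule tendsto_ennrealI)
  hence "ennreal \<bar>u (x + T *\<^sub>R v) \<bullet> v - u x \<bullet> v\<bar> = liminf (\<lambda>k. ennreal (?L k))"
    by (rule lim_imp_Liminf[OF sequentially_bot, symmetric])
  also have "\<dots> \<le> liminf (\<lambda>k. ennreal ((norm v)\<^sup>2) * (\<integral>\<^sup>+t. indicator A t * moll_fun (step k) g (x + t *\<^sub>R v) \<partial>lborel))"
  proof (rule Liminf_mono)
    have "eventually (\<lambda>k. step k < e) sequentially" using step_tendsto e(1) by (rule order_tendstoD)
    thus "eventually (\<lambda>k. ennreal (?L k) \<le> ennreal ((norm v)\<^sup>2) *
        (\<integral>\<^sup>+t. indicator A t * moll_fun (step k) g (x + t *\<^sub>R v) \<partial>lborel)) sequentially"
    proof eventually_elim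
      case (elim k)
      have "ennreal (?L k) \<le> ennreal ((norm v)\<^sup>2) * (\<integral>\<^sup>+t. indicator {0..T} t * moll_fun (step k) g (x + t *\<^sub>R v) \<partial>lborel)"
      proof (rule mollified_line_bound[OF sgb u _ step_pos T])
        fix t assume "t \<in> {0..T}"
        hence "cball (x + t *\<^sub>R v) e \<subseteq> \<Omega>" using e(2) by (force simp: S_def)
        thus "cball (x + t *\<^sub>R v) (step k) \<subseteq> \<Omega>" using elim by (meson order_trans less_imp_le subset_cball)
      qed simp
      also have "\<dots> \<le> ennreal ((norm v)\<^sup>2) * (\<integral>\<^sup>+t. indicator A t * moll_fun (step k) g (x + t *\<^sub>R v) \<partial>lborel)"
        using A by (intro mult_left_mono nn_integral_mono mult_right_mono) (auto split: split_indicator)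
      finally show ?case .
    qed
  qed
  finally show ?thesis .
qed

section \<open>Mollification of the kernel with exponent \<open>1 - n\<close>\<close>

definition kernel_const :: "'a::euclidean_space itself \<Rightarrow> real" where
  "kernel_const _ = 2 ^ (DIM('a) - 1)
     + unit_ball_vol (real DIM('a)) * 2 ^ DIM('a) * 3 * 2 ^ (DIM('a) - 1) / moll_const TYPE('a)"

lemma kernel_const_nonneg: "kernel_const TYPE('a::euclidean_space) \<ge> 0"
  using moll_const_pos[where 'a='a] by (simp add: kernel_const_def)

lemma pred_mem_ball [measurable (raw)]:
  fixes f :: "'b \<Rightarrow> 'a::euclidean_space"
  assumes [measurable]: "f \<in> borel_measurable M"
  shows "Measurable.pred M (\<lambda>x. f x \<in> ball y r)"
  unfolding mem_ball by measurable

lemma powr_real_DIM_minus_1: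
  "t > 0 \<Longrightarrow> t powr (- (real DIM('a::euclidean_space) - 1)) = 1 / t ^ (DIM('a) - 1)"
proof -
  assume t: "t > 0"
  have "real DIM('a) - 1 = real (DIM('a) - 1)" by (simp add: of_nat_diff Suc_leI)
  thus ?thesis using t by (simp only: powr_minus powr_realpow inverse_eq_divide)
qed

text \<open>In dimension \<open>n\<close> this is \<open>norm z powr (1 - n)\<close>, the size of
  the gradient of the Newton potential up to a constant.\<close>

abbreviation (input) newton :: "'a::euclidean_space \<Rightarrow> ennreal" where
  "newton \<equiv> riesz (real DIM('a) - 1)"

text \<open>Uniform in \<open>d\<close>, which is the point. If \<open>norm y \<ge> 2 * d\<close>,
  the kernel on the support of the mollifier is at most \<open>2 ^ (n - 1)\<close> times its value
  at \<open>y\<close>. Otherwise the mollifier is at most a constant times \<open>d ^ (- n)\<close>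
  and the kernel has integral of order \<open>d\<close> over the ball of radius
  \<open>3 * d\<close>; the product is of order \<open>d ^ (1 - n)\<close>, and \<open>d\<close>
  exceeds \<open>norm y / 2\<close>. \<open>kernel_const\<close> is the sum of the two
  constants.\<close>

lemma moll_kernel_bound:
  fixes y :: "'a::euclidean_space"
  assumes d: "d > 0" and y: "y \<noteq> 0"
  shows "(\<integral>\<^sup>+z. newton z * ennreal (moll d (z - y)) \<partial>lborel) \<le> ennreal (kernel_const TYPE('a)) * newton y"
proof -
  let ?n = "DIM('a)"
  have n: "?n \<ge> 1" by (simp add: Suc_leI)
  have mom: "(\<integral>\<^sup>+z. ennreal (moll d (z - y)) \<partial>lborel) = 1"
    using moll_integral_translate[OF d, of y] moll_minus[of d "y - z" for z] by simp
  have yp: "norm y > 0" using y by simp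
  show ?thesis
  proof (cases "norm y \<ge> 2 * d")
    case True
    have "(\<integral>\<^sup>+z. newton z * ennreal (moll d (z - y)) \<partial>lborel)
        \<le> (\<integral>\<^sup>+z. ennreal (2 ^ (?n - 1) * (1 / norm y ^ (?n - 1))) * ennreal (moll d (z - y)) \<partial>lborel)"
    proof (rule nn_integral_mono)
      fix z :: 'a
      show "newton z * ennreal (moll d (z - y)) \<le> ennreal (2 ^ (?n - 1) * (1 / norm y ^ (?n - 1))) * ennreal (moll d (z - y))"
      proof (cases "norm (z - y) < d")
        case T2: True
        have "norm y \<le> norm z + norm (z - y)" using norm_triangle_sub[of y z] by (simp add: norm_minus_commute)
        hence zy: "norm y / 2 \<le> norm z" using T2 True by simp
        hence zp: "norm z > 0" using yp by linarith
        have "norm z powr (- (real ?n - 1)) \<le> (norm y / 2) powr (- (real ?n - 1))"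
          using zy yp n by (intro powr_mono2') auto
        also have "\<dots> = 1 / (norm y / 2) ^ (?n - 1)" using yp by (intro powr_real_DIM_minus_1) simp
        also have "\<dots> = 2 ^ (?n - 1) * (1 / norm y ^ (?n - 1))" by (simp add: power_divide)
        finally show ?thesis unfolding riesz_def by (intro mult_right_mono ennreal_leI) auto
      qed (simp add: moll_eq_0[OF d])
    qed
    also have "\<dots> = ennreal (2 ^ (?n - 1) * (1 / norm y ^ (?n - 1)))"
      by (subst nn_integral_cmult) (auto simp: mom)
    also have "\<dots> \<le> ennreal (kernel_const TYPE('a) * (1 / norm y ^ (?n - 1)))"
      using moll_const_pos[where 'a='a] yp
      by (intro ennreal_leI mult_right_mono) (auto simp: kernel_const_def)
    also have "\<dots> = ennreal (kernel_const TYPE('a)) * newton y"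
      unfolding riesz_def powr_real_DIM_minus_1[OF yp] 
      by (rule ennreal_mult) (use yp in \<open>simp_all add: kernel_const_nonneg\<close>)
    finally show ?thesis .
  next
    case False
    let ?m = "1 / (d ^ ?n * moll_const TYPE('a))"
    have m0: "?m \<ge> 0" using d moll_const_pos[where 'a='a] by simp
    have "(\<integral>\<^sup>+z. newton z * ennreal (moll d (z - y)) \<partial>lborel)
        \<le> (\<integral>\<^sup>+z. ennreal ?m * (indicator (ball 0 (3 * d)) z * newton (z - 0 :: 'a)) \<partial>lborel)"
    proof (rule nn_integral_mono)
      fix z :: 'a
      show "newton z * ennreal (moll d (z - y)) \<le> ennreal ?m * (indicator (ball 0 (3 * d)) z * newton (z - 0))"
      proof (cases "norm (z - y) < d")
        case T2: True
        have "norm z \<le> norm y + norm (z - y)" using norm_triangle_sub[of z y] by simp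
        hence "z \<in> ball 0 (3 * d)" using T2 False by simp
        moreover have "newton z * ennreal (moll d (z - y)) \<le> newton z * ennreal ?m"
          by (intro mult_left_mono ennreal_leI moll_le d) simp
        ultimately show ?thesis by (simp add: mult.commute)
      qed (simp add: moll_eq_0[OF d])
    qed
    also have "\<dots> = ennreal ?m * (\<integral>\<^sup>+z. indicator (ball 0 (3 * d)) z * newton (z - 0::'a) \<partial>lborel)"
      by (rule nn_integral_cmult) measurable
    also have "\<dots> \<le> ennreal ?m * ennreal (unit_ball_vol (real ?n) * 2 powr (real ?n - 1) * (3 * d) powr (real ?n - (real ?n - 1))
         / (1 - 2 powr ((real ?n - 1) - real ?n)))"
      using n d by (intro mult_left_mono riesz_near lborel_ball_growth) auto
    also have "unit_ball_vol (real ?n) * 2 powr (real ?n - 1) * (3 * d) powr (real ?n - (real ?n - 1))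
         / (1 - 2 powr ((real ?n - 1) - real ?n)) = unit_ball_vol (real ?n) * 2 ^ ?n * (3 * d)"
      using d n by (simp add: powr_minus powr_diff powr_realpow)
    also have "ennreal ?m * ennreal (unit_ball_vol (real ?n) * 2 ^ ?n * (3 * d))
       = ennreal (unit_ball_vol (real ?n) * 2 ^ ?n * 3 / moll_const TYPE('a) * (d / d ^ ?n))"
      using m0 d by (subst ennreal_mult[symmetric]) (auto simp: field_simps)
    also have "d / d ^ ?n = 1 / d ^ (?n - 1)"
      using d n by (cases ?n) auto
    also have "ennreal (unit_ball_vol (real ?n) * 2 ^ ?n * 3 / moll_const TYPE('a) * (1 / d ^ (?n - 1)))
       \<le> ennreal (unit_ball_vol (real ?n) * 2 ^ ?n * 3 / moll_const TYPE('a) * (2 ^ (?n - 1) / norm y ^ (?n - 1)))"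
    proof (intro ennreal_leI mult_left_mono)
      have "1 / d ^ (?n - 1) \<le> 1 / (norm y / 2) ^ (?n - 1)"
        using False yp by (intro divide_left_mono power_mono mult_pos_pos zero_less_power) (auto simp: d)
      thus "1 / d ^ (?n - 1) \<le> 2 ^ (?n - 1) / norm y ^ (?n - 1)" by (simp add: power_divide)
      show "0 \<le> unit_ball_vol (real ?n) * 2 ^ ?n * 3 / moll_const TYPE('a)"
        using moll_const_pos[where 'a='a] by simp
    qed
    also have "\<dots> \<le> ennreal (kernel_const TYPE('a) * (1 / norm y ^ (?n - 1)))"
      using yp d by (intro ennreal_leI) (simp add: kernel_const_def add_divide_distrib)
    also have "\<dots> = ennreal (kernel_const TYPE('a)) * newton y"
      unfolding riesz_def powr_real_DIM_minus_1[OF yp] 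
      by (rule ennreal_mult) (use yp in \<open>simp_all add: kernel_const_nonneg\<close>)
    finally show ?thesis .
  qed
qed

section \<open>From integrals along rays to integrals over space\<close>

lemma nn_integral_tail_power:
  assumes a: "a > 0"
  shows "(\<integral>\<^sup>+t. indicator {a<..} t * ennreal (1 / t ^ (m + 2)) \<partial>lborel) \<le> ennreal (1 / a ^ (m + 1))"
proof -
  have "(\<integral>\<^sup>+t. indicator {a<..} t * ennreal (1 / t ^ (m + 2)) \<partial>lborel)
     \<le> (\<integral>\<^sup>+t. ennreal (1 / t ^ (m + 2)) * indicator {a..} t \<partial>lborel)"
    by (intro nn_integral_mono) (auto split: split_indicator)
  also have "\<dots> = ennreal (0 - (- 1 / (real (m + 1) * a ^ (m + 1))))"
  proof (rule nn_integral_FTC_atLeast)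
    fix t assume t: "a \<le> t"
    have "((\<lambda>t. (- 1 / real (m + 1)) * inverse t ^ Suc m) has_real_derivative
        (- 1 / real (m + 1)) * ((1 + real m) * (- (inverse t ^ Suc (Suc 0)) * inverse t ^ m))) (at t)"
      using a t by (intro DERIV_cmult DERIV_power_Suc DERIV_inverse) auto
    also have "(- 1 / real (m + 1)) * ((1 + real m) * (- (inverse t ^ Suc (Suc 0)) * inverse t ^ m)) = 1 / t ^ (m + 2)"
      by (simp add: field_simps)
    also have "(\<lambda>t. (- 1 / real (m + 1)) * inverse t ^ Suc m) = (\<lambda>t. - 1 / (real (m + 1) * t ^ (m + 1)))"
      by (simp add: fun_eq_iff divide_inverse power_inverse mult_ac)
    finally show "((\<lambda>t. - 1 / (real (m + 1) * t ^ (m + 1))) has_real_derivative 1 / t ^ (m + 2)) (at t)" .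
    show "0 \<le> 1 / t ^ (m + 2)" using a t by simp
  next
    have "((\<lambda>t. (- 1 / real (m + 1)) * inverse t ^ (m + 1)) \<longlongrightarrow> (- 1 / real (m + 1)) * 0 ^ (m + 1)) at_top"
      by (intro tendsto_intros tendsto_inverse_0_at_top filterlim_ident)
    thus "((\<lambda>t. - 1 / (real (m + 1) * t ^ (m + 1))) \<longlongrightarrow> 0) at_top"
      by (simp add: divide_inverse power_inverse mult_ac)
  qed simp
  also have "\<dots> \<le> ennreal (1 / a ^ (m + 1))"
    using a by (intro ennreal_leI) (simp add: divide_simps)
  finally show ?thesis .
qed

text \<open>For fixed \<open>t\<close> substitute \<open>z = t *\<^sub>R v\<close>: the unit ball
  becomes \<open>norm z < t\<close>, the volume element contributes \<open>1 / t ^ n\<close>, and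
  \<open>(norm v)\<^sup>2\<close> becomes \<open>(norm z)\<^sup>2 / t\<^sup>2\<close>. Integrating
  \<open>1 / t ^ (n + 2)\<close> over \<open>t > norm z\<close> gives at most
  \<open>1 / norm z ^ (n + 1)\<close>, and with \<open>(norm z)\<^sup>2\<close> this is the kernel
  \<open>newton z\<close>.\<close>

lemma ray_integral_bound:
  fixes F :: "'a::euclidean_space \<Rightarrow> ennreal"
  assumes [measurable]: "F \<in> borel_measurable borel" "A \<in> sets borel" "P \<in> sets borel"
    and P: "\<And>t z. t \<in> A \<Longrightarrow> norm z < t \<Longrightarrow> z \<in> P"
  shows "(\<integral>\<^sup>+v. indicator (ball 0 1) v * (ennreal ((norm v)\<^sup>2) * (\<integral>\<^sup>+t. indicator (A \<inter> {0<..}) t * F (x + t *\<^sub>R v) \<partial>lborel)) \<partial>lborel)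
     \<le> (\<integral>\<^sup>+z. indicator P z * (F (x + z) * newton z) \<partial>lborel)"
proof -
  let ?n = "DIM('a)" and ?A = "A \<inter> {0<..}"
  let ?T = "\<lambda>t z. indicator ?A t * (indicator {norm z<..} t * (ennreal (1 / t ^ (?n + 2)) * (ennreal ((norm z)\<^sup>2) * F (x + z))))"
  have "(\<integral>\<^sup>+v. indicator (ball 0 1) v * (ennreal ((norm v)\<^sup>2) * (\<integral>\<^sup>+t. indicator ?A t * F (x + t *\<^sub>R v) \<partial>lborel)) \<partial>lborel)
     = (\<integral>\<^sup>+v. (\<integral>\<^sup>+t. indicator (ball 0 1) v * (ennreal ((norm v)\<^sup>2) * (indicator ?A t * F (x + t *\<^sub>R v))) \<partial>lborel) \<partial>lborel)"
    by (intro nn_integral_cong) (subst nn_integral_cmult; simp)+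
  also have "\<dots> = (\<integral>\<^sup>+t. (\<integral>\<^sup>+v. indicator (ball 0 1) v * (ennreal ((norm v)\<^sup>2) * (indicator ?A t * F (x + t *\<^sub>R v))) \<partial>lborel) \<partial>lborel)"
    by (rule lborel_pair.Fubini'[symmetric]) (simp add: indicator_def, measurable)
  also have "\<dots> = (\<integral>\<^sup>+t. (\<integral>\<^sup>+z. ?T t z \<partial>lborel) \<partial>lborel)"
  proof (rule nn_integral_cong)
    fix t :: real
    show "(\<integral>\<^sup>+v. indicator (ball 0 1) v * (ennreal ((norm v)\<^sup>2) * (indicator ?A t * F (x + t *\<^sub>R v))) \<partial>lborel)
       = (\<integral>\<^sup>+z. ?T t z \<partial>lborel)"
    proof (cases "t \<in> ?A")
      case True
      hence t: "t > 0" by simp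
      have "(\<integral>\<^sup>+z. ?T t z \<partial>lborel)
         = ennreal (\<bar>t\<bar> ^ ?n) * (\<integral>\<^sup>+v. indicator ?A t * (indicator {norm (0 + t *\<^sub>R v::'a)<..} t * (ennreal (1 / t ^ (?n + 2)) * (ennreal ((norm (0 + t *\<^sub>R v))\<^sup>2) * F (x + (0 + t *\<^sub>R v))))) \<partial>lborel)"
        using t by (intro nn_integral_lborel_scale) (auto simp: indicator_def)
      also have "\<dots> = (\<integral>\<^sup>+v. ennreal (\<bar>t\<bar> ^ ?n) * (indicator ?A t * (indicator {norm (0 + t *\<^sub>R v::'a)<..} t * (ennreal (1 / t ^ (?n + 2)) * (ennreal ((norm (0 + t *\<^sub>R v))\<^sup>2) * F (x + (0 + t *\<^sub>R v)))))) \<partial>lborel)"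
        by (rule nn_integral_cmult[symmetric]) (auto simp: indicator_def)
      also have "\<dots> = (\<integral>\<^sup>+v. indicator (ball 0 1) v * (ennreal ((norm v)\<^sup>2) * (indicator ?A t * F (x + t *\<^sub>R v))) \<partial>lborel)"
      proof (rule nn_integral_cong)
        fix v :: 'a
        have "t ^ ?n * (1 / t ^ (?n + 2) * (norm (t *\<^sub>R v))\<^sup>2) = (norm v)\<^sup>2"
          using t by (simp add: power_mult_distrib power_add power2_eq_square)
        hence "ennreal (t ^ ?n) * (ennreal (1 / t ^ (?n + 2)) * ennreal ((norm (t *\<^sub>R v))\<^sup>2)) = ennreal ((norm v)\<^sup>2)"
          using t by (simp flip: ennreal_mult)
        moreover have "norm (t *\<^sub>R v) < t \<longleftrightarrow> norm v < 1" using t by simp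
        ultimately show "ennreal (\<bar>t\<bar> ^ ?n) * (indicator ?A t * (indicator {norm (0 + t *\<^sub>R v)<..} t * (ennreal (1 / t ^ (?n + 2)) * (ennreal ((norm (0 + t *\<^sub>R v))\<^sup>2) * F (x + (0 + t *\<^sub>R v))))))
           = indicator (ball 0 1) v * (ennreal ((norm v)\<^sup>2) * (indicator ?A t * F (x + t *\<^sub>R v)))"
          using True t by (simp add: indicator_def mult.assoc[symmetric] del: norm_scaleR)
      qed
      finally show ?thesis by simp
    qed simp
  qed
  also have "\<dots> = (\<integral>\<^sup>+z. (\<integral>\<^sup>+t. ?T t z \<partial>lborel) \<partial>lborel)"
    by (rule lborel_pair.Fubini') (simp add: indicator_def, measurable)
  also have "\<dots> \<le> (\<integral>\<^sup>+z. indicator P z * (F (x + z) * newton z) \<partial>lborel)"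
  proof (rule nn_integral_mono)
    fix z :: 'a
    show "(\<integral>\<^sup>+t. ?T t z \<partial>lborel)
       \<le> indicator P z * (F (x + z) * newton z)"
    proof (cases "z = 0 \<or> z \<notin> P")
      case True
      hence "?T t z = 0" for t
        using P[of t z] by (auto simp: indicator_def)
      thus ?thesis by (simp only: nn_integral_const mult_zero_left zero_le)
    next
      case False
      hence z: "norm z > 0" "z \<in> P" by auto
      have "(\<integral>\<^sup>+t. ?T t z \<partial>lborel)
         \<le> (\<integral>\<^sup>+t. (ennreal ((norm z)\<^sup>2) * F (x + z)) * (indicator {norm z<..} t * ennreal (1 / t ^ (?n + 2))) \<partial>lborel)"
        by (intro nn_integral_mono) (auto simp: indicator_def mult_ac)
      also have "\<dots> = (ennreal ((norm z)\<^sup>2) * F (x + z)) * (\<integral>\<^sup>+t. indicator {norm z<..} t * ennreal (1 / t ^ (?n + 2)) \<partial>lborel)"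
        by (rule nn_integral_cmult) measurable
      also have "\<dots> \<le> (ennreal ((norm z)\<^sup>2) * F (x + z)) * ennreal (1 / norm z ^ (?n + 1))"
        by (intro mult_left_mono nn_integral_tail_power z) simp
      also have "\<dots> = F (x + z) * (ennreal ((norm z)\<^sup>2) * ennreal (1 / norm z ^ (?n + 1)))"
        by (simp add: mult_ac)
      also have "ennreal ((norm z)\<^sup>2) * ennreal (1 / norm z ^ (?n + 1)) = newton z"
        unfolding riesz_def powr_real_DIM_minus_1[OF z(1)] using z
        by (subst ennreal_mult[symmetric]) (auto simp: field_simps power2_eq_square power_Suc[symmetric] simp del: power_Suc
              intro!: arg_cong[where f=ennreal])
      finally show ?thesis using z by simp
    qed
  qed
  finally show ?thesis .
qed

text \<open>Fubini's theorem moves the mollifier from \<open>g\<close> to the kernel, where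
  \<open>moll_kernel_bound\<close> removes it at the cost of a constant. \<open>P'\<close> contains
  the \<open>d\<close>-neighbourhood of \<open>P\<close>.\<close>

lemma moll_fun_newton_bound:
  fixes g :: "'a::euclidean_space \<Rightarrow> ennreal"
  assumes [measurable]: "g \<in> borel_measurable borel" "P \<in> sets borel" "P' \<in> sets borel"
    and d: "d > 0" and P': "\<And>z y. z \<in> P \<Longrightarrow> norm (z - y) < d \<Longrightarrow> y \<in> P'"
  shows "(\<integral>\<^sup>+z. indicator P z * (moll_fun d g (x + z) * newton z) \<partial>lborel)
    \<le> ennreal (kernel_const TYPE('a)) * (\<integral>\<^sup>+w. indicator P' (w - x) * (g w * newton (w - x)) \<partial>lborel)"
proof -
  have "(\<integral>\<^sup>+z. indicator P z * (moll_fun d g (x + z) * newton z) \<partial>lborel)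
     = (\<integral>\<^sup>+z. (\<integral>\<^sup>+w. indicator P z * (g w * ennreal (moll d (x + z - w)) * newton z) \<partial>lborel) \<partial>lborel)"
  proof (rule nn_integral_cong)
    fix z :: 'a
    have "(\<integral>\<^sup>+w. (indicator P z * newton z) * (g w * ennreal (moll d (x + z - w))) \<partial>lborel)
       = (indicator P z * newton z) * moll_fun d g (x + z)"
      unfolding moll_fun_def by (rule nn_integral_cmult) measurable
    thus "indicator P z * (moll_fun d g (x + z) * newton z)
        = (\<integral>\<^sup>+w. indicator P z * (g w * ennreal (moll d (x + z - w)) * newton z) \<partial>lborel)"
      by (simp add: mult_ac)
  qed
  also have "\<dots> = (\<integral>\<^sup>+w. (\<integral>\<^sup>+z. indicator P z * (g w * ennreal (moll d (x + z - w)) * newton z) \<partial>lborel) \<partial>lborel)"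
    by (rule lborel_pair.Fubini'[symmetric]) measurable
  also have "\<dots> \<le> (\<integral>\<^sup>+w. ennreal (kernel_const TYPE('a)) * (indicator P' (w - x) * (g w * newton (w - x))) \<partial>lborel)"
  proof (rule nn_integral_mono_AE)
    \<comment> \<open>At \<open>w = x\<close> the kernel has the conventional value
      \<open>0\<close>, which would not dominate its mollification.\<close>
    have "AE w in lborel. w \<noteq> x" by (rule AE_lborel_singleton)
    thus "AE w in lborel. (\<integral>\<^sup>+z. indicator P z * (g w * ennreal (moll d (x + z - w)) * newton z) \<partial>lborel)
       \<le> ennreal (kernel_const TYPE('a)) * (indicator P' (w - x) * (g w * newton (w - x)))"
    proof eventually_elim
      case (elim w)
      have "(\<integral>\<^sup>+z. indicator P z * (g w * ennreal (moll d (x + z - w)) * newton z) \<partial>lborel)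
        \<le> (\<integral>\<^sup>+z. (indicator P' (w - x) * g w) * (newton z * ennreal (moll d (z - (w - x)))) \<partial>lborel)"
      proof (rule nn_integral_mono)
        fix z
        have eq: "x + z - w = z - (w - x)" by simp
        show "indicator P z * (g w * ennreal (moll d (x + z - w)) * newton z)
           \<le> (indicator P' (w - x) * g w) * (newton z * ennreal (moll d (z - (w - x))))"
          unfolding eq using P'[of z "w - x"]
          by (cases "norm (z - (w - x)) < d") (auto simp: moll_eq_0[OF d] indicator_def mult_ac)
      qed
      also have "\<dots> = (indicator P' (w - x) * g w) * (\<integral>\<^sup>+z. newton z * ennreal (moll d (z - (w - x))) \<partial>lborel)"
        by (rule nn_integral_cmult) measurable
      also have "\<dots> \<le> (indicator P' (w - x) * g w) * (ennreal (kernel_const TYPE('a)) * newton (w - x))"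
        using elim by (intro mult_left_mono moll_kernel_bound d) auto
      finally show ?case by (simp add: mult_ac)
    qed
  qed
  also have "\<dots> = ennreal (kernel_const TYPE('a)) * (\<integral>\<^sup>+w. indicator P' (w - x) * (g w * newton (w - x)) \<partial>lborel)"
    by (rule nn_integral_cmult) measurable
  finally show ?thesis .
qed

text \<open>Fatou's lemma, with a bound that no longer depends on \<open>k\<close> once the
  mollifier has been moved to the kernel. \<open>b\<close> stands for the contribution of the end of
  the ray, \<open>A\<close> for the times at which the ray is followed; \<open>P'\<close> leaves
  room for the mollification.\<close>

lemma ray_average_bound:
  fixes g :: "'a::euclidean_space \<Rightarrow> ennreal"
  assumes [measurable]: "g \<in> borel_measurable borel" "A \<in> sets borel" "P' \<in> sets borel"
    and [measurable]: "b \<in> borel_measurable borel"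
    and A: "A \<subseteq> {0..}"
    and P': "\<forall>\<^sub>F k in sequentially. \<forall>t\<in>A. \<forall>z y. norm (z::'a) < t \<longrightarrow> norm (z - y) < step k \<longrightarrow> y \<in> P'"
    and h: "\<And>v. norm v < 1 \<Longrightarrow> h v \<le> b v + liminf (\<lambda>k. ennreal ((norm v)\<^sup>2) *
               (\<integral>\<^sup>+t. indicator A t * moll_fun (step k) g (x + t *\<^sub>R v) \<partial>lborel))"
  shows "(\<integral>\<^sup>+v. indicator (ball 0 1) v * h v \<partial>lborel)
    \<le> (\<integral>\<^sup>+v. indicator (ball 0 1) v * b v \<partial>lborel)
     + ennreal (kernel_const TYPE('a)) * (\<integral>\<^sup>+w. indicator P' (w - x) * (g w * newton (w - x)) \<partial>lborel)"
proof -
  define I where "I k v = (\<integral>\<^sup>+t. indicator (A \<inter> {0<..}) t * moll_fun (step k) g (x + t *\<^sub>R v) \<partial>lborel)" for k v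
  \<comment> \<open>Time \<open>0\<close> is discarded because the substitution
    \<open>z = t *\<^sub>R v\<close> requires \<open>t > 0\<close>.\<close>
  have I: "(\<integral>\<^sup>+t. indicator A t * moll_fun (step k) g (x + t *\<^sub>R v) \<partial>lborel) = I k v" for k v
    unfolding I_def
  proof (rule nn_integral_cong_AE)
    have "AE t in lborel. t \<noteq> (0::real)" by (rule AE_lborel_singleton)
    thus "AE t in lborel. indicator A t * moll_fun (step k) g (x + t *\<^sub>R v)
       = indicator (A \<inter> {0<..}) t * moll_fun (step k) g (x + t *\<^sub>R v)"
      by eventually_elim (use A in \<open>auto simp: indicator_def\<close>)
  qed
  have [measurable]: "I k \<in> borel_measurable borel" for k
    unfolding I_def by measurable
  define J where "J k v = indicator (ball 0 1) v * (ennreal ((norm v)\<^sup>2) * I k v)" for k v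
  have [measurable]: "J k \<in> borel_measurable borel" for k unfolding J_def by measurable
  have "(\<integral>\<^sup>+v. indicator (ball 0 1) v * h v \<partial>lborel)
     \<le> (\<integral>\<^sup>+v. indicator (ball 0 1) v * b v + liminf (\<lambda>k. J k v) \<partial>lborel)"
  proof (rule nn_integral_mono)
    fix v :: 'a
    show "indicator (ball 0 1) v * h v \<le> indicator (ball 0 1) v * b v + liminf (\<lambda>k. J k v)"
      using h[of v, unfolded I] by (cases "norm v < 1") (simp_all add: J_def)
  qed
  also have "\<dots> = (\<integral>\<^sup>+v. indicator (ball 0 1) v * b v \<partial>lborel) + (\<integral>\<^sup>+v. liminf (\<lambda>k. J k v) \<partial>lborel)"
    by (rule nn_integral_add) measurable
  also have "\<dots> \<le> (\<integral>\<^sup>+v. indicator (ball 0 1) v * b v \<partial>lborel) + liminf (\<lambda>k. \<integral>\<^sup>+v. J k v \<partial>lborel)"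
    by (intro add_left_mono nn_integral_liminf) measurable
  also have "liminf (\<lambda>k. \<integral>\<^sup>+v. J k v \<partial>lborel)
      \<le> liminf (\<lambda>k::nat. ennreal (kernel_const TYPE('a)) * (\<integral>\<^sup>+w. indicator P' (w - x) * (g w * newton (w - x)) \<partial>lborel))"
  proof (rule Liminf_mono)
    show "\<forall>\<^sub>F k in sequentially. (\<integral>\<^sup>+v. J k v \<partial>lborel)
       \<le> ennreal (kernel_const TYPE('a)) * (\<integral>\<^sup>+w. indicator P' (w - x) * (g w * newton (w - x)) \<partial>lborel)"
      using P'
    proof eventually_elim
      case (elim k)
      define P where "P = (\<Union>t\<in>A. ball (0::'a) t)"
      have "open P" unfolding P_def by auto
      hence [measurable]: "P \<in> sets borel" by simp
      have "(\<integral>\<^sup>+v. J k v \<partial>lborel) \<le> (\<integral>\<^sup>+z. indicator P z * (moll_fun (step k) g (x + z) * newton z) \<partial>lborel)"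
        unfolding J_def I_def by (rule ray_integral_bound[OF _ _ \<open>P \<in> sets borel\<close>]) (auto simp: P_def)
      also have "\<dots> \<le> ennreal (kernel_const TYPE('a)) * (\<integral>\<^sup>+w. indicator P' (w - x) * (g w * newton (w - x)) \<partial>lborel)"
        by (rule moll_fun_newton_bound[OF _ \<open>P \<in> sets borel\<close> _ step_pos]) (use elim in \<open>auto simp: P_def\<close>)
      finally show ?case .
    qed
  qed
  also have "\<dots> = ennreal (kernel_const TYPE('a)) * (\<integral>\<^sup>+w. indicator P' (w - x) * (g w * newton (w - x)) \<partial>lborel)"
    by (rule Liminf_const[OF sequentially_bot])
  finally show ?thesis by (simp add: add_left_mono)
qed

text \<open>Rays are followed up to time \<open>e\<close> only and no boundary term occurs. The
  radius \<open>2 * e\<close> is \<open>e\<close> for the ray plus \<open>e\<close> for the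
  mollification, as \<open>step k < e\<close> eventually.\<close>

lemma local_oscillation_bound:
  fixes u :: "real^'n \<Rightarrow> real^'n"
  assumes sgb: "sym_grad_bound \<Omega> u g" and u: "continuous_on \<Omega> u" and \<Omega>: "open \<Omega>"
    and g: "g \<in> borel_measurable borel" and e: "e > 0" and ball: "cball x e \<subseteq> \<Omega>"
  shows "(\<integral>\<^sup>+v. indicator (ball 0 1) v * ennreal \<bar>u (x + e *\<^sub>R v) \<bullet> v - u x \<bullet> v\<bar> \<partial>lborel)
    \<le> ennreal (kernel_const TYPE(real^'n)) * (\<integral>\<^sup>+w. indicator (ball x (2 * e)) w * (g w * newton (w - x)) \<partial>lborel)"
proof -
  have "(\<integral>\<^sup>+v. indicator (ball 0 1) v * ennreal \<bar>u (x + e *\<^sub>R v) \<bullet> v - u x \<bullet> v\<bar> \<partial>lborel)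
    \<le> (\<integral>\<^sup>+v. indicator (ball 0 1) v * (\<lambda>_. 0) (v::real^'n) \<partial>lborel)
     + ennreal (kernel_const TYPE(real^'n)) * (\<integral>\<^sup>+w. indicator (ball 0 (2 * e)) (w - x) * (g w * newton (w - x)) \<partial>lborel)"
  proof (rule ray_average_bound[OF g, where A = "{0..e}"])
    have "\<forall>\<^sub>F k in sequentially. step k < e" using step_tendsto e by (rule order_tendstoD)
    thus "\<forall>\<^sub>F k in sequentially. \<forall>t\<in>{0..e}. \<forall>z y. norm (z::real^'n) < t \<longrightarrow> norm (z - y) < step k \<longrightarrow> y \<in> ball 0 (2 * e)"
    proof eventually_elim
      case (elim k)
      show ?case
      proof safe
        fix t z and y :: "real^'n" assume "t \<in> {0..e}" "norm z < t" "norm (z - y) < step k"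
        moreover have "norm y \<le> norm z + norm (z - y)" using norm_triangle_sub[of y z] by (simp add: norm_minus_commute)
        ultimately show "y \<in> ball 0 (2 * e)" using elim by simp
      qed
    qed
  next
    fix v :: "real^'n" assume v: "norm v < 1"
    have "ennreal \<bar>u (x + e *\<^sub>R v) \<bullet> v - u x \<bullet> v\<bar> \<le> liminf (\<lambda>k. ennreal ((norm v)\<^sup>2) *
               (\<integral>\<^sup>+t. indicator {0..e} t * moll_fun (step k) g (x + t *\<^sub>R v) \<partial>lborel))"
    proof (rule line_bound_liminf[OF sgb u \<Omega> g])
      fix t assume t: "t \<in> {0..e}"
      hence "t * norm v \<le> e * 1" using v by (intro mult_mono) auto
      thus "x + t *\<^sub>R v \<in> \<Omega>" using ball t by (auto simp: dist_norm subset_eq)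
    qed (use e in auto)
    thus "ennreal \<bar>u (x + e *\<^sub>R v) \<bullet> v - u x \<bullet> v\<bar> \<le> (\<lambda>_. 0) v + liminf (\<lambda>k. ennreal ((norm v)\<^sup>2) *
               (\<integral>\<^sup>+t. indicator {0..e} t * moll_fun (step k) g (x + t *\<^sub>R v) \<partial>lborel))" by simp
  qed auto
  also have "(\<lambda>w. indicator (ball 0 (2 * e)) (w - x)) = (indicator (ball x (2 * e)) :: real^'n \<Rightarrow> ennreal)"
    by (auto simp: fun_eq_iff indicator_def dist_norm norm_minus_commute)
  finally show ?thesis by (simp add: fun_eq_iff)
qed

section \<open>Hausdorff measure and the first exit point\<close>

definition ray_cone :: "'a::euclidean_space \<Rightarrow> 'a set \<Rightarrow> 'a set" where
  "ray_cone x U = {v. norm v < 1 \<and> (\<exists>t>0. x + t *\<^sub>R v \<in> U)}"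

text \<open>At most \<open>4 / h\<close> balls of radius \<open>2 * h\<close> cover a tube of width
  \<open>h\<close>; this is their total volume divided by \<open>h ^ (n - 1)\<close>.\<close>

definition tube_const :: "'a::euclidean_space itself \<Rightarrow> real" where
  "tube_const _ = 4 * 2 ^ DIM('a) * unit_ball_vol (real DIM('a))"

text \<open>The sets of a Hausdorff covering are arbitrary, so the cones over them may fail to be
  measurable; their size is therefore measured by the outer measure.\<close>

lemma outer_measure_of_UN_le:
  fixes A :: "nat \<Rightarrow> 'a set"
  assumes "\<And>i. A i \<subseteq> space M"
  shows "outer_measure_of M (\<Union>i. A i) \<le> (\<Sum>i. outer_measure_of M (A i))"
proof -
  have "\<forall>i. \<exists>E. E \<in> sets M \<and> A i \<subseteq> E \<and> outer_measure_of M (A i) = emeasure M E"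
    using outer_measure_of_attain[OF assms] by blast
  then obtain E where E: "\<And>i. E i \<in> sets M" "\<And>i. A i \<subseteq> E i" "\<And>i. outer_measure_of M (A i) = emeasure M (E i)"
    by metis
  have "outer_measure_of M (\<Union>i. A i) \<le> outer_measure_of M (\<Union>i. E i)"
    using E(2) by (intro outer_measure_of_mono) blast
  also have "\<dots> = emeasure M (\<Union>i. E i)" using E(1) by (intro outer_measure_of_eq) auto
  also have "\<dots> \<le> (\<Sum>i. emeasure M (E i))" using E(1) by (intro emeasure_subadditive_countably) auto
  finally show ?thesis by (simp add: E(3))
qed

text \<open>Seen from \<open>x\<close>, the set \<open>U\<close> is shrunk into the unit ball:
  \<open>v = s *\<^sub>R (y - x)\<close> with \<open>s * d \<le> 1\<close>. Two points of
  \<open>U\<close> are at most \<open>\<eta>\<close> apart, so \<open>v\<close> stays within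
  \<open>h = \<eta> / d\<close> of the axis through one fixed point of \<open>U\<close>, and the
  cone lies in a tube of bounded length and width of order \<open>h\<close>. A free
  \<open>\<eta>\<close> in place of the diameter keeps \<open>h\<close> positive.\<close>

lemma ray_cone_cover:
  fixes U :: "'a::euclidean_space set"
  assumes U: "bounded U" "diameter U \<le> \<eta>" and d: "\<And>y. y \<in> U \<Longrightarrow> d \<le> dist x y" and \<eta>: "0 < \<eta>" "\<eta> \<le> d"
  shows "outer_measure_of lborel (ray_cone x U) \<le> ennreal (tube_const TYPE('a) * (\<eta> / d) ^ (DIM('a) - 1))"
proof (cases "U = {}")
  case True
  hence "ray_cone x U = {}" by (simp add: ray_cone_def)
  thus ?thesis by simp
next
  case False
  then obtain y0 where y0: "y0 \<in> U" by blast
  define l where "l = dist x y0"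
  have dp: "d > 0" using \<eta> by simp
  have l: "l \<ge> d" "l > 0" using d[OF y0] dp by (auto simp: l_def)
  define w where "w = (1 / l) *\<^sub>R (y0 - x)"
  have w: "norm w = 1" using l by (simp add: w_def l_def dist_norm norm_minus_commute)
  have y0w: "y0 - x = l *\<^sub>R w" using l by (simp add: w_def)
  define h where "h = \<eta> / d"
  have h: "0 < h" "h \<le> 1" using \<eta> dp by (auto simp: h_def)
  \<comment> \<open>The axis point nearby has norm at most \<open>norm v + h \<le> 2\<close>, so
    multiples of \<open>h\<close> up to \<open>2\<close> are enough. Rounding to one of them costs
    another \<open>h\<close>, hence the radius \<open>2 * h\<close> below.\<close>
  define N where "N = nat \<lceil>2 / h\<rceil>"
  define B where "B = (\<Union>i\<le>N. cball ((real i * h) *\<^sub>R w) (2 * h))"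
  have sub: "ray_cone x U \<subseteq> B"
  proof
    fix v assume "v \<in> ray_cone x U"
    then obtain t where v: "norm v < 1" "t > 0" "x + t *\<^sub>R v \<in> U" by (auto simp: ray_cone_def)
    define y where "y = x + t *\<^sub>R v"
    define s where "s = 1 / t"
    have vs: "v = s *\<^sub>R (y - x)" using v by (simp add: y_def s_def)
    have s: "s > 0" using v by (simp add: s_def)
    have dy: "d \<le> norm (y - x)" using d[OF v(3)] by (simp add: y_def dist_norm norm_minus_commute)
    have "s * d \<le> s * norm (y - x)" using s dy by (intro mult_left_mono) auto
    also have "\<dots> = norm v" using s by (simp add: vs)
    finally have sd: "s * d \<le> 1" using v by simp
    have yy0: "norm (y - y0) \<le> \<eta>"
      using diameter_bounded_bound[OF U(1) v(3) y0] U(2) by (simp add: y_def dist_norm)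
    have s\<eta>: "s * \<eta> \<le> h"
      using sd \<eta> dp mult_right_mono[OF sd, of "\<eta> / d"] by (simp add: h_def)
    have 1: "norm (v - (s * l) *\<^sub>R w) \<le> h"
    proof -
      have "v - (s * l) *\<^sub>R w = s *\<^sub>R ((y - x) - (y0 - x))" by (simp add: vs y0w scaleR_right_diff_distrib)
      hence "norm (v - (s * l) *\<^sub>R w) = s * norm (y - y0)" using s by simp
      also have "\<dots> \<le> s * \<eta>" using s yy0 by (intro mult_left_mono) auto
      finally show ?thesis using s\<eta> by simp
    qed
    have sl: "0 \<le> s * l" using s l by simp
    have sl2: "s * l \<le> 2"
    proof -
      have "norm ((s * l) *\<^sub>R w) \<le> norm v + norm (v - (s * l) *\<^sub>R w)"
        using norm_triangle_sub[of "(s * l) *\<^sub>R w" v] by (simp add: norm_minus_commute)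
      thus ?thesis using w 1 v(1) h sl by simp
    qed
    define i where "i = nat \<lfloor>s * l / h\<rfloor>"
    have i: "real i \<le> s * l / h" "s * l / h < real i + 1"
      using sl h unfolding i_def by (auto simp: of_nat_nat intro: floor_correct)
    have "i \<le> N" unfolding i_def N_def
      using sl2 h by (intro nat_mono order_trans[OF floor_mono floor_le_ceiling] divide_right_mono) auto
    moreover have "norm ((s * l) *\<^sub>R w - (real i * h) *\<^sub>R w) \<le> h"
    proof -
      have "norm ((s * l) *\<^sub>R w - (real i * h) *\<^sub>R w) = \<bar>s * l - real i * h\<bar>"
        using w by (simp add: scaleR_left_diff_distrib[symmetric])
      also have "\<dots> \<le> h" using i h by (simp add: field_simps abs_le_iff)
      finally show ?thesis .
    qed
    hence "norm (v - (real i * h) *\<^sub>R w) \<le> 2 * h"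
      using 1 norm_triangle_ineq[of "v - (s * l) *\<^sub>R w" "(s * l) *\<^sub>R w - (real i * h) *\<^sub>R w"] by simp
    ultimately show "v \<in> B" unfolding B_def by (auto simp: dist_norm norm_minus_commute)
  qed
  have Bs: "B \<in> sets lborel" unfolding B_def by simp
  have n: "DIM('a) \<ge> 1" by (simp add: Suc_leI)
  have "outer_measure_of lborel (ray_cone x U) \<le> emeasure lborel B"
    using outer_measure_of_mono[OF sub, of lborel] Bs by simp
  also have "\<dots> \<le> (\<Sum>i\<le>N. emeasure lborel (cball ((real i * h) *\<^sub>R w) (2 * h)))"
    unfolding B_def by (intro emeasure_subadditive_finite) auto
  also have "\<dots> = ennreal ((real N + 1) * (unit_ball_vol (real DIM('a)) * (2 * h) ^ DIM('a)))"
    using h by (simp add: emeasure_cball ennreal_mult ennreal_of_nat_eq_real_of_nat add.commute flip: ennreal_1 ennreal_plus)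
  also have "\<dots> \<le> ennreal (4 / h * (unit_ball_vol (real DIM('a)) * (2 * h) ^ DIM('a)))"
  proof (intro ennreal_leI mult_right_mono)
    have "2 / h > 0" using h by simp
    hence "real N \<le> 2 / h + 1" unfolding N_def by linarith
    moreover have "1 \<le> 1 / h" using h by simp
    ultimately show "real N + 1 \<le> 4 / h" by simp
  qed (use h in auto)
  also have "4 / h * (unit_ball_vol (real DIM('a)) * (2 * h) ^ DIM('a)) = tube_const TYPE('a) * h ^ (DIM('a) - 1)"
    using n h by (cases "DIM('a)") (auto simp: tube_const_def power_mult_distrib)
  finally show ?thesis by (simp add: h_def)
qed

lemma tube_const_nonneg: "tube_const TYPE('a::euclidean_space) \<ge> 0"
  by (simp add: tube_const_def)

text \<open>For positive diameter take \<open>\<eta> = diameter U\<close>; for a set of diameter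
  \<open>0\<close> let \<open>\<eta>\<close> tend to \<open>0\<close>.\<close>

lemma ray_cone_outer_measure:
  fixes U :: "'a::euclidean_space set"
  assumes n: "DIM('a) \<ge> 2" and U: "bounded U" "diameter U \<le> d"
    and d: "\<And>y. y \<in> U \<Longrightarrow> d \<le> dist x y" "d > 0"
  shows "outer_measure_of lborel (ray_cone x U) \<le> ennreal (tube_const TYPE('a) * (diameter U / d) ^ (DIM('a) - 1))"
proof (cases "diameter U > 0")
  case True
  thus ?thesis using ray_cone_cover[OF U(1) order_refl d(1)] U(2) by simp
next
  case False
  hence 0: "diameter U = 0" using diameter_ge_0[OF U(1)] by simp
  have "((\<lambda>\<eta>. tube_const TYPE('a) * (\<eta> / d) ^ (DIM('a) - 1)) \<longlongrightarrow> tube_const TYPE('a) * (0 / d) ^ (DIM('a) - 1)) (at_right 0)"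
    using d(2) by (intro tendsto_intros) auto
  hence "((\<lambda>\<eta>. ennreal (tube_const TYPE('a) * (\<eta> / d) ^ (DIM('a) - 1))) \<longlongrightarrow> ennreal (tube_const TYPE('a) * (0 / d) ^ (DIM('a) - 1))) (at_right 0)"
    by (rule tendsto_ennrealI)
  moreover have "\<forall>\<^sub>F \<eta> in at_right 0. outer_measure_of lborel (ray_cone x U) \<le> ennreal (tube_const TYPE('a) * (\<eta> / d) ^ (DIM('a) - 1))"
    using eventually_at_right_real[OF d(2)]
  proof eventually_elim
    case (elim \<eta>)
    thus ?case using ray_cone_cover[OF U(1) _ d(1), where \<eta> = \<eta>] 0 by simp
  qed
  ultimately show ?thesis unfolding 0 by (rule tendsto_lowerbound) simp
qed

text \<open>Coverings at the single scale \<open>d\<close> suffice, since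
  \<open>hausdorff_outer\<close> is a supremum over scales. \<open>K\<close> passes from
  \<open>diameter U ^ (n - 1)\<close> to the gauge, which explains the factor
  \<open>2 ^ (n - 1) / unit_ball_vol s\<close>. Pieces are intersected with \<open>A\<close> to keep
  their distance from \<open>x\<close>.\<close>

lemma ray_cone_hausdorff_outer:
  fixes A :: "'a::euclidean_space set"
  assumes n: "DIM('a) \<ge> 2" and d: "\<And>y. y \<in> A \<Longrightarrow> d \<le> dist x y" "d > 0"
  defines "s \<equiv> real DIM('a) - 1"
  defines "K \<equiv> tube_const TYPE('a) * 2 ^ (DIM('a) - 1) / unit_ball_vol s"
  shows "outer_measure_of lborel (ray_cone x A) \<le> ennreal (K / d ^ (DIM('a) - 1)) * hausdorff_outer s A"
proof -
  have s: "s > 0" "s = real (DIM('a) - 1)" using n by (auto simp: s_def of_nat_diff)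
  have vol: "unit_ball_vol s > 0" using s by simp
  have tc: "tube_const TYPE('a) > 0" by (simp add: tube_const_def)
  define L where "L = K / d ^ (DIM('a) - 1)"
  have L: "L > 0" using vol tc d(2) by (simp add: L_def K_def)
  have step: "outer_measure_of lborel (ray_cone x (A \<inter> U)) \<le> ennreal L * hausdorff_gauge s d U" for U
  proof (cases "bounded U \<and> diameter U \<le> d")
    case True
    have bAU: "bounded (A \<inter> U)" and dAU: "diameter (A \<inter> U) \<le> diameter U" "0 \<le> diameter (A \<inter> U)"
      using True by (auto intro: bounded_subset diameter_subset diameter_ge_0)
    have "outer_measure_of lborel (ray_cone x (A \<inter> U)) \<le> ennreal (tube_const TYPE('a) * (diameter (A \<inter> U) / d) ^ (DIM('a) - 1))"
      using bAU dAU True d by (intro ray_cone_outer_measure n) auto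
    also have "\<dots> \<le> ennreal (tube_const TYPE('a) * (diameter U / d) ^ (DIM('a) - 1))"
      using dAU d(2) tc by (intro ennreal_leI mult_left_mono power_mono divide_right_mono) auto
    also have "tube_const TYPE('a) * (diameter U / d) ^ (DIM('a) - 1) = L * (unit_ball_vol s * (diameter U / 2) ^ (DIM('a) - 1))"
      using vol by (simp add: L_def K_def power_divide)
    \<comment> \<open>The power and \<open>powr\<close> also agree at \<open>0\<close>, because the
      exponent \<open>n - 1\<close> is positive.\<close>
    also have "(diameter U / 2) ^ (DIM('a) - 1) = (diameter U / 2) powr s"
    proof (cases "diameter U = 0")
      case True thus ?thesis using s n by simp
    next
      case False
      hence "diameter U / 2 > 0" using dAU by simp
      thus ?thesis unfolding s(2) by (simp only: powr_realpow)
    qed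
    also have "ennreal (L * (unit_ball_vol s * (diameter U / 2) powr s)) = ennreal L * hausdorff_gauge s d U"
      using True L vol by (simp add: hausdorff_gauge_def ennreal_mult)
    finally show ?thesis .
  next
    case False
    hence "hausdorff_gauge s d U = \<infinity>" by (simp only: hausdorff_gauge_def if_False)
    thus ?thesis using L by (simp add: ennreal_mult_top)
  qed
  \<comment> \<open>Divided by \<open>L\<close>, the claim is a lower bound for an infimum over
    coverings.\<close>
  have "ennreal (1 / L) * outer_measure_of lborel (ray_cone x A) \<le> hausdorff_content s d A"
    unfolding hausdorff_content_def
  proof (rule INF_greatest)
    fix U :: "nat \<Rightarrow> 'a set" assume "U \<in> {U. A \<subseteq> (\<Union>i. U i)}"
    hence "ray_cone x A \<subseteq> (\<Union>i. ray_cone x (A \<inter> U i))" by (fastforce simp: ray_cone_def)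
    hence "outer_measure_of lborel (ray_cone x A) \<le> outer_measure_of lborel (\<Union>i. ray_cone x (A \<inter> U i))"
      by (rule outer_measure_of_mono)
    also have "\<dots> \<le> (\<Sum>i. outer_measure_of lborel (ray_cone x (A \<inter> U i)))"
      by (rule outer_measure_of_UN_le) simp
    also have "\<dots> \<le> (\<Sum>i. ennreal L * hausdorff_gauge s d (U i))"
      by (intro suminf_le step) auto
    also have "\<dots> = ennreal L * (\<Sum>i. hausdorff_gauge s d (U i))" by simp
    finally have "ennreal (1 / L) * outer_measure_of lborel (ray_cone x A)
       \<le> ennreal (1 / L) * (ennreal L * (\<Sum>i. hausdorff_gauge s d (U i)))" by (rule mult_left_mono) simp
    also have "\<dots> = (\<Sum>i. hausdorff_gauge s d (U i))"
      using L by (simp add: mult.assoc[symmetric] ennreal_mult[symmetric])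
    finally show "ennreal (1 / L) * outer_measure_of lborel (ray_cone x A) \<le> (\<Sum>i. hausdorff_gauge s d (U i))" .
  qed
  also have "\<dots> \<le> hausdorff_outer s A" unfolding hausdorff_outer_def using d(2) by (intro SUP_upper) auto
  finally have "ennreal L * (ennreal (1 / L) * outer_measure_of lborel (ray_cone x A)) \<le> ennreal L * hausdorff_outer s A"
    by (rule mult_left_mono) simp
  moreover have "ennreal L * (ennreal (1 / L) * outer_measure_of lborel (ray_cone x A)) = outer_measure_of lborel (ray_cone x A)"
    using L by (simp add: mult.assoc[symmetric] ennreal_mult[symmetric])
  ultimately show ?thesis by (simp add: L_def)
qed

section \<open>Exit times and boundary values\<close>

definition exits :: "'a::euclidean_space set \<Rightarrow> 'a \<Rightarrow> 'a set" where
  "exits \<Omega> x = {v. \<exists>t\<ge>0. x + t *\<^sub>R v \<notin> \<Omega>}"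

text \<open>Meaningful for \<open>v \<in> exits \<Omega> x\<close> only: otherwise it is the infimum of the empty set.\<close>

definition exit_time :: "'a::euclidean_space set \<Rightarrow> 'a \<Rightarrow> 'a \<Rightarrow> real" where
  "exit_time \<Omega> x v = Inf {t. 0 \<le> t \<and> x + t *\<^sub>R v \<notin> \<Omega>}"

definition exit_point :: "'a::euclidean_space set \<Rightarrow> 'a \<Rightarrow> 'a \<Rightarrow> 'a" where
  "exit_point \<Omega> x v = x + exit_time \<Omega> x v *\<^sub>R v"

lemma exit_before:
  assumes "0 \<le> t" "t < exit_time \<Omega> x v"
  shows "x + t *\<^sub>R v \<in> \<Omega>"
proof (rule ccontr)
  assume "\<not> ?thesis"
  hence "exit_time \<Omega> x v \<le> t"
    unfolding exit_time_def using assms by (intro cInf_lower) (auto intro: bdd_belowI[of _ 0])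
  thus False using assms by simp
qed

text \<open>The set of times outside the open set \<Omega> is closed, so its infimum is attained. It
  is positive because the ray starts inside, and the exit point is a limit of points of \<Omega>
  from earlier times.\<close>

lemma
  assumes \<Omega>: "open \<Omega>" and x: "x \<in> \<Omega>" and v: "v \<in> exits \<Omega> x"
  shows exit_point_notin: "exit_point \<Omega> x v \<notin> \<Omega>"
    and exit_time_pos: "exit_time \<Omega> x v > 0"
    and exit_point_frontier: "exit_point \<Omega> x v \<in> frontier \<Omega>"
proof -
  let ?S = "{t. 0 \<le> t \<and> x + t *\<^sub>R v \<notin> \<Omega>}"
  have S: "?S = {0..} \<inter> ((\<lambda>t. x + t *\<^sub>R v) -` (- \<Omega>))" by auto
  have "closed ?S"
    unfolding S by (intro closed_Int closed_atLeast continuous_closed_vimage) (use \<Omega> in \<open>auto intro!: continuous_intros\<close>)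
  moreover have "?S \<noteq> {}" using v by (auto simp: exits_def)
  moreover have "bdd_below ?S" by (rule bdd_belowI[of _ 0]) auto
  ultimately have "exit_time \<Omega> x v \<in> ?S"
    unfolding exit_time_def by (intro closed_contains_Inf) auto
  hence *: "exit_time \<Omega> x v \<ge> 0" "exit_point \<Omega> x v \<notin> \<Omega>" by (auto simp: exit_point_def)
  show "exit_point \<Omega> x v \<notin> \<Omega>" by (rule *)
  show pos: "exit_time \<Omega> x v > 0"
    using * x by (cases "exit_time \<Omega> x v = 0") (auto simp: exit_point_def)
  have "exit_point \<Omega> x v \<in> closure \<Omega>"
  proof (rule Lim_in_closed_set[OF closed_closure])
    show "((\<lambda>t. x + t *\<^sub>R v) \<longlongrightarrow> exit_point \<Omega> x v) (at_left (exit_time \<Omega> x v))"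
      unfolding exit_point_def by (intro tendsto_intros)
    show "\<forall>\<^sub>F t in at_left (exit_time \<Omega> x v). x + t *\<^sub>R v \<in> closure \<Omega>"
      using eventually_at_left_real[OF pos]
      by eventually_elim (intro subsetD[OF closure_subset] exit_before; simp)
  qed simp
  thus "exit_point \<Omega> x v \<in> frontier \<Omega>" using * \<Omega> by (simp add: frontier_def interior_open)
qed

text \<open>Projection of a closed set along a compact interval. These are the sublevel sets of the
  exit time, which is lower semicontinuous but in general not continuous; all measurability of exit
  points comes from here.\<close>

lemma exit_le_closed:
  fixes \<Omega> :: "'a::euclidean_space set"
  assumes "open \<Omega>"
  shows "closed {v. \<exists>t\<in>{0..a}. x + t *\<^sub>R v \<notin> \<Omega>}"
proof -
  let ?T = "(\<lambda>p. x + fst p *\<^sub>R snd p) -` (- \<Omega>)"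
  have "closed ?T"
    by (rule closed_vimage) (use assms in \<open>auto intro!: continuous_intros\<close>)
  from closed_compact_projection[OF compact_Icc[of 0 a] this]
  show ?thesis by (simp add: Bex_def)
qed

lemma exits_measurable [measurable]:
  assumes "open \<Omega>" shows "exits \<Omega> x \<in> sets borel"
proof -
  have "exits \<Omega> x = (\<Union>N::nat. {v. \<exists>t\<in>{0..real N}. x + t *\<^sub>R v \<notin> \<Omega>})"
    unfolding exits_def by (auto, metis real_arch_simple atLeastAtMost_iff)
  thus ?thesis using exit_le_closed[OF assms] by auto
qed

lemma exit_point_measurable:
  assumes \<Omega>: "open \<Omega>" and x: "x \<in> \<Omega>"
  shows "exit_point \<Omega> x \<in> borel_measurable (restrict_space borel (exits \<Omega> x))"
proof -
  have "exit_time \<Omega> x \<in> borel_measurable (restrict_space borel (exits \<Omega> x))"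
  proof (subst borel_measurable_iff_le, intro allI)
    fix a
    have "{v \<in> space (restrict_space borel (exits \<Omega> x)). exit_time \<Omega> x v \<le> a}
       = exits \<Omega> x \<inter> {v. \<exists>t\<in>{0..a}. x + t *\<^sub>R v \<notin> \<Omega>}"
    proof safe
      fix v assume v: "v \<in> space (restrict_space borel (exits \<Omega> x))" "exit_time \<Omega> x v \<le> a"
      hence "v \<in> exits \<Omega> x" by (simp add: space_restrict_space)
      from exit_point_notin[OF \<Omega> x this] exit_time_pos[OF \<Omega> x this]
      show "\<exists>t\<in>{0..a}. x + t *\<^sub>R v \<notin> \<Omega>"
        using v(2) by (intro bexI[of _ "exit_time \<Omega> x v"]) (auto simp: exit_point_def)
      show "v \<in> exits \<Omega> x" by fact
    next
      fix v t assume "t \<in> {0..a}" "x + t *\<^sub>R v \<notin> \<Omega>"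
      thus "exit_time \<Omega> x v \<le> a" using exit_before[of t \<Omega> x v] by (cases "t < exit_time \<Omega> x v") auto
    qed (auto simp: space_restrict_space)
    thus "{v \<in> space (restrict_space borel (exits \<Omega> x)). exit_time \<Omega> x v \<le> a} \<in> sets (restrict_space borel (exits \<Omega> x))"
      using exit_le_closed[OF \<Omega>] exits_measurable[OF \<Omega>] by (auto simp: sets_restrict_space_iff)
  qed
  moreover have "(\<lambda>v. v) \<in> borel_measurable (restrict_space borel (exits \<Omega> x))"
    by (rule measurable_restrict_space1) simp
  ultimately show ?thesis unfolding exit_point_def[abs_def] by measurable
qed

text \<open>A ray with \<open>v \<noteq> 0\<close> that never leaves \<Omega> eventually runs
  outside the bounded support of \<open>u\<close>, so the value assigned to it is
  \<open>0\<close>.\<close>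

definition boundary_value :: "(real^'n) set \<Rightarrow> (real^'n \<Rightarrow> real^'n) \<Rightarrow> real^'n \<Rightarrow> real^'n \<Rightarrow> real" where
  "boundary_value \<Omega> u x v = (if v \<in> exits \<Omega> x then norm (u (exit_point \<Omega> x v)) else 0)"

lemma closure_restrict_measurable:
  fixes u :: "'a::euclidean_space \<Rightarrow> 'b::{second_countable_topology, real_normed_vector}"
  assumes "continuous_on S u" "S \<in> sets borel"
  shows "(\<lambda>y. indicator S y *\<^sub>R u y) \<in> borel_measurable borel"
  using borel_measurable_continuous_on_indicator[OF assms(2,1)] .

text \<open>Off \<open>closure \<Omega>\<close> the function \<open>u\<close> is arbitrary. Cut off
  to the closure it is Borel, and the cut-off is invisible because exit points lie on the
  frontier.\<close>

lemma boundary_value_measurable [measurable]: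
  assumes \<Omega>: "open \<Omega>" and x: "x \<in> \<Omega>" and u: "continuous_on (closure \<Omega>) u"
  shows "boundary_value \<Omega> u x \<in> borel_measurable borel"
proof -
  have ub: "(\<lambda>y. indicator (closure \<Omega>) y *\<^sub>R u y) \<in> borel_measurable borel"
    by (rule closure_restrict_measurable[OF u]) auto
  have "(\<lambda>v. norm (indicator (closure \<Omega>) (exit_point \<Omega> x v) *\<^sub>R u (exit_point \<Omega> x v)))
     \<in> borel_measurable (restrict_space borel (exits \<Omega> x))"
    by (rule measurable_compose[OF measurable_compose[OF exit_point_measurable[OF \<Omega> x] ub] borel_measurable_norm])
  hence "(\<lambda>v. indicator (exits \<Omega> x) v * norm (indicator (closure \<Omega>) (exit_point \<Omega> x v) *\<^sub>R u (exit_point \<Omega> x v)))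
      \<in> borel_measurable borel"
    using exits_measurable[OF \<Omega>, of x]
    by (subst (asm) borel_measurable_restrict_space_iff) auto
  also have "(\<lambda>v. indicator (exits \<Omega> x) v * norm (indicator (closure \<Omega>) (exit_point \<Omega> x v) *\<^sub>R u (exit_point \<Omega> x v)))
     = boundary_value \<Omega> u x"
    using exit_point_frontier[OF \<Omega> x] frontier_subset_closed[of "closure \<Omega>"]
    by (auto simp: boundary_value_def fun_eq_iff indicator_def frontier_def)
  finally show ?thesis .
qed

text \<open>The segment estimate holds for every time before the exit and passes to the exit point
  by continuity of \<open>u\<close> up to the boundary. A ray that stays in \<Omega> is followed
  until it has left the support of \<open>u\<close>, where the end value is
  \<open>0\<close>.\<close>

lemma exit_ray_bound:
  fixes u :: "real^'n \<Rightarrow> real^'n"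
  assumes sgb: "sym_grad_bound \<Omega> u g" and \<Omega>: "open \<Omega>" and x: "x \<in> \<Omega>"
    and g: "g \<in> borel_measurable borel"
    and u: "u \<in> C_b (closure \<Omega>)" and v: "norm v < 1"
  shows "ennreal \<bar>u x \<bullet> v\<bar> \<le> ennreal (boundary_value \<Omega> u x v) + liminf (\<lambda>k. ennreal ((norm v)\<^sup>2) *
      (\<integral>\<^sup>+t. indicator {0..} t * moll_fun (step k) g (x + t *\<^sub>R v) \<partial>lborel))" (is "_ \<le> _ + ?L")
proof -
  have uc: "continuous_on (closure \<Omega>) u" and bd: "bounded {y \<in> closure \<Omega>. u y \<noteq> 0}"
    using u by (auto simp: C_b_def)
  have uO: "continuous_on \<Omega> u" using uc by (rule continuous_on_subset) (rule closure_subset)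
  have line: "ennreal \<bar>u (x + T *\<^sub>R v) \<bullet> v - u x \<bullet> v\<bar> \<le> ?L"
    if "T \<ge> 0" "\<And>t. t \<in> {0..T} \<Longrightarrow> x + t *\<^sub>R v \<in> \<Omega>" for T
    by (rule line_bound_liminf[OF sgb uO \<Omega> g that]) auto
  show ?thesis
  proof (cases "v \<in> exits \<Omega> x")
    case True
    let ?e = "exit_time \<Omega> x v" and ?P = "exit_point \<Omega> x v"
    note pos = exit_time_pos[OF \<Omega> x True]
    have inO: "\<forall>\<^sub>F t in at_left ?e. 0 < t \<and> t < ?e"
      using eventually_at_left_real[OF pos] by eventually_elim simp
    have "((\<lambda>t. x + t *\<^sub>R v) \<longlongrightarrow> ?P) (at_left ?e)"
      unfolding exit_point_def by (intro tendsto_intros)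
    moreover have "?P \<in> closure \<Omega>" using exit_point_frontier[OF \<Omega> x True] by (simp add: frontier_def)
    moreover have "\<forall>\<^sub>F t in at_left ?e. x + t *\<^sub>R v \<in> closure \<Omega>"
      using inO by eventually_elim (intro subsetD[OF closure_subset] exit_before; simp)
    ultimately have "((\<lambda>t. u (x + t *\<^sub>R v)) \<longlongrightarrow> u ?P) (at_left ?e)"
      using continuous_on_tendsto_compose[OF uc] by blast
    hence "((\<lambda>t. ennreal \<bar>u (x + t *\<^sub>R v) \<bullet> v - u x \<bullet> v\<bar>) \<longlongrightarrow> ennreal \<bar>u ?P \<bullet> v - u x \<bullet> v\<bar>) (at_left ?e)"
      by (intro tendsto_ennrealI tendsto_intros)
    moreover have "\<forall>\<^sub>F t in at_left ?e. ennreal \<bar>u (x + t *\<^sub>R v) \<bullet> v - u x \<bullet> v\<bar> \<le> ?L"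
      using inO by eventually_elim (auto intro!: line exit_before)
    ultimately have L: "ennreal \<bar>u ?P \<bullet> v - u x \<bullet> v\<bar> \<le> ?L"
      by (rule tendsto_upperbound) simp
    have "\<bar>u ?P \<bullet> v\<bar> \<le> norm (u ?P) * norm v" by (rule Cauchy_Schwarz_ineq2)
    also have "\<dots> \<le> norm (u ?P) * 1" using v by (intro mult_left_mono) auto
    finally have "\<bar>u x \<bullet> v\<bar> \<le> boundary_value \<Omega> u x v + \<bar>u ?P \<bullet> v - u x \<bullet> v\<bar>"
      using True by (simp add: boundary_value_def)
    hence "ennreal \<bar>u x \<bullet> v\<bar> \<le> ennreal (boundary_value \<Omega> u x v) + ennreal \<bar>u ?P \<bullet> v - u x \<bullet> v\<bar>"
      by (subst ennreal_plus[symmetric]) (simp_all add: boundary_value_def del: ennreal_plus)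
    also have "\<dots> \<le> ennreal (boundary_value \<Omega> u x v) + ?L" by (intro add_left_mono L)
    finally show ?thesis .
  next
    case False
    hence all: "x + t *\<^sub>R v \<in> \<Omega>" if "t \<ge> 0" for t using that by (auto simp: exits_def)
    show ?thesis
    proof (cases "v = 0")
      case False
      obtain R where R: "\<And>y. y \<in> closure \<Omega> \<Longrightarrow> u y \<noteq> 0 \<Longrightarrow> norm y \<le> R"
        using bd by (auto simp: bounded_iff)
      \<comment> \<open>Far enough for \<open>x + T *\<^sub>R v\<close> to have norm larger than
        \<open>R\<close>, a bound for the support.\<close>
      define T where "T = (\<bar>R\<bar> + norm x + 1) / norm v"
      have T: "T \<ge> 0" by (simp add: T_def)
      have "norm (T *\<^sub>R v) = \<bar>R\<bar> + norm x + 1" using False by (simp add: T_def)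
      moreover have "norm (T *\<^sub>R v) \<le> norm (x + T *\<^sub>R v) + norm x"
        using norm_triangle_ineq4[of "x + T *\<^sub>R v" x] by simp
      ultimately have "norm (x + T *\<^sub>R v) > R" by simp
      hence "u (x + T *\<^sub>R v) = 0"
        using R[of "x + T *\<^sub>R v"] all[OF T] closure_subset[of \<Omega>] by force
      thus ?thesis using line[OF T] all by (simp add: boundary_value_def False \<open>v \<notin> exits \<Omega> x\<close>)
    qed simp
  qed
qed

section \<open>The distribution of exit points\<close>

definition boundary_const :: "'a::euclidean_space itself \<Rightarrow> real" where
  "boundary_const _ = tube_const TYPE('a) * 4 ^ (DIM('a) - 1) / unit_ball_vol (real DIM('a) - 1)"

text \<open>Two measures are compared: the image \<Lambda> of Lebesgue measure on the unit ball
  under the exit point, and the Hausdorff measure \<open>N\<close> weighted by the kernel. On a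
  shell \<open>d \<le> dist x y < 2 * d\<close> the cone estimate gives \<Lambda> \<le>
  \<open>N\<close> for every Borel subset; summing over shells and integrating \<open>f\<close>
  finishes. In \<open>boundary_const\<close> one factor \<open>2 ^ (n - 1)\<close> is that of the
  cone estimate and one comes from the width of the shells.\<close>

lemma exit_integral_le_hausdorff:
  fixes \<Omega> :: "'a::euclidean_space set" and f :: "'a \<Rightarrow> ennreal"
  assumes n: "DIM('a) \<ge> 2" and \<Omega>: "open \<Omega>" and x: "x \<in> \<Omega>" and f[measurable]: "f \<in> borel_measurable borel"
  shows "(\<integral>\<^sup>+v. indicator (ball 0 1 \<inter> exits \<Omega> x) v * f (exit_point \<Omega> x v) \<partial>lborel)
    \<le> ennreal (boundary_const TYPE('a)) * (\<integral>\<^sup>+y. f y * newton (y - x) \<partial>hausdorff_measure (real DIM('a) - 1))"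
proof -
  let ?D = "ball 0 1 \<inter> exits \<Omega> x" and ?P = "exit_point \<Omega> x" and ?s = "real DIM('a) - 1"
  let ?H = "hausdorff_measure ?s :: 'a measure"
  let ?c = "boundary_const TYPE('a)"
  have s: "?s > 0" using n by simp
  have c0: "?c \<ge> 0" using s by (simp add: boundary_const_def tube_const_nonneg)
  have D[measurable]: "?D \<in> sets borel" using exits_measurable[OF \<Omega>] by auto
  have Pm: "?P \<in> borel_measurable (restrict_space borel ?D)"
  proof -
    have "restrict_space (restrict_space borel (exits \<Omega> x)) ?D = restrict_space borel (exits \<Omega> x \<inter> ?D)"
      by (rule restrict_restrict_space) (use exits_measurable[OF \<Omega>] D in auto)
    moreover have "?P \<in> borel_measurable (restrict_space (restrict_space borel (exits \<Omega> x)) ?D)"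
      by (rule measurable_restrict_space1[OF exit_point_measurable[OF \<Omega> x]])
    ultimately show ?thesis by (simp add: Int_absorb1)
  qed
  have Pm': "?P \<in> measurable (restrict_space lborel ?D) borel"
    using Pm by (simp cong: measurable_cong_sets add: measurable_def space_restrict_space sets_restrict_space)
  define \<Lambda> where "\<Lambda> = distr (restrict_space lborel ?D) borel ?P"
  define N where "N = density ?H (\<lambda>y. ennreal ?c * newton (y - x))"
  have sets_eq: "sets \<Lambda> = sets N" by (simp add: \<Lambda>_def N_def)
  have eL: "emeasure \<Lambda> A = emeasure lborel {v \<in> ?D. ?P v \<in> A}" if [measurable]: "A \<in> sets borel" for A
  proof -
    have "emeasure \<Lambda> A = emeasure (restrict_space lborel ?D) (?P -` A \<inter> ?D)"
      unfolding \<Lambda>_def by (subst emeasure_distr[OF Pm' that]) (simp add: space_restrict_space)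
    also have "\<dots> = emeasure lborel (?P -` A \<inter> ?D)"
      by (rule emeasure_restrict_space) auto
    also have "?P -` A \<inter> ?D = {v \<in> ?D. ?P v \<in> A}" by auto
    finally show ?thesis .
  qed
  define R where "R k = {y. y \<noteq> x \<and> \<lfloor>log 2 (dist x y)\<rfloor> = k}" for k :: int
  have [measurable]: "R k \<in> sets borel" for k unfolding R_def by measurable
  have shell: "emeasure \<Lambda> (A \<inter> R k) \<le> emeasure N (A \<inter> R k)" if [measurable]: "A \<in> sets borel" for A k
  proof -
    define d where "d = 2 powr real_of_int k"
    have d: "d > 0" by (simp add: d_def)
    have dR: "d \<le> dist x y \<and> dist x y < 2 * d" if "y \<in> R k" for y
    proof -
      have "dist x y > 0" "\<lfloor>log 2 (dist x y)\<rfloor> = k" using that by (auto simp: R_def)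
      hence "real_of_int k \<le> log 2 (dist x y)" "log 2 (dist x y) < real_of_int k + 1" by linarith+
      thus ?thesis using \<open>dist x y > 0\<close> by (simp add: le_log_iff log_less_iff d_def powr_add mult.commute)
    qed
    let ?A = "A \<inter> R k"
    let ?K = "tube_const TYPE('a) * 2 ^ (DIM('a) - 1) / unit_ball_vol ?s"
    have K0: "?K \<ge> 0" using s by (simp add: tube_const_nonneg)
    have "emeasure \<Lambda> ?A = emeasure lborel {v \<in> ?D. ?P v \<in> ?A}" by (rule eL) simp
    \<comment> \<open>A direction whose exit point lies in \<open>?A\<close> belongs to the cone
      over \<open>?A\<close>. The cone need not be Borel, hence the outer measure.\<close>
    also have "\<dots> \<le> outer_measure_of lborel (ray_cone x ?A)"
    proof -
      have "{v \<in> ?D. ?P v \<in> ?A} = ?P -` ?A \<inter> space (restrict_space lborel ?D)"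
        by (auto simp: space_restrict_space)
      also have "\<dots> \<in> sets (restrict_space lborel ?D)" by (rule measurable_sets[OF Pm']) simp
      finally have "{v \<in> ?D. ?P v \<in> ?A} \<in> sets lborel"
        using D by (simp add: sets_restrict_space_iff)
      hence "emeasure lborel {v \<in> ?D. ?P v \<in> ?A} = outer_measure_of lborel {v \<in> ?D. ?P v \<in> ?A}" by simp
      also have "\<dots> \<le> outer_measure_of lborel (ray_cone x ?A)"
        using exit_time_pos[OF \<Omega> x]
        by (intro outer_measure_of_mono) (auto simp: ray_cone_def exit_point_def)
      finally show ?thesis .
    qed
    also have "\<dots> \<le> ennreal (?K / d ^ (DIM('a) - 1)) * hausdorff_outer ?s ?A"
      by (rule ray_cone_hausdorff_outer[OF n]) (use dR d in auto)
    also have "hausdorff_outer ?s ?A = emeasure ?H ?A"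
      by (rule emeasure_hausdorff_measure[symmetric]) (use s in auto)
    also have "ennreal (?K / d ^ (DIM('a) - 1)) * emeasure ?H ?A
        = (\<integral>\<^sup>+y. ennreal (?K / d ^ (DIM('a) - 1)) * indicator ?A y \<partial>?H)"
      by (rule nn_integral_cmult_indicator[symmetric]) simp
    also have "\<dots> \<le> (\<integral>\<^sup>+y. ennreal ?c * newton (y - x) * indicator ?A y \<partial>?H)"
    proof (rule nn_integral_mono)
      fix y
      show "ennreal (?K / d ^ (DIM('a) - 1)) * indicator ?A y \<le> ennreal ?c * newton (y - x) * indicator ?A y"
      proof (cases "y \<in> ?A")
        case True
        hence nd: "0 < norm (y - x)" "norm (y - x) < 2 * d" using dR[of y] by (auto simp: R_def dist_norm norm_minus_commute)
        have "1 / (2 * d) ^ (DIM('a) - 1) \<le> 1 / norm (y - x) ^ (DIM('a) - 1)"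
          using nd d by (intro divide_left_mono power_mono mult_pos_pos zero_less_power) auto
        hence "?c * (1 / (2 * d) ^ (DIM('a) - 1)) \<le> ?c * (1 / norm (y - x) ^ (DIM('a) - 1))"
          by (rule mult_left_mono[OF _ c0])
        moreover have "?c * (1 / (2 * d) ^ (DIM('a) - 1)) = ?K / d ^ (DIM('a) - 1)"
        proof -
          have "(4::real) ^ (DIM('a) - 1) = 2 ^ (DIM('a) - 1) * 2 ^ (DIM('a) - 1)"
            by (simp add: power_mult_distrib[symmetric])
          thus ?thesis by (simp add: boundary_const_def power_mult_distrib)
        qed
        ultimately have "ennreal (?K / d ^ (DIM('a) - 1)) \<le> ennreal (?c * (1 / norm (y - x) ^ (DIM('a) - 1)))"
          by (simp only: ennreal_leI)
        also have "\<dots> = ennreal ?c * newton (y - x)"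
          unfolding riesz_def powr_real_DIM_minus_1[OF nd(1)] by (rule ennreal_mult) (use c0 nd in simp_all)
        finally show ?thesis using True by simp
      qed simp
    qed
    also have "\<dots> = emeasure N ?A"
      unfolding N_def by (rule emeasure_density[symmetric]) simp_all
    finally show ?thesis .
  qed
  have le: "emeasure \<Lambda> A \<le> emeasure N A" if A[measurable]: "A \<in> sets borel" for A
  proof -
    let ?R = "\<lambda>i. A \<inter> R (int_decode i)"
    have sub: "disjoint_family ?R"
      unfolding disjoint_family_on_def R_def by (auto simp: int_decode_eq)
    have un: "(\<Union>i. ?R i) = A - {x}"
    proof -
      have "y \<in> (\<Union>i. R (int_decode i))" if "y \<noteq> x" for y
      proof (rule UN_I[of "int_encode \<lfloor>log 2 (dist x y)\<rfloor>"])
      qed (use that in \<open>auto simp: R_def\<close>)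
      thus ?thesis by (auto simp: R_def)
    qed
    \<comment> \<open>The shells miss the point \<open>x\<close>, which is never an exit point as it
      lies in \<Omega>.\<close>
    have "emeasure \<Lambda> A = emeasure \<Lambda> (A - {x})"
    proof -
      have "{v \<in> ?D. ?P v \<in> A} = {v \<in> ?D. ?P v \<in> A - {x}}"
        using exit_point_notin[OF \<Omega> x] x by force
      thus ?thesis by (simp add: eL)
    qed
    also have "\<dots> = (\<Sum>i. emeasure \<Lambda> (?R i))"
      unfolding un[symmetric] by (rule suminf_emeasure[symmetric, OF _ sub]) (auto simp: \<Lambda>_def)
    also have "\<dots> \<le> (\<Sum>i. emeasure N (?R i))" by (intro suminf_le shell) auto
    also have "\<dots> = emeasure N (A - {x})"
      unfolding un[symmetric] by (rule suminf_emeasure[OF _ sub]) (auto simp: N_def)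
    also have "\<dots> \<le> emeasure N A" by (rule emeasure_mono) (auto simp: N_def)
    finally show ?thesis .
  qed
  have "\<Lambda> \<le> N"
    unfolding le_measure_iff using le sets_eq sets_eq_imp_space_eq[OF sets_eq]
    by (auto simp: le_fun_def) (metis (no_types, lifting) N_def emeasure_notin_sets le sets_density sets_hausdorff_measure zero_le sets_eq)
  have "(\<integral>\<^sup>+v. indicator ?D v * f (?P v) \<partial>lborel) = (\<integral>\<^sup>+v. f (?P v) \<partial>restrict_space lborel ?D)"
    using D by (subst nn_integral_restrict_space) (auto simp: mult.commute)
  also have "\<dots> = (\<integral>\<^sup>+y. f y \<partial>\<Lambda>)" unfolding \<Lambda>_def by (rule nn_integral_distr[symmetric, OF Pm']) simp
  also have "\<dots> \<le> (\<integral>\<^sup>+y. f y \<partial>N)" by (rule nn_integral_mono_measure[OF sets_eq \<open>\<Lambda> \<le> N\<close>])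
  also have "\<dots> = (\<integral>\<^sup>+y. ennreal ?c * (f y * newton (y - x)) \<partial>?H)"
    unfolding N_def by (subst nn_integral_density) (auto simp: mult_ac)
  also have "\<dots> = ennreal ?c * (\<integral>\<^sup>+y. f y * newton (y - x) \<partial>?H)"
    by (rule nn_integral_cmult) simp
  finally show ?thesis .
qed

section \<open>Bounds in \<open>L\<^sup>s\<close>\<close>

text \<open>Truncation replaces convexity:
  \<open>\<kappa> \<le> L + L powr (1 - r) * \<kappa> powr r\<close> for every level
  \<open>L > 0\<close>. At the level chosen below, the first term integrates to at most
  \<open>N * L\<close> and the second to at most \<open>L\<close>, whence \<open>1 + N\<close>. The
  left side is a real \<open>t\<close> below the integral because the integral may be
  infinite.\<close>

lemma powr_jensen_bound:
  fixes \<kappa> :: "'a \<Rightarrow> real"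
  assumes [measurable]: "\<kappa> \<in> borel_measurable \<nu>" and nn: "\<And>y. 0 \<le> \<kappa> y"
    and N: "emeasure \<nu> (space \<nu>) \<le> ennreal N" "0 \<le> N" and r: "1 \<le> r"
    and t: "0 \<le> t" "ennreal t \<le> (\<integral>\<^sup>+y. ennreal (\<kappa> y) \<partial>\<nu>)"
  shows "ennreal (t powr r) \<le> ennreal ((1 + N) powr r) * (\<integral>\<^sup>+y. ennreal (\<kappa> y powr r) \<partial>\<nu>)"
proof (cases "(\<integral>\<^sup>+y. ennreal (\<kappa> y powr r) \<partial>\<nu>) = \<infinity>")
  case True
  have "(1 + N) powr r > 0" using N by simp
  thus ?thesis unfolding True by (simp add: ennreal_mult_top)
next
  case False
  then obtain I where I: "(\<integral>\<^sup>+y. ennreal (\<kappa> y powr r) \<partial>\<nu>) = ennreal I" "I \<ge> 0"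
    by (cases "\<integral>\<^sup>+y. ennreal (\<kappa> y powr r) \<partial>\<nu>") auto
  have "t powr r \<le> (1 + N) powr r * I"
  proof (rule field_le_epsilon)
    fix e :: real assume e: "e > 0"
    \<comment> \<open>The added term keeps \<open>J\<close> positive, so that negative powers of
      \<open>L\<close> make sense; multiplied by \<open>(1 + N) powr r\<close> it is exactly
      \<open>e\<close>.\<close>
    define J where "J = I + e / (1 + N) powr r"
    have J: "J > 0" "I \<le> J" using I e N by (auto simp: J_def add_nonneg_pos)
    define L where "L = J powr (1 / r)"
    have L: "L > 0" using J by (simp add: L_def)
    have pt: "\<kappa> y \<le> L + L powr (1 - r) * \<kappa> y powr r" for y
    proof (cases "\<kappa> y \<le> L")
      case True thus ?thesis by (smt (verit) mult_nonneg_nonneg powr_ge_zero)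
    next
      case False
      have "\<kappa> y = \<kappa> y powr (1 - r) * \<kappa> y powr r" using False L by (simp add: powr_add[symmetric])
      also have "\<dots> \<le> L powr (1 - r) * \<kappa> y powr r"
        using False L r by (intro mult_right_mono powr_mono2') auto
      finally show ?thesis using L by simp
    qed
    have "ennreal t \<le> (\<integral>\<^sup>+y. ennreal L + ennreal (L powr (1 - r)) * ennreal (\<kappa> y powr r) \<partial>\<nu>)"
    proof (rule order_trans[OF t(2)], rule nn_integral_mono)
      fix y
      have "ennreal (\<kappa> y) \<le> ennreal (L + L powr (1 - r) * \<kappa> y powr r)" by (rule ennreal_leI[OF pt])
      also have "\<dots> = ennreal L + ennreal (L powr (1 - r)) * ennreal (\<kappa> y powr r)"
        using L by (simp add: ennreal_plus ennreal_mult)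
      finally show "ennreal (\<kappa> y) \<le> ennreal L + ennreal (L powr (1 - r)) * ennreal (\<kappa> y powr r)" .
    qed
    also have "\<dots> = ennreal L * emeasure \<nu> (space \<nu>) + ennreal (L powr (1 - r)) * ennreal I"
      by (simp add: nn_integral_add nn_integral_cmult I)
    also have "\<dots> \<le> ennreal L * ennreal N + ennreal (L powr (1 - r)) * ennreal J"
      using N J by (intro add_mono mult_left_mono ennreal_leI) auto
    also have "\<dots> = ennreal (L * N + L powr (1 - r) * J)"
      using L N J by (simp add: ennreal_plus ennreal_mult)
    also have "L powr (1 - r) * J = L"
    proof -
      have "J = L powr r" using J r by (simp add: L_def powr_powr)
      hence "L powr (1 - r) * J = L powr (1 - r) * L powr r" by simp
      also have "\<dots> = L" using L by (simp add: powr_add[symmetric])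
      finally show ?thesis .
    qed
    finally have "t \<le> (1 + N) * L"
      using L N by (subst (asm) ennreal_le_iff) (auto simp: algebra_simps intro!: add_nonneg_nonneg)
    hence "t powr r \<le> ((1 + N) * L) powr r" using t r by (intro powr_mono2) auto
    also have "\<dots> = (1 + N) powr r * J"
      using N L J r by (simp add: powr_mult L_def powr_powr)
    also have "\<dots> = (1 + N) powr r * I + e" using N by (simp add: J_def distrib_left)
    finally show "t powr r \<le> (1 + N) powr r * I + e" .
  qed
  hence "ennreal (t powr r) \<le> ennreal ((1 + N) powr r * I)" by (rule ennreal_leI)
  also have "\<dots> = ennreal ((1 + N) powr r) * ennreal I" using I by (simp add: ennreal_mult)
  finally show ?thesis unfolding I .
qed

text \<open>Hoelder's inequality as Jensen's for the measure with density \<open>h powr p'\<close>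
  and the function \<open>\<kappa> = f * h powr (1 - p')\<close>: the density times
  \<open>\<kappa>\<close> is \<open>f * h\<close>, and times \<open>\<kappa> powr p\<close> it is at
  most \<open>f powr p\<close>, because \<open>p' + (1 - p') * p = 0\<close>.\<close>

lemma powr_holder_bound:
  fixes f h :: "'a \<Rightarrow> real"
  assumes [measurable]: "f \<in> borel_measurable M" "h \<in> borel_measurable M"
    and f: "\<And>y. 0 \<le> f y" and h: "\<And>y. 0 \<le> h y" and p: "p > 1" and p': "p' = p / (p - 1)"
    and N: "(\<integral>\<^sup>+y. ennreal (h y powr p') \<partial>M) \<le> ennreal N" "0 \<le> N"
    and t: "0 \<le> t" "ennreal t \<le> (\<integral>\<^sup>+y. ennreal (f y * h y) \<partial>M)"
  shows "ennreal (t powr p) \<le> ennreal ((1 + N) powr p) * (\<integral>\<^sup>+y. ennreal (f y powr p) \<partial>M)"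
proof -
  define \<nu> where "\<nu> = density M (\<lambda>y. ennreal (h y powr p'))"
  define \<kappa> where "\<kappa> y = f y * h y powr (1 - p')" for y
  have [measurable]: "\<kappa> \<in> borel_measurable M" unfolding \<kappa>_def by measurable
  have \<kappa>0: "\<kappa> y \<ge> 0" for y using f by (simp add: \<kappa>_def)
  have "ennreal (t powr p) \<le> ennreal ((1 + N) powr p) * (\<integral>\<^sup>+y. ennreal (\<kappa> y powr p) \<partial>\<nu>)"
  proof (rule powr_jensen_bound)
    show "emeasure \<nu> (space \<nu>) \<le> ennreal N"
      using N by (simp add: \<nu>_def emeasure_density cong: nn_integral_cong)
    have "(\<integral>\<^sup>+y. ennreal (\<kappa> y) \<partial>\<nu>) = (\<integral>\<^sup>+y. ennreal (h y powr p') * ennreal (\<kappa> y) \<partial>M)"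
      unfolding \<nu>_def by (rule nn_integral_density) measurable
    also have "\<dots> = (\<integral>\<^sup>+y. ennreal (f y * h y) \<partial>M)"
    proof (rule nn_integral_cong)
      fix y
      have "h y powr p' * \<kappa> y = f y * h y"
        using h[of y] by (cases "h y = 0") (auto simp: \<kappa>_def mult.left_commute powr_add[symmetric])
      thus "ennreal (h y powr p') * ennreal (\<kappa> y) = ennreal (f y * h y)"
        using \<kappa>0 by (simp add: ennreal_mult[symmetric])
    qed
    finally show "ennreal t \<le> (\<integral>\<^sup>+y. ennreal (\<kappa> y) \<partial>\<nu>)" using t by simp
  qed (use N p t f in \<open>auto simp: \<kappa>_def \<nu>_def\<close>)
  also have "(\<integral>\<^sup>+y. ennreal (\<kappa> y powr p) \<partial>\<nu>) = (\<integral>\<^sup>+y. ennreal (h y powr p') * ennreal (\<kappa> y powr p) \<partial>M)"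
    unfolding \<nu>_def by (rule nn_integral_density) measurable
  also have "\<dots> \<le> (\<integral>\<^sup>+y. ennreal (f y powr p) \<partial>M)"
  proof (rule nn_integral_mono)
    fix y
    have "h y powr p' * \<kappa> y powr p \<le> f y powr p"
    proof (cases "h y = 0")
      case False
      have "p' + (1 - p') * p = 0" using p by (simp add: p' field_simps)
      hence "h y powr p' * h y powr ((1 - p') * p) = 1" using False h[of y] by (simp add: powr_add[symmetric])
      thus ?thesis using f h[of y] by (simp add: \<kappa>_def powr_mult powr_powr mult.left_commute)
    qed simp
    thus "ennreal (h y powr p') * ennreal (\<kappa> y powr p) \<le> ennreal (f y powr p)"
      by (subst ennreal_mult[symmetric]) (auto intro: ennreal_leI)
  qed
  finally show ?thesis by (simp add: mult_left_mono)
qed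

text \<open>At distance at least \<open>1\<close> the kernel is at most \<open>1\<close>, so the
  total mass bounds that part, and \<open>riesz_near\<close> with radius \<open>1\<close> the rest.
  The second form serves kernels that equal \<open>1\<close> away from the pole.\<close>

lemma riesz_finite_measure:
  fixes y :: "'a::euclidean_space"
  assumes meas: "sets M = sets borel" and M: "\<And>r. r > 0 \<Longrightarrow> emeasure M (ball y r) \<le> ennreal (C * r powr \<alpha>)"
    and C: "0 \<le> C" and \<gamma>: "0 \<le> \<gamma>" "\<gamma> < \<alpha>" and N: "emeasure M UNIV \<le> ennreal N" "0 \<le> N"
  shows "(\<integral>\<^sup>+x. riesz \<gamma> (x - y) \<partial>M) \<le> ennreal (C * 2 powr \<gamma> / (1 - 2 powr (\<gamma> - \<alpha>)) + N)"
    and "(\<integral>\<^sup>+x. (indicator (ball y 1) x * riesz \<gamma> (x - y) + 1) \<partial>M) \<le> ennreal (C * 2 powr \<gamma> / (1 - 2 powr (\<gamma> - \<alpha>)) + N)"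
proof -
  note [measurable_cong] = meas
  have sp: "space M = UNIV" using sets_eq_imp_space_eq[OF meas] by simp
  have pos: "C * 2 powr \<gamma> / (1 - 2 powr (\<gamma> - \<alpha>)) \<ge> 0"
    using C \<gamma> by (intro divide_nonneg_nonneg mult_nonneg_nonneg) (auto intro!: less_imp_le simp: powr_less_one)
  have "(\<integral>\<^sup>+x. (indicator (ball y 1) x * riesz \<gamma> (x - y) + 1) \<partial>M)
     = (\<integral>\<^sup>+x. indicator (ball y 1) x * riesz \<gamma> (x - y) \<partial>M) + emeasure M UNIV"
    by (subst nn_integral_add) (auto simp: sp)
  also have "\<dots> \<le> ennreal (C * 2 powr \<gamma> / (1 - 2 powr (\<gamma> - \<alpha>))) + ennreal N"
    using riesz_near[OF meas M C \<gamma> zero_less_one] by (intro add_mono N) simp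
  also have "\<dots> = ennreal (C * 2 powr \<gamma> / (1 - 2 powr (\<gamma> - \<alpha>)) + N)"
    using pos N by (simp add: ennreal_plus)
  finally show *: "(\<integral>\<^sup>+x. (indicator (ball y 1) x * riesz \<gamma> (x - y) + 1) \<partial>M) \<le> \<dots>" .
  have "(\<integral>\<^sup>+x. riesz \<gamma> (x - y) \<partial>M) \<le> (\<integral>\<^sup>+x. (indicator (ball y 1) x * riesz \<gamma> (x - y) + 1) \<partial>M)"
  proof (rule nn_integral_mono)
    fix x
    show "riesz \<gamma> (x - y) \<le> indicator (ball y 1) x * riesz \<gamma> (x - y) + 1"
    proof (cases "x \<in> ball y 1")
      case False
      hence "1 \<le> norm (x - y)" by (simp add: dist_norm norm_minus_commute)
      hence "norm (x - y) powr (- \<gamma>) \<le> 1 powr (- \<gamma>)" using \<gamma> by (intro powr_mono2') auto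
      thus ?thesis using False by (simp add: riesz_def ennreal_le_1)
    qed simp
  qed
  also note *
  finally show "(\<integral>\<^sup>+x. riesz \<gamma> (x - y) \<partial>M) \<le> ennreal (C * 2 powr \<gamma> / (1 - 2 powr (\<gamma> - \<alpha>)) + N)" .
qed

section \<open>Averages with a tent weight\<close>

definition tent :: "'a::euclidean_space \<Rightarrow> real" where
  "tent v = max 0 (1 - norm v)"

text \<open>
  Only \<open>F v \<bullet> v\<close> is averaged, since the symmetric gradient controls nothing else along \<open>v\<close>. On constants
  this is an invertible linear map.
\<close>

definition tent_average :: "('a::euclidean_space \<Rightarrow> 'a) \<Rightarrow> 'a" where
  "tent_average F = (LINT v|lborel. tent v *\<^sub>R ((F v \<bullet> v) *\<^sub>R v))"

lemma tent_bounds: "0 \<le> tent v" "tent v \<le> 1" "norm v \<ge> 1 \<Longrightarrow> tent v = 0"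
  by (auto simp: tent_def)

lemma continuous_on_tent: "continuous_on S f \<Longrightarrow> continuous_on S (\<lambda>x. tent (f x))"
  unfolding tent_def by (intro continuous_intros)

lemma tent_average_integrable:
  fixes F :: "'a::euclidean_space \<Rightarrow> 'a"
  assumes F: "continuous_on (cball 0 1) F"
  shows "integrable lborel (\<lambda>v. tent v *\<^sub>R ((F v \<bullet> v) *\<^sub>R v))"
proof -
  have "integrable lborel (\<lambda>v. indicator (cball 0 1) v *\<^sub>R (tent v *\<^sub>R ((F v \<bullet> v) *\<^sub>R v)))"
    by (intro borel_integrable_compact compact_cball continuous_on_scaleR continuous_on_tent continuous_on_inner F continuous_on_id)
  also have "(\<lambda>v. indicator (cball 0 1) v *\<^sub>R (tent v *\<^sub>R ((F v \<bullet> v) *\<^sub>R v))) = (\<lambda>v. tent v *\<^sub>R ((F v \<bullet> v) *\<^sub>R v))"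
  proof
    fix v :: 'a
    show "indicator (cball 0 1) v *\<^sub>R (tent v *\<^sub>R ((F v \<bullet> v) *\<^sub>R v)) = tent v *\<^sub>R ((F v \<bullet> v) *\<^sub>R v)"
      by (cases "norm v \<le> 1") (simp_all add: tent_bounds(3))
  qed
  finally show ?thesis .
qed

lemma norm_tent_average_le:
  fixes F :: "'a::euclidean_space \<Rightarrow> 'a"
  assumes F: "continuous_on (cball 0 1) F"
  shows "ennreal (norm (tent_average F)) \<le> (\<integral>\<^sup>+v. indicator (ball 0 1) v * ennreal \<bar>F v \<bullet> v\<bar> \<partial>lborel)"
proof -
  have "ennreal (norm (tent_average F)) \<le> (\<integral>\<^sup>+v. ennreal (norm (tent v *\<^sub>R ((F v \<bullet> v) *\<^sub>R v))) \<partial>lborel)"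
    unfolding tent_average_def by (rule integral_norm_bound_ennreal[OF tent_average_integrable[OF F]])
  also have "\<dots> \<le> (\<integral>\<^sup>+v. indicator (ball 0 1) v * ennreal \<bar>F v \<bullet> v\<bar> \<partial>lborel)"
  proof (rule nn_integral_mono)
    fix v :: 'a
    show "ennreal (norm (tent v *\<^sub>R ((F v \<bullet> v) *\<^sub>R v))) \<le> indicator (ball 0 1) v * ennreal \<bar>F v \<bullet> v\<bar>"
    proof (cases "norm v < 1")
      case True
      have "norm (tent v *\<^sub>R ((F v \<bullet> v) *\<^sub>R v)) = (tent v * norm v) * \<bar>F v \<bullet> v\<bar>"
        using tent_bounds[of v] by (simp add: abs_mult)
      also have "\<dots> \<le> (1 * 1) * \<bar>F v \<bullet> v\<bar>"
        using tent_bounds[of v] True by (intro mult_right_mono mult_mono) auto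
      finally show ?thesis using True by (simp add: ennreal_leI)
    qed (simp add: tent_bounds(3))
  qed
  finally show ?thesis .
qed

lemma tent_average_diff:
  assumes "continuous_on (cball 0 1) F" "continuous_on (cball 0 1) G"
  shows "tent_average (\<lambda>v. F v - G v) = tent_average F - tent_average G"
  unfolding tent_average_def
  by (subst Bochner_Integration.integral_diff[OF tent_average_integrable tent_average_integrable, symmetric])
     (use assms in \<open>auto simp: inner_diff_left scaleR_left_diff_distrib scaleR_right_diff_distrib\<close>)

lemma linear_tent_average: "linear (\<lambda>\<xi>::'a::euclidean_space. tent_average (\<lambda>_. \<xi>))"
proof
  fix a b :: 'a and r :: real
  have "tent_average (\<lambda>_. a - - b) = tent_average (\<lambda>_. a) - tent_average (\<lambda>_. - b)"
    by (rule tent_average_diff) auto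
  moreover have "tent_average (\<lambda>_. 0 - b) = tent_average (\<lambda>_. 0) - tent_average (\<lambda>_. b)"
    by (rule tent_average_diff) auto
  moreover have "tent_average (\<lambda>_. 0 :: 'a) = 0" by (simp add: tent_average_def)
  ultimately show "tent_average (\<lambda>_. a + b) = tent_average (\<lambda>_. a) + tent_average (\<lambda>_. b)" by simp
  have "(\<lambda>v. tent v *\<^sub>R (((r *\<^sub>R a) \<bullet> v) *\<^sub>R v)) = (\<lambda>v. r *\<^sub>R (tent v *\<^sub>R ((a \<bullet> v) *\<^sub>R v)))"
    by (auto simp: fun_eq_iff)
  thus "tent_average (\<lambda>_. r *\<^sub>R a) = r *\<^sub>R tent_average (\<lambda>_. a)"
    unfolding tent_average_def
    by (simp only: integral_scaleR_right)
qed

text \<open>The inner product with \<open>\<xi>\<close> turns the average into the integral of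
  \<open>tent v * (\<xi> \<bullet> v)\<^sup>2\<close>. If it vanishes, the integrand is
  \<open>0\<close> almost everywhere and, by continuity, everywhere; but on the ray through
  \<open>\<xi>\<close> at norm \<open>1/2\<close> it is positive.\<close>

lemma tent_average_const_eq_0:
  fixes \<xi> :: "'a::euclidean_space"
  assumes "tent_average (\<lambda>_. \<xi>) = 0"
  shows "\<xi> = 0"
proof (rule ccontr)
  assume \<xi>: "\<xi> \<noteq> 0"
  let ?f = "\<lambda>v. tent v * (\<xi> \<bullet> v)\<^sup>2"
  have int: "integrable lborel (\<lambda>v. tent v *\<^sub>R ((\<xi> \<bullet> v) *\<^sub>R v))"
    by (rule tent_average_integrable) auto
  have eq: "(\<lambda>v. \<xi> \<bullet> (tent v *\<^sub>R ((\<xi> \<bullet> v) *\<^sub>R v))) = ?f"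
    by (auto simp: fun_eq_iff power2_eq_square)
  have fi: "integrable lborel ?f" using integrable_inner_right[of \<xi>, OF int] unfolding eq by blast
  have "(LINT v|lborel. ?f v) = \<xi> \<bullet> tent_average (\<lambda>_. \<xi>)"
    unfolding tent_average_def eq[symmetric] by (rule integral_inner_right) (use int in auto)
  hence "(LINT v|lborel. ?f v) = 0" using assms by simp
  hence ae: "AE v in lborel. ?f v = 0"
    by (subst integral_nonneg_eq_0_iff_AE[OF fi, symmetric]) (auto simp: tent_bounds)
  have cl: "closed {v. ?f v = 0}"
    by (intro closed_Collect_eq continuous_intros continuous_on_tent)
  have "(1 / (2 * norm \<xi>)) *\<^sub>R \<xi> \<in> {v. ?f v = 0}"
    by (rule mem_closed_if_AE_lebesgue[OF cl]) (use ae in \<open>simp add: AE_completion\<close>)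
  thus False using \<xi> by (simp add: tent_def dot_square_norm power2_eq_square)
qed

lemma tent_average_coercive:
  "\<exists>c>0. \<forall>\<xi>::'a::euclidean_space. c * norm \<xi> \<le> norm (tent_average (\<lambda>_. \<xi>))"
proof -
  have "inj (\<lambda>\<xi>::'a. tent_average (\<lambda>_. \<xi>))"
    by (subst linear_injective_0[OF linear_tent_average]) (auto intro: tent_average_const_eq_0)
  then obtain B where "B > 0" "\<And>\<xi>::'a. B * norm \<xi> \<le> norm (tent_average (\<lambda>_. \<xi>))"
    using linear_inj_bounded_below_pos[OF linear_tent_average] by blast
  thus ?thesis by blast
qed

definition coercive_const :: "'a::euclidean_space itself \<Rightarrow> real" where
  "coercive_const _ = (SOME c. c > 0 \<and> (\<forall>\<xi>::'a. c * norm \<xi> \<le> norm (tent_average (\<lambda>_. \<xi>))))"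

lemma coercive_const:
  "coercive_const TYPE('a::euclidean_space) > 0"
  "coercive_const TYPE('a) * norm (\<xi>::'a) \<le> norm (tent_average (\<lambda>_. \<xi>))"
  using someI_ex[OF tent_average_coercive[where 'a='a]] unfolding coercive_const_def by blast+

text \<open>Each ray sees only one component \<open>\<xi> \<bullet> v\<close>; together they bound
  the full vector.\<close>

lemma coercive_nn_integral:
  "ennreal (coercive_const TYPE('a) * norm (\<xi>::'a::euclidean_space))
    \<le> (\<integral>\<^sup>+v. indicator (ball 0 1) v * ennreal \<bar>\<xi> \<bullet> v\<bar> \<partial>lborel)"
  by (rule order_trans[OF ennreal_leI[OF coercive_const(2)] norm_tent_average_le]) simp

lemma pointwise_ray_bound:
  fixes u :: "real^'n \<Rightarrow> real^'n"
  assumes sgb: "sym_grad_bound \<Omega> u g" and \<Omega>: "open \<Omega>" and x: "x \<in> \<Omega>"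
    and g[measurable]: "g \<in> borel_measurable borel" and u: "u \<in> C_b (closure \<Omega>)"
  shows "ennreal (coercive_const TYPE(real^'n) * norm (u x))
    \<le> (\<integral>\<^sup>+v. indicator (ball 0 1) v * ennreal (boundary_value \<Omega> u x v) \<partial>lborel)
     + ennreal (kernel_const TYPE(real^'n)) * (\<integral>\<^sup>+w. g w * newton (w - x) \<partial>lborel)"
proof -
  have uc: "continuous_on (closure \<Omega>) u" using u by (simp add: C_b_def)
  have bm[measurable]: "boundary_value \<Omega> u x \<in> borel_measurable borel"
    by (rule boundary_value_measurable[OF \<Omega> x uc])
  have "(\<integral>\<^sup>+v. indicator (ball 0 1) v * ennreal \<bar>u x \<bullet> v\<bar> \<partial>lborel)
    \<le> (\<integral>\<^sup>+v. indicator (ball 0 1) v * ennreal (boundary_value \<Omega> u x v) \<partial>lborel)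
     + ennreal (kernel_const TYPE(real^'n)) * (\<integral>\<^sup>+w. indicator UNIV (w - x) * (g w * newton (w - x)) \<partial>lborel)"
    by (rule ray_average_bound[OF g, where A = "{0..}"]) (auto intro!: exit_ray_bound[OF sgb \<Omega> x g u])
  thus ?thesis using coercive_nn_integral[of "u x"] by (simp add: order_trans)
qed

text \<open>Both measures are finite, which Fubini's theorem uses. For the boundary term \<nu> is
  the Hausdorff measure with the density |u|^\<sigma>, whose finite mass repairs the possible lack
  of sigma-finiteness.\<close>

lemma riesz_double_integral:
  fixes M \<nu> :: "'a::euclidean_space measure" and W :: "'a \<Rightarrow> ennreal"
  assumes M: "sets M = sets borel" "emeasure M UNIV < \<infinity>" and \<nu>: "sets \<nu> = sets borel" "emeasure \<nu> UNIV \<le> ennreal N"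
    and [measurable]: "W \<in> borel_measurable borel" and B: "\<And>y. (\<integral>\<^sup>+x. W (y - x) \<partial>M) \<le> ennreal B"
  shows "(\<integral>\<^sup>+x. (\<integral>\<^sup>+y. W (y - x) \<partial>\<nu>) \<partial>M) \<le> ennreal B * ennreal N"
proof -
  note [measurable_cong] = M(1) \<nu>(1)
  have sp: "space M = UNIV" "space \<nu> = UNIV" using sets_eq_imp_space_eq[OF M(1)] sets_eq_imp_space_eq[OF \<nu>(1)] by auto
  interpret M: finite_measure M using M(2) by (intro finite_measureI) (auto simp: sp)
  interpret \<nu>: finite_measure \<nu> using \<nu>(2) by (intro finite_measureI) (auto simp: sp top_unique)
  interpret pair_sigma_finite M \<nu> ..
  have "(\<integral>\<^sup>+x. (\<integral>\<^sup>+y. W (y - x) \<partial>\<nu>) \<partial>M) = (\<integral>\<^sup>+y. (\<integral>\<^sup>+x. W (y - x) \<partial>M) \<partial>\<nu>)"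
    by (rule Fubini'[symmetric]) measurable
  also have "\<dots> \<le> (\<integral>\<^sup>+y. ennreal B \<partial>\<nu>)" by (intro nn_integral_mono B)
  also have "\<dots> = ennreal B * emeasure \<nu> UNIV" by (simp add: sp)
  also have "\<dots> \<le> ennreal B * ennreal N" by (intro mult_left_mono \<nu>) simp
  finally show ?thesis .
qed

lemma ennreal_le_mult_imp:
  assumes "ennreal t \<le> ennreal c * X" "c > 0" "t \<ge> 0"
  shows "ennreal (t / c) \<le> X"
proof -
  have "ennreal (t / c) = ennreal (1 / c) * ennreal t" using assms by (simp add: ennreal_mult[symmetric])
  also have "\<dots> \<le> ennreal (1 / c) * (ennreal c * X)" by (intro mult_left_mono assms) simp
  also have "\<dots> = X" using assms by (simp add: mult.assoc[symmetric] ennreal_mult[symmetric])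
  finally show ?thesis .
qed

text \<open>Joins a bound for the power \<open>p\<close> with an inequality for the power
  \<open>s / p\<close>, such as Jensen's for a finite measure. The latter is asked only for reals
  below \<open>I\<close>, as \<open>I\<close> may be infinite.\<close>

lemma iterated_powr_bound:
  assumes t: "ennreal (t powr p) \<le> ennreal c * I" "0 \<le> t" "c > 0" and p: "0 < p"
    and J: "\<And>t'. 0 \<le> t' \<Longrightarrow> ennreal t' \<le> I \<Longrightarrow> ennreal (t' powr (s / p)) \<le> ennreal K * X" and K: "K \<ge> 0"
  shows "ennreal (t powr s) \<le> ennreal (c powr (s / p) * K) * X"
proof -
  have "ennreal ((t powr p / c) powr (s / p)) \<le> ennreal K * X"
    using t by (intro J ennreal_le_mult_imp) auto
  hence "ennreal (c powr (s / p)) * ennreal ((t powr p / c) powr (s / p)) \<le> ennreal (c powr (s / p)) * (ennreal K * X)"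
    by (rule mult_left_mono) simp
  also have "ennreal (c powr (s / p)) * ennreal ((t powr p / c) powr (s / p)) = ennreal (t powr s)"
    using t p by (subst ennreal_mult[symmetric]) (auto simp: powr_divide powr_powr)
  also have "ennreal (c powr (s / p)) * (ennreal K * X) = ennreal (c powr (s / p) * K) * X"
    using K by (simp add: ennreal_mult mult.assoc)
  finally show ?thesis .
qed

lemma boundary_value_nonneg: "0 \<le> boundary_value \<Omega> u x v"
  by (simp add: boundary_value_def)

text \<open>Jensen's inequality is used twice: on the unit ball with exponent \<sigma>, after which
  the exit points are replaced by the potential of \<nu>, and then for the finite measure \<nu> with
  exponent \<open>s / \<sigma>\<close>, which acts on the kernel only.\<close>

lemma boundary_part_bound:
  fixes u :: "real^'n \<Rightarrow> real^'n"
  assumes n: "CARD('n) \<ge> 2" and \<Omega>: "open \<Omega>" and x: "x \<in> \<Omega>" and u: "u \<in> C_b (closure \<Omega>)"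
    and \<sigma>: "1 \<le> \<sigma>" "\<sigma> \<le> s" and N2: "0 \<le> N2"
    and bd: "(\<integral>\<^sup>+y. ennreal (norm (u y) powr \<sigma>) \<partial>boundary_measure \<Omega>) \<le> ennreal N2"
    and t: "0 \<le> t" "ennreal t \<le> (\<integral>\<^sup>+v. indicator (ball 0 1) v * ennreal (boundary_value \<Omega> u x v) \<partial>lborel)"
  defines "\<nu> \<equiv> density (hausdorff_measure (real CARD('n) - 1)) (\<lambda>y. ennreal (norm (indicator (frontier \<Omega>) y *\<^sub>R u y) powr \<sigma>))"
  shows "ennreal (t powr s) \<le> ennreal (((1 + unit_ball_vol (real CARD('n))) powr \<sigma> * boundary_const TYPE(real^'n)) powr (s / \<sigma>) * (1 + N2) powr (s / \<sigma>))
     * (\<integral>\<^sup>+y. riesz ((real CARD('n) - 1) * (s / \<sigma>)) (y - x) \<partial>\<nu>)"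
    and "emeasure \<nu> UNIV \<le> ennreal N2"
proof -
  let ?H = "hausdorff_measure (real CARD('n) - 1) :: (real^'n) measure"
  define F where "F y = ennreal (norm (indicator (frontier \<Omega>) y *\<^sub>R u y) powr \<sigma>)" for y
  have uc: "continuous_on (closure \<Omega>) u" using u by (simp add: C_b_def)
  have [measurable]: "boundary_value \<Omega> u x \<in> borel_measurable borel"
    by (rule boundary_value_measurable[OF \<Omega> x uc])
  have [measurable]: "(\<lambda>y. indicator (frontier \<Omega>) y *\<^sub>R u y) \<in> borel_measurable borel"
    by (rule closure_restrict_measurable) (auto intro: continuous_on_subset[OF uc] simp: frontier_def)
  have [measurable]: "F \<in> borel_measurable borel" unfolding F_def by measurable
  have "emeasure \<nu> UNIV = (\<integral>\<^sup>+y. F y \<partial>?H)"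
    unfolding \<nu>_def F_def[symmetric] by (subst emeasure_density) auto
  also have "\<dots> = (\<integral>\<^sup>+y. ennreal (norm (u y) powr \<sigma>) * indicator (frontier \<Omega>) y \<partial>?H)"
    using \<sigma> by (intro nn_integral_cong) (auto simp: F_def indicator_def)
  also have "\<dots> = (\<integral>\<^sup>+y. ennreal (norm (u y) powr \<sigma>) \<partial>boundary_measure \<Omega>)"
    unfolding boundary_measure_def by (rule nn_integral_restrict_space[symmetric]) simp
  finally show tot: "emeasure \<nu> UNIV \<le> ennreal N2" using bd by simp
  let ?\<beta> = "density lborel (indicator (ball 0 1)) :: (real^'n) measure"
  have c1: "(1 + unit_ball_vol (real CARD('n))) powr \<sigma> > 0" by (intro powr_gt_zero[THEN iffD2]) (smt (verit) unit_ball_vol_nonneg of_nat_0_le_iff)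
  have bc: "boundary_const TYPE(real^'n) > 0"
    using n by (simp add: boundary_const_def tube_const_def)
  have "ennreal (t powr \<sigma>) \<le> ennreal ((1 + unit_ball_vol (real CARD('n))) powr \<sigma>) * (\<integral>\<^sup>+v. ennreal (boundary_value \<Omega> u x v powr \<sigma>) \<partial>?\<beta>)"
  proof (rule powr_jensen_bound)
    show "emeasure ?\<beta> (space ?\<beta>) \<le> ennreal (unit_ball_vol (real CARD('n)))"
      by (simp add: emeasure_density emeasure_ball)
    show "ennreal t \<le> (\<integral>\<^sup>+v. ennreal (boundary_value \<Omega> u x v) \<partial>?\<beta>)"
      using t by (subst nn_integral_density) auto
  qed (use t \<sigma> in \<open>auto simp: boundary_value_nonneg\<close>)
  also have "(\<integral>\<^sup>+v. ennreal (boundary_value \<Omega> u x v powr \<sigma>) \<partial>?\<beta>)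
      = (\<integral>\<^sup>+v. indicator (ball 0 1 \<inter> exits \<Omega> x) v * F (exit_point \<Omega> x v) \<partial>lborel)"
  proof -
    have "indicator (ball 0 1) v * ennreal (boundary_value \<Omega> u x v powr \<sigma>)
        = indicator (ball 0 1 \<inter> exits \<Omega> x) v * F (exit_point \<Omega> x v)" for v
      using exit_point_frontier[OF \<Omega> x, of v] \<sigma> by (auto simp: indicator_def F_def boundary_value_def)
    thus ?thesis by (subst nn_integral_density) auto
  qed
  also have "\<dots> \<le> ennreal (boundary_const TYPE(real^'n)) * (\<integral>\<^sup>+y. F y * newton (y - x) \<partial>hausdorff_measure (real DIM(real^'n) - 1))"
    by (rule exit_integral_le_hausdorff[OF _ \<Omega> x]) (use n in simp_all)
  also have "(\<integral>\<^sup>+y. F y * newton (y - x) \<partial>hausdorff_measure (real DIM(real^'n) - 1)) = (\<integral>\<^sup>+y. newton (y - x) \<partial>\<nu>)"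
    unfolding \<nu>_def F_def[symmetric] by (subst nn_integral_density) simp_all
  finally have *: "ennreal (t powr \<sigma>) \<le> ennreal ((1 + unit_ball_vol (real CARD('n))) powr \<sigma> * boundary_const TYPE(real^'n))
       * (\<integral>\<^sup>+y. newton (y - x) \<partial>\<nu>)"
    using bc by (simp add: ennreal_mult mult.assoc mult_left_mono)
  show "ennreal (t powr s) \<le> ennreal (((1 + unit_ball_vol (real CARD('n))) powr \<sigma> * boundary_const TYPE(real^'n)) powr (s / \<sigma>) * (1 + N2) powr (s / \<sigma>))
     * (\<integral>\<^sup>+y. riesz ((real CARD('n) - 1) * (s / \<sigma>)) (y - x) \<partial>\<nu>)"
  proof (rule iterated_powr_bound[OF * t(1)])
    fix t' :: real assume t': "0 \<le> t'" "ennreal t' \<le> (\<integral>\<^sup>+y. newton (y - x) \<partial>\<nu>)"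
    have "ennreal (t' powr (s / \<sigma>)) \<le> ennreal ((1 + N2) powr (s / \<sigma>))
        * (\<integral>\<^sup>+y. ennreal ((norm (y - x) powr (- (real CARD('n) - 1))) powr (s / \<sigma>)) \<partial>\<nu>)"
      by (rule powr_jensen_bound) (use t' \<sigma> N2 tot in \<open>auto simp: \<nu>_def riesz_def\<close>)
    thus "ennreal (t' powr (s / \<sigma>)) \<le> ennreal ((1 + N2) powr (s / \<sigma>))
        * (\<integral>\<^sup>+y. riesz ((real CARD('n) - 1) * (s / \<sigma>)) (y - x) \<partial>\<nu>)"
      by (simp only: riesz_def powr_powr mult_minus_left)
  qed (use c1 bc \<sigma> in auto)
qed

text \<open>Hoelder's inequality on the whole space requires a factor whose power \<open>p'\<close>
  is integrable both at the origin and at infinity, which no single power is. The far exponent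
  \<open>0\<close> gives a kernel bounded away from the origin.\<close>

definition near_far :: "real \<Rightarrow> real \<Rightarrow> 'a::euclidean_space \<Rightarrow> real" where
  "near_far \<beta> \<gamma> z = (if norm z < 1 then norm z powr (- \<beta>) else norm z powr (- \<gamma>))"

lemma near_far_measurable [measurable]: "near_far \<beta> \<gamma> \<in> borel_measurable borel"
  unfolding near_far_def[abs_def] by measurable

lemma near_far_mult: "near_far \<beta> \<gamma> z * near_far \<beta>' \<gamma>' z = near_far (\<beta> + \<beta>') (\<gamma> + \<gamma>') z"
  by (simp add: near_far_def powr_add[symmetric])

lemma near_far_nonneg: "0 \<le> near_far \<beta> \<gamma> z"
  by (simp add: near_far_def)

lemma near_far_powr: "near_far \<beta> \<gamma> z powr r = near_far (\<beta> * r) (\<gamma> * r) z"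
  by (simp add: near_far_def powr_powr)

lemma near_far_same: "ennreal (near_far \<gamma> \<gamma> z) = riesz \<gamma> z"
  by (simp add: near_far_def riesz_def)

lemma near_far_integral:
  fixes x :: "'a::euclidean_space"
  assumes "0 \<le> \<beta>" "\<beta> < real DIM('a)" "real DIM('a) < \<gamma>"
  shows "\<exists>B\<ge>0. \<forall>x::'a. (\<integral>\<^sup>+w. ennreal (near_far \<beta> \<gamma> (w - x)) \<partial>lborel) \<le> ennreal B"
proof -
  let ?n = "real DIM('a)"
  define B1 where "B1 = unit_ball_vol ?n * 2 powr \<beta> * 1 powr (?n - \<beta>) / (1 - 2 powr (\<beta> - ?n))"
  define B2 where "B2 = unit_ball_vol ?n * 2 powr ?n * 1 powr (?n - \<gamma>) / (1 - 2 powr (?n - \<gamma>))"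
  have B: "B1 \<ge> 0" "B2 \<ge> 0" unfolding B1_def B2_def using assms
    by (auto intro!: divide_nonneg_nonneg mult_nonneg_nonneg less_imp_le simp: powr_less_one)
  have "(\<integral>\<^sup>+w. ennreal (near_far \<beta> \<gamma> (w - x)) \<partial>lborel) \<le> ennreal (B1 + B2)" for x :: 'a
  proof -
    have "(\<integral>\<^sup>+w. ennreal (near_far \<beta> \<gamma> (w - x)) \<partial>lborel)
       = (\<integral>\<^sup>+w. indicator (ball x 1) w * riesz \<beta> (w - x) + indicator (- ball x 1) w * riesz \<gamma> (w - x) \<partial>lborel)"
      by (intro nn_integral_cong) (auto simp: near_far_def riesz_def indicator_def dist_norm norm_minus_commute)
    also have "\<dots> = (\<integral>\<^sup>+w. indicator (ball x 1) w * riesz \<beta> (w - x) \<partial>lborel) + (\<integral>\<^sup>+w. indicator (- ball x 1) w * riesz \<gamma> (w - x) \<partial>lborel)"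
      by (rule nn_integral_add) auto
    also have "\<dots> \<le> ennreal B1 + ennreal B2"
      unfolding B1_def B2_def using assms
      by (intro add_mono riesz_near riesz_far lborel_ball_growth) auto
    finally show ?thesis using B by (simp add: ennreal_plus)
  qed
  thus ?thesis using B by (intro exI[of _ "B1 + B2"]) auto
qed

text \<open>The kernel is the product of \<open>near_far (n - 1 - \<beta>) 0\<close> and
  \<open>near_far \<beta> (n - 1)\<close>. Hoelder's inequality spends the second factor, which
  costs \<open>B\<close>, and leaves the potential of \<open>g powr p\<close> with the
  \<open>p\<close>-th power of the first; Jensen's inequality for the finite measure \<nu> then
  raises it to \<open>s / p\<close>.\<close>

lemma potential_part_bound:
  fixes g :: "'a::euclidean_space \<Rightarrow> real"
  assumes g[measurable]: "g \<in> borel_measurable borel" "\<And>y. 0 \<le> g y"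
    and p: "1 < p" "p \<le> s" and k: "k \<ge> 0" and N1: "0 \<le> N1" "(\<integral>\<^sup>+y. ennreal (g y powr p) \<partial>lborel) \<le> ennreal N1"
    and B: "B \<ge> 0" "\<And>x::'a. (\<integral>\<^sup>+w. ennreal (near_far (\<beta> * (p / (p - 1))) ((real DIM('a) - 1) * (p / (p - 1))) (w - x)) \<partial>lborel) \<le> ennreal B"
    and t: "0 \<le> t" "ennreal t \<le> ennreal k * (\<integral>\<^sup>+w. ennreal (g w) * newton (w - x) \<partial>lborel)"
  defines "\<nu> \<equiv> density lborel (\<lambda>y. ennreal (g y powr p))"
  shows "ennreal (t powr s) \<le> ennreal (((1 + B) powr p * (k powr p + 1)) powr (s / p) * (1 + N1) powr (s / p))
     * (\<integral>\<^sup>+y. ennreal (near_far ((real DIM('a) - 1 - \<beta>) * s) 0 (y - x)) \<partial>\<nu>)"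
proof -
  let ?n = "real DIM('a)" and ?a = "\<lambda>w. near_far (real DIM('a) - 1 - \<beta>) 0 (w - x)"
  let ?b = "\<lambda>w. near_far \<beta> (real DIM('a) - 1) (w - x)"
  have tot: "emeasure \<nu> (space \<nu>) \<le> ennreal N1"
    using N1 by (simp add: \<nu>_def emeasure_density)
  have ab: "ennreal (k * g w * ?a w * ?b w) = ennreal k * (ennreal (g w) * newton (w - x))" for w
  proof -
    have "?a w * ?b w = near_far (?n - 1) (?n - 1) (w - x)" by (simp add: near_far_mult)
    thus ?thesis using k g(2)[of w] near_far_nonneg[of "?n - 1" "?n - 1" "w - x"]
      by (simp add: near_far_same[symmetric] ennreal_mult[symmetric] mult.assoc)
  qed
  have "ennreal (t powr p) \<le> ennreal ((1 + B) powr p) * (\<integral>\<^sup>+w. ennreal ((k * g w * ?a w) powr p) \<partial>lborel)"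
  proof (rule powr_holder_bound[where h = ?b and p' = "p / (p - 1)"])
    show "(\<integral>\<^sup>+w. ennreal (?b w powr (p / (p - 1))) \<partial>lborel) \<le> ennreal B"
      using B(2)[of x] by (simp add: near_far_powr)
    have "(\<integral>\<^sup>+w. ennreal (k * g w * ?a w * ?b w) \<partial>lborel) = ennreal k * (\<integral>\<^sup>+w. ennreal (g w) * newton (w - x) \<partial>lborel)"
      unfolding ab by (rule nn_integral_cmult) measurable
    thus "ennreal t \<le> (\<integral>\<^sup>+w. ennreal (k * g w * ?a w * ?b w) \<partial>lborel)" using t by simp
  qed (use p B t k g in \<open>auto intro!: mult_nonneg_nonneg near_far_nonneg\<close>)
  \<comment> \<open>\<open>k powr p\<close> may be \<open>0\<close>; the added \<open>1\<close>
    makes the constant positive, as \<open>iterated_powr_bound\<close> requires.\<close>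
  also have "(\<integral>\<^sup>+w. ennreal ((k * g w * ?a w) powr p) \<partial>lborel) \<le> (\<integral>\<^sup>+w. ennreal (k powr p + 1) * (ennreal (g w powr p) * ennreal (?a w powr p)) \<partial>lborel)"
  proof (rule nn_integral_mono)
    fix w
    have "(k * g w * ?a w) powr p = k powr p * (g w powr p * ?a w powr p)"
      using k g(2)[of w] near_far_nonneg[of "?n - 1 - \<beta>" 0 "w - x"] by (simp add: powr_mult mult.assoc)
    also have "\<dots> \<le> (k powr p + 1) * (g w powr p * ?a w powr p)" by (intro mult_right_mono) auto
    finally show "ennreal ((k * g w * ?a w) powr p) \<le> ennreal (k powr p + 1) * (ennreal (g w powr p) * ennreal (?a w powr p))"
      by (simp only: ennreal_mult[symmetric] powr_ge_zero mult_nonneg_nonneg add_nonneg_nonneg zero_le_one) (rule ennreal_leI)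
  qed
  also have "\<dots> = ennreal (k powr p + 1) * (\<integral>\<^sup>+w. ennreal (?a w powr p) \<partial>\<nu>)"
    unfolding \<nu>_def by (subst nn_integral_density, simp, simp, rule nn_integral_cmult) measurable
  finally have *: "ennreal (t powr p) \<le> ennreal ((1 + B) powr p * (k powr p + 1)) * (\<integral>\<^sup>+w. ennreal (?a w powr p) \<partial>\<nu>)"
    by (simp add: ennreal_mult mult.assoc mult_left_mono)
  show ?thesis
  proof (rule iterated_powr_bound[OF * t(1)])
    fix t' :: real assume t': "0 \<le> t'" "ennreal t' \<le> (\<integral>\<^sup>+w. ennreal (?a w powr p) \<partial>\<nu>)"
    have "ennreal (t' powr (s / p)) \<le> ennreal ((1 + N1) powr (s / p)) * (\<integral>\<^sup>+y. ennreal ((?a y powr p) powr (s / p)) \<partial>\<nu>)"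
      by (rule powr_jensen_bound) (use t' p N1 tot in \<open>auto simp: \<nu>_def\<close>)
    thus "ennreal (t' powr (s / p)) \<le> ennreal ((1 + N1) powr (s / p))
        * (\<integral>\<^sup>+y. ennreal (near_far ((?n - 1 - \<beta>) * s) 0 (y - x)) \<partial>\<nu>)"
      using p by (simp add: near_far_powr)
  next
    have "(1 + B) powr p > 0" using B by simp
    thus "0 < (1 + B) powr p * (k powr p + 1)" by (intro mult_pos_pos) (auto intro: add_nonneg_pos)
  qed (use p in auto)
qed

section \<open>The uniform bound with exponent \<open>s\<close>\<close>

lemma trace_exponent_ge:
  fixes p n :: real
  assumes "1 < p" "p < n" shows "p \<le> p * (n - 1) / (n - p)"
proof -
  have "p * (n - p) \<le> p * (n - 1)" using assms by (intro mult_left_mono) auto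
  thus ?thesis using assms by (simp add: field_simps)
qed

text \<open>\<open>N1\<close> and \<open>N2\<close> bound integrals of powers, not norms, since they
  serve as total masses of measures. The dominating function \<open>g\<close> is a parameter, Borel
  and defined on the whole space.\<close>

definition energy_bounded ::
  "(real^'n) set \<Rightarrow> real \<Rightarrow> real \<Rightarrow> real \<Rightarrow> (real^'n \<Rightarrow> real^'n) \<Rightarrow> (real^'n \<Rightarrow> real) \<Rightarrow> bool" where
  "energy_bounded \<Omega> p N1 N2 u g \<longleftrightarrow>
     u \<in> C_b (closure \<Omega>) \<and> sym_grad_bound \<Omega> u (\<lambda>w. ennreal (g w)) \<and> g \<in> borel_measurable borel
     \<and> (\<forall>w. 0 \<le> g w) \<and> (\<integral>\<^sup>+y. ennreal (g y powr p) \<partial>lborel) \<le> ennreal N1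
     \<and> (\<integral>\<^sup>+y. ennreal (norm (u y) powr (p * (real CARD('n) - 1) / (real CARD('n) - p))) \<partial>boundary_measure \<Omega>) \<le> ennreal N2"

text \<open>Stated for any finite measure with the growth condition, because it is applied both to
  the given measure and, with exponent \<open>n\<close>, to Lebesgue measure on a compact set. The
  constant precedes \<open>u\<close> and \<open>g\<close>, so it is uniform along the sequence. The
  lower bounds on \<open>s\<close> are those of the second application of Jensen's inequality in
  either part.\<close>

lemma Ls_bound:
  fixes \<Omega> :: "(real^'n) set" and M :: "(real^'n) measure"
  defines "n \<equiv> real CARD('n)"
  assumes card: "CARD('n) \<ge> 2" and \<Omega>: "open \<Omega>" and p: "1 < p" "p < n" and \<alpha>: "n - 1 < \<alpha>"
    and s: "p \<le> s" "p * (n - 1) / (n - p) \<le> s" "s < \<alpha> * p / (n - p)"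
    and M: "sets M = sets borel" "emeasure M UNIV < \<infinity>" and C: "C \<ge> 0"
    and growth: "\<And>y r. r > 0 \<Longrightarrow> emeasure M (ball y r) \<le> ennreal (C * r powr \<alpha>)"
    and N: "0 \<le> N1" "0 \<le> N2"
  shows "\<exists>K\<ge>0. \<forall>u g. energy_bounded \<Omega> p N1 N2 u g
     \<longrightarrow> (\<integral>\<^sup>+x. indicator \<Omega> x * ennreal (norm (u x) powr s) \<partial>M) \<le> ennreal K"
proof -
  note [measurable_cong] = M(1)
  have sp: "space M = UNIV" using sets_eq_imp_space_eq[OF M(1)] by simp
  define \<sigma> where "\<sigma> = p * (n - 1) / (n - p)"
  define p' where "p' = p / (p - 1)"
  have n: "n \<ge> 2" using card by (simp add: n_def)
  have \<sigma>p: "p \<le> \<sigma>"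
    unfolding \<sigma>_def by (rule trace_exponent_ge[OF p])
  obtain N0 where N0: "emeasure M UNIV = ennreal N0" "N0 \<ge> 0" using M(2) by (cases "emeasure M UNIV") auto
  have \<alpha>s: "n - 1 - \<alpha> / s < n / p'"
  proof -
    have "s * (n - p) < \<alpha> * p" using s p by (simp add: field_simps)
    moreover have sp0: "s > 0" using s p by simp
    ultimately have "n / p - 1 < \<alpha> / s" using p by (simp add: field_simps)
    moreover have "n / p' = n - n / p" using p by (simp add: p'_def field_simps)
    ultimately show ?thesis by simp
  qed
  \<comment> \<open>The kernel is split as \<open>|z|\<^sup>1\<^sup>-\<^sup>n = |z|\<^sup>\<beta>\<^sup>+\<^sup>1\<^sup>-\<^sup>n |z|\<^sup>-\<^sup>\<beta>\<close> near \<open>0\<close>: the second factor has to be in \<open>L\<^sup>p'\<close>, and the power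
    \<open>s\<close> of the first one \<open>M\<close>-integrable. Both are possible exactly because \<open>s < \<alpha> p / (n - p)\<close>.\<close>
  define \<beta> where "\<beta> = (max 0 (n - 1 - \<alpha> / s) + n / p') / 2"
  have np: "n / p' > 0" "n / p' < n - 1"
  proof -
    show "n / p' > 0" using p n by (simp add: p'_def)
    have "n * (p - 1) < (n - 1) * p" using p by (simp add: algebra_simps)
    thus "n / p' < n - 1" using p by (simp add: p'_def field_simps)
  qed
  have \<beta>: "0 \<le> \<beta>" "\<beta> < n / p'" "n - 1 - \<alpha> / s < \<beta>" "\<beta> < n - 1"
  proof -
    define m q where "m = max 0 (n - 1 - \<alpha> / s)" and "q = n / p'"
    have *: "0 \<le> m" "n - 1 - \<alpha> / s \<le> m" "m < q" "0 < q" "q < n - 1" "\<beta> = (m + q) / 2"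
      using \<alpha>s np by (auto simp: m_def q_def \<beta>_def)
    have "0 \<le> \<beta>" "\<beta> < q" "m < \<beta>" unfolding *(6) using * by (simp_all add: field_simps)
    thus "0 \<le> \<beta>" "\<beta> < n / p'" "n - 1 - \<alpha> / s < \<beta>" "\<beta> < n - 1"
      using * unfolding q_def[symmetric] by auto
  qed
  have p'0: "p' > 0" using p by (simp add: p'_def)
  have s0: "s > 0" using s p by simp
  have b1: "\<beta> * p' < n" using \<beta>(2) p'0 by (simp add: field_simps)
  have b2: "n < (n - 1) * p'" using np(2) p'0 by (simp add: field_simps)
  have b3: "(n - 1 - \<beta>) * s < \<alpha>"
    using \<beta>(3) s0 by (simp add: field_simps)
  have b4: "(n - 1) * (s / \<sigma>) < \<alpha>"
  proof -
    have "(n - 1) * (s / \<sigma>) = s * (n - p) / p" using n p by (simp add: \<sigma>_def)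
    also have "\<dots> < \<alpha>" using s p by (simp add: field_simps)
    finally show ?thesis .
  qed
  obtain B where B: "B \<ge> 0" "\<And>x::real^'n. (\<integral>\<^sup>+w. ennreal (near_far (\<beta> * p') ((n - 1) * p') (w - x)) \<partial>lborel) \<le> ennreal B"
    using near_far_integral[of "\<beta> * p'" "(n - 1) * p'", where 'a="real^'n"] \<beta>(1) p'0 b1 b2 by (auto simp: n_def)
  define k where "k = kernel_const TYPE(real^'n)"
  define c where "c = coercive_const TYPE(real^'n)"
  have c: "c > 0" by (simp add: c_def coercive_const)
  define K1 where "K1 = ((1 + unit_ball_vol n) powr \<sigma> * boundary_const TYPE(real^'n)) powr (s / \<sigma>) * (1 + N2) powr (s / \<sigma>)"
  define K2 where "K2 = ((1 + B) powr p * (k powr p + 1)) powr (s / p) * (1 + N1) powr (s / p)"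
  define G1 where "G1 = C * 2 powr ((n - 1) * (s / \<sigma>)) / (1 - 2 powr ((n - 1) * (s / \<sigma>) - \<alpha>)) + N0"
  define G2 where "G2 = C * 2 powr ((n - 1 - \<beta>) * s) / (1 - 2 powr ((n - 1 - \<beta>) * s - \<alpha>)) + N0"
  have K0: "K1 \<ge> 0" "K2 \<ge> 0" by (simp_all add: K1_def K2_def)
  have G0: "G1 \<ge> 0" "G2 \<ge> 0"
  proof -
    have "C * 2 powr \<gamma> / (1 - 2 powr (\<gamma> - \<alpha>)) + N0 \<ge> 0" if "\<gamma> < \<alpha>" for \<gamma>
    proof -
      have "2 powr (\<gamma> - \<alpha>) < 1" using that by (simp add: powr_less_one)
      thus ?thesis using C N0 by (intro add_nonneg_nonneg divide_nonneg_nonneg mult_nonneg_nonneg) auto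
    qed
    thus "G1 \<ge> 0" "G2 \<ge> 0" unfolding G1_def G2_def using b3 b4 by blast+
  qed
  define K where "K = (2 / c) powr s * (K1 * (G1 * N2) + K2 * (G2 * N1))"
  show ?thesis
  proof (intro exI[of _ K] conjI allI impI)
    show "0 \<le> K" using K0 G0 N by (simp add: K_def)
    fix u g
    assume "energy_bounded \<Omega> p N1 N2 u g"
    hence u: "u \<in> C_b (closure \<Omega>)" and sgb: "sym_grad_bound \<Omega> u (\<lambda>w. ennreal (g w))"
      and g[measurable]: "g \<in> borel_measurable borel" and g0: "\<forall>w. 0 \<le> g w"
      and gp: "(\<integral>\<^sup>+y. ennreal (g y powr p) \<partial>lborel) \<le> ennreal N1"
      and ub': "(\<integral>\<^sup>+y. ennreal (norm (u y) powr \<sigma>) \<partial>boundary_measure \<Omega>) \<le> ennreal N2"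
      unfolding energy_bounded_def \<sigma>_def n_def by blast+
    have \<sigma>1: "1 \<le> \<sigma>" "\<sigma> \<le> s" using \<sigma>p p s(2)[folded \<sigma>_def] by auto
    define \<nu>1 where "\<nu>1 = density (hausdorff_measure (real CARD('n) - 1)) (\<lambda>y. ennreal (norm (indicator (frontier \<Omega>) y *\<^sub>R u y) powr \<sigma>))"
    define \<nu>2 where "\<nu>2 = density lborel (\<lambda>y. ennreal (g y powr p))"
    define W1 :: "real^'n \<Rightarrow> ennreal" where "W1 = riesz ((n - 1) * (s / \<sigma>))"
    define W2 :: "real^'n \<Rightarrow> ennreal" where "W2 z = ennreal (near_far ((n - 1 - \<beta>) * s) 0 z)" for z
    define X1 where "X1 x = (\<integral>\<^sup>+y. W1 (y - x) \<partial>\<nu>1)" for x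
    define X2 where "X2 x = (\<integral>\<^sup>+y. W2 (y - x) \<partial>\<nu>2)" for x
    have [measurable]: "W1 \<in> borel_measurable borel" "W2 \<in> borel_measurable borel"
      unfolding W1_def W2_def[abs_def] by measurable
    have \<nu>s: "sets \<nu>1 = sets borel" "sets \<nu>2 = sets borel" by (simp_all add: \<nu>1_def \<nu>2_def)
    have \<nu>2N: "emeasure \<nu>2 UNIV \<le> ennreal N1" using gp by (simp add: \<nu>2_def emeasure_density)
    have \<nu>1N: "emeasure \<nu>1 UNIV \<le> ennreal N2" if "x \<in> \<Omega>" for x
      unfolding \<nu>1_def
      by (rule boundary_part_bound(2)[OF card \<Omega> that u, of \<sigma> s N2 0]) (use \<sigma>1 N ub' in auto)
    have pt: "indicator \<Omega> x * ennreal (norm (u x) powr s)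
        \<le> ennreal ((2 / c) powr s) * (ennreal K1 * X1 x + ennreal K2 * X2 x)" for x
    proof (cases "x \<in> \<Omega>")
      case True
      \<comment> \<open>Half of the left side of the ray bound lies below one of its two terms, so
        each term can be estimated alone; the factor \<open>(2 / c) powr s\<close> undoes the
        scaling.\<close>
      define t where "t = c * norm (u x) / 2"
      have t0: "t \<ge> 0" using c by (simp add: t_def)
      let ?I1 = "\<integral>\<^sup>+v. indicator (ball 0 1) v * ennreal (boundary_value \<Omega> u x v) \<partial>lborel"
      let ?I2 = "ennreal k * (\<integral>\<^sup>+w. ennreal (g w) * newton (w - x) \<partial>lborel)"
      have "ennreal (c * norm (u x)) \<le> ?I1 + ?I2"
        using pointwise_ray_bound[OF sgb \<Omega> True _ u] by (simp add: c_def k_def)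
      hence le: "ennreal t + ennreal t \<le> ?I1 + ?I2"
        using t0 by (simp add: t_def ennreal_plus[symmetric] del: ennreal_plus)
      have "ennreal t \<le> ?I1 \<or> ennreal t \<le> ?I2"
      proof (rule ccontr)
        assume "\<not> ?thesis"
        hence "?I1 + ?I2 < ennreal t + ennreal t" by (intro add_strict_mono) auto
        with le show False by simp
      qed
      hence "ennreal (t powr s) \<le> ennreal K1 * X1 x + ennreal K2 * X2 x"
      proof
        assume I1: "ennreal t \<le> ?I1"
        have "ennreal (t powr s) \<le> ennreal K1 * X1 x"
          unfolding K1_def X1_def W1_def \<nu>1_def n_def
          by (rule boundary_part_bound(1)[OF card \<Omega> True u _ _ _ _ t0 I1]) (use \<sigma>1 N ub' in auto)
        thus ?thesis by (rule order_trans) simp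
      next
        assume I2: "ennreal t \<le> ?I2"
        have "ennreal (t powr s) \<le> ennreal (((1 + B) powr p * (k powr p + 1)) powr (s / p) * (1 + N1) powr (s / p))
            * (\<integral>\<^sup>+y. ennreal (near_far ((real DIM(real^'n) - 1 - \<beta>) * s) 0 (y - x)) \<partial>\<nu>2)"
          unfolding \<nu>2_def
          by (rule potential_part_bound[OF g _ _ _ _ _ _ _ _ t0 I2])
             (use g0 p s N gp B in \<open>auto simp: k_def kernel_const_nonneg n_def p'_def\<close>)
        hence "ennreal (t powr s) \<le> ennreal K2 * X2 x"
          by (simp add: K2_def X2_def W2_def n_def)
        thus ?thesis by (rule order_trans) simp
      qed
      hence "ennreal ((2 / c) powr s) * ennreal (t powr s) \<le> ennreal ((2 / c) powr s) * (ennreal K1 * X1 x + ennreal K2 * X2 x)"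
        by (rule mult_left_mono) simp
      moreover have "ennreal ((2 / c) powr s) * ennreal (t powr s) = ennreal (norm (u x) powr s)"
        using c t0 by (simp add: ennreal_mult[symmetric] powr_mult[symmetric] t_def)
      ultimately show ?thesis using True by simp
    qed simp
    show "(\<integral>\<^sup>+x. indicator \<Omega> x * ennreal (norm (u x) powr s) \<partial>M) \<le> ennreal K"
    proof (cases "\<Omega> = {}")
      case False
      \<comment> \<open>The mass of \<open>\<nu>1\<close> is bounded by a lemma stated at a point of
        \<Omega>; the choice of \<open>x0\<close> is irrelevant.\<close>
      then obtain x0 where x0: "x0 \<in> \<Omega>" by blast
      interpret \<nu>1: finite_measure \<nu>1
        using \<nu>1N[OF x0] sets_eq_imp_space_eq[OF \<nu>s(1)] by (intro finite_measureI) (auto simp: top_unique)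
      interpret \<nu>2: finite_measure \<nu>2
        using \<nu>2N sets_eq_imp_space_eq[OF \<nu>s(2)] by (intro finite_measureI) (auto simp: top_unique)
      note [measurable_cong] = \<nu>s
      have [measurable]: "X1 \<in> borel_measurable M" "X2 \<in> borel_measurable M"
        unfolding X1_def[abs_def] X2_def[abs_def] by measurable
      have "(\<integral>\<^sup>+x. indicator \<Omega> x * ennreal (norm (u x) powr s) \<partial>M)
         \<le> (\<integral>\<^sup>+x. ennreal ((2 / c) powr s) * (ennreal K1 * X1 x + ennreal K2 * X2 x) \<partial>M)"
        by (intro nn_integral_mono pt)
      also have "\<dots> = ennreal ((2 / c) powr s) * (ennreal K1 * (\<integral>\<^sup>+x. X1 x \<partial>M) + ennreal K2 * (\<integral>\<^sup>+x. X2 x \<partial>M))"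
        by (simp add: nn_integral_cmult nn_integral_add)
      also have "\<dots> \<le> ennreal ((2 / c) powr s) * (ennreal K1 * (ennreal G1 * ennreal N2) + ennreal K2 * (ennreal G2 * ennreal N1))"
      proof (intro mult_left_mono add_mono)
        show "(\<integral>\<^sup>+x. X1 x \<partial>M) \<le> ennreal G1 * ennreal N2"
          unfolding X1_def
        proof (rule riesz_double_integral[OF M \<nu>s(1) \<nu>1N[OF x0]])
          fix y :: "real^'n"
          have "(\<integral>\<^sup>+x. W1 (x - y) \<partial>M) \<le> ennreal G1"
            unfolding W1_def G1_def by (rule riesz_finite_measure(1)[OF M(1) growth C]) (use b4 n s0 \<sigma>p p N0 in auto)
          thus "(\<integral>\<^sup>+x. W1 (y - x) \<partial>M) \<le> ennreal G1" by (simp add: W1_def riesz_minus_commute)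
        qed simp
        show "(\<integral>\<^sup>+x. X2 x \<partial>M) \<le> ennreal G2 * ennreal N1"
          unfolding X2_def
        proof (rule riesz_double_integral[OF M \<nu>s(2) \<nu>2N])
          fix y :: "real^'n"
          have "(\<integral>\<^sup>+x. W2 (y - x) \<partial>M) \<le> (\<integral>\<^sup>+x. (indicator (ball y 1) x * riesz ((n - 1 - \<beta>) * s) (x - y) + 1) \<partial>M)"
            by (intro nn_integral_mono) (auto simp: W2_def near_far_def riesz_def dist_norm norm_minus_commute indicator_def)
          also have "\<dots> \<le> ennreal G2"
            unfolding G2_def by (rule riesz_finite_measure(2)[OF M(1) growth C]) (use b3 \<beta> s0 N0 in auto)
          finally show "(\<integral>\<^sup>+x. W2 (y - x) \<partial>M) \<le> ennreal G2" .
        qed simp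
      qed auto
      also have "\<dots> = ennreal K"
        using K0 G0 N by (simp add: K_def ennreal_mult ennreal_plus)
      finally show ?thesis .
    qed (simp add: K0)
  qed
qed

section \<open>From the distributional gradient to the bound along segments\<close>

lemma test_function_facts:
  assumes \<phi>: "\<phi> \<in> test_functions \<Omega>"
  defines "K \<equiv> closure {x. \<phi> x \<noteq> 0}"
  shows "compact K" "K \<subseteq> \<Omega>" "continuous_on UNIV \<phi>" "continuous_on UNIV (partial j \<phi>)"
    "\<And>x. x \<notin> K \<Longrightarrow> \<phi> x = 0" "\<And>x. x \<notin> K \<Longrightarrow> partial j \<phi> x = 0"
    "frechet_derivative \<phi> (at x) v = (\<Sum>j\<in>UNIV. v $ j * partial j \<phi> x)"
proof -
  have Ck: "\<And>k. C_k k \<phi>" and K: "compact K" "K \<subseteq> \<Omega>" using \<phi> by (auto simp: test_functions_def K_def)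
  show "compact K" "K \<subseteq> \<Omega>" by (rule K)+
  show "continuous_on UNIV \<phi>" using Ck[of 0] by simp
  show "continuous_on UNIV (partial j \<phi>)" using Ck[of "Suc 0"] by simp
  have diff: "\<phi> differentiable (at x)" for x using Ck[of "Suc 0"] by simp
  show \<phi>0: "\<phi> x = 0" if "x \<notin> K" for x using that closure_subset[of "{x. \<phi> x \<noteq> 0}"] by (auto simp: K_def)
  show "partial j \<phi> x = 0" if "x \<notin> K" for x
  proof -
    have "open (- K)" by (simp add: K_def open_Compl)
    hence "(\<phi> has_derivative (\<lambda>h. 0)) (at x)"
      using that \<phi>0 by (intro has_derivative_transform_within_open[of "\<lambda>_. 0" "\<lambda>h. 0" x UNIV "- K" \<phi>]) auto
    from frechet_derivative_at[OF this] show ?thesis unfolding partial_def by metis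
  qed
  have lin: "linear (frechet_derivative \<phi> (at x))" by (rule linear_frechet_derivative[OF diff])
  have "v = (\<Sum>j\<in>UNIV. v $ j *\<^sub>R axis j 1)"
    by (simp add: vec_eq_iff axis_def if_distrib cong: if_cong)
  hence "frechet_derivative \<phi> (at x) v = frechet_derivative \<phi> (at x) (\<Sum>j\<in>UNIV. v $ j *\<^sub>R axis j 1)" by simp
  also have "\<dots> = (\<Sum>j\<in>UNIV. v $ j * partial j \<phi> x)"
    by (simp add: linear_sum[OF lin] linear_cmul[OF lin] partial_def)
  finally show "frechet_derivative \<phi> (at x) v = (\<Sum>j\<in>UNIV. v $ j * partial j \<phi> x)" .
qed

lemma set_integrable_compact_support:
  fixes f :: "'a::euclidean_space \<Rightarrow> real"
  assumes K: "compact K" "K \<subseteq> \<Omega>" and f: "continuous_on K f" and 0: "\<And>x. x \<notin> K \<Longrightarrow> f x = 0"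
  shows "set_integrable lebesgue \<Omega> f"
proof -
  have "integrable lborel (\<lambda>x. indicator K x *\<^sub>R f x)" by (rule borel_integrable_compact[OF K(1) f])
  hence "integrable lebesgue (\<lambda>x. indicator K x *\<^sub>R f x)" by (simp add: integrable_completion borel_measurable_integrable)
  also have "(\<lambda>x. indicator K x *\<^sub>R f x) = (\<lambda>x. indicator \<Omega> x *\<^sub>R f x)"
    using K(2) 0 by (auto simp: fun_eq_iff indicator_def)
  finally show ?thesis by (simp add: set_integrable_def)
qed

text \<open>Exhaustion by compact sets: at every point the truncated functions are eventually
  constant.\<close>

lemma L1_loc_measurable:
  fixes f :: "'a::euclidean_space \<Rightarrow> 'b::euclidean_space"
  assumes \<Omega>: "open \<Omega>" and f: "f \<in> L1_loc \<Omega>"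
  shows "(\<lambda>x. indicator \<Omega> x *\<^sub>R f x) \<in> borel_measurable lebesgue"
proof -
  obtain C where C: "\<And>n. compact (C n)" "\<And>n. C n \<subseteq> \<Omega>" "\<And>n. C n \<subseteq> interior (C (Suc n))" "\<Union>(range C) = \<Omega>"
    using open_Union_compact_subsets[OF \<Omega>] by metis
  have mono: "C m \<subseteq> C n" if "m \<le> n" for m n
    using that C(3) interior_subset by (intro lift_Suc_mono_le[of C, OF _ that]) blast
  show ?thesis
  proof (rule borel_measurable_LIMSEQ_metric)
    fix n
    show "(\<lambda>x. indicator (C n) x *\<^sub>R f x) \<in> borel_measurable lebesgue"
      using f C(1,2)[of n] by (auto simp: L1_loc_def set_integrable_def dest!: borel_measurable_integrable)
  next
    fix x
    show "(\<lambda>n. indicator (C n) x *\<^sub>R f x) \<longlonglongrightarrow> indicator \<Omega> x *\<^sub>R f x"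
    proof (cases "x \<in> \<Omega>")
      case True
      then obtain m where "x \<in> C m" using C(4) by blast
      hence "\<forall>n\<ge>m. indicator (C n) x *\<^sub>R f x = indicator \<Omega> x *\<^sub>R f x" using mono True by (auto simp: indicator_def)
      thus ?thesis by (intro tendsto_eventually) (auto simp: eventually_sequentially)
    next
      case False
      hence "x \<notin> C n" for n using C(2) by blast
      thus ?thesis using False by simp
    qed
  qed
qed

text \<open>Cauchy-Schwarz for the Frobenius inner product with the matrix of entries
  \<open>v $ i * v $ j\<close>, whose norm is \<open>(norm v)\<^sup>2\<close>.\<close>

lemma quadratic_form_le:
  fixes E :: "real^'n^'n" and v :: "real^'n"
  shows "\<bar>\<Sum>i\<in>UNIV. \<Sum>j\<in>UNIV. v $ i * v $ j * E $ i $ j\<bar> \<le> (norm v)\<^sup>2 * norm E"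
proof -
  have "(\<Sum>i\<in>UNIV. \<Sum>j\<in>UNIV. v $ i * v $ j * E $ i $ j) = E \<bullet> (\<chi> i. v $ i *\<^sub>R v)"
    by (simp add: inner_vec_def sum_distrib_left mult_ac)
  hence "\<bar>\<Sum>i\<in>UNIV. \<Sum>j\<in>UNIV. v $ i * v $ j * E $ i $ j\<bar> \<le> norm E * norm (\<chi> i. v $ i *\<^sub>R v)"
    by (simp add: Cauchy_Schwarz_ineq2)
  also have "norm (\<chi> i. v $ i *\<^sub>R v) = norm v * norm v"
  proof -
    have "(\<chi> i. v $ i *\<^sub>R v) \<bullet> (\<chi> i. v $ i *\<^sub>R v) = (v \<bullet> v) * (v \<bullet> v)"
      by (simp add: inner_vec_def sum_distrib_left sum_distrib_right mult_ac)
    thus ?thesis by (simp add: norm_eq_sqrt_inner real_sqrt_mult)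
  qed
  finally show ?thesis by (simp add: power2_eq_square mult_ac)
qed

text \<open>Testing \<open>u \<bullet> v\<close> with the derivative in direction \<open>v\<close>
  is minus the sum of \<open>v $ i * v $ j\<close> times the entries of the distributional gradient.
  The weights are symmetric, so the symmetric part gives the same sum, and there the field
  \<open>E\<close> can be inserted. \<open>g\<close> is a Borel version of \<open>norm E\<close>,
  extended by \<open>0\<close>.\<close>

lemma represents_sym_grad_bound:
  fixes u :: "real^'n \<Rightarrow> real^'n"
  assumes \<Omega>: "open \<Omega>" and u: "continuous_on \<Omega> u" and rep: "represents_sym_grad \<Omega> u E"
  shows "\<exists>g. g \<in> borel_measurable borel \<and> (\<forall>w. 0 \<le> g w) \<and> sym_grad_bound \<Omega> u (\<lambda>w. ennreal (g w))
     \<and> (\<forall>p>0. (\<integral>\<^sup>+y. ennreal (g y powr p) \<partial>lborel) = (\<integral>\<^sup>+y. ennreal (norm (E y) powr p) \<partial>lebesgue_on \<Omega>))"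
proof -
  have EL: "E \<in> L1_loc \<Omega>"
    and rep: "\<And>\<phi> i j. \<phi> \<in> test_functions \<Omega> \<Longrightarrow> dist_sym_grad \<Omega> u i j \<phi> = (LINT x:\<Omega>|lebesgue. E x $ i $ j * \<phi> x)"
    using rep by (auto simp: represents_sym_grad_def)
  have Em: "(\<lambda>x. indicator \<Omega> x *\<^sub>R E x) \<in> borel_measurable lebesgue" by (rule L1_loc_measurable[OF \<Omega> EL])
  hence "(\<lambda>x. norm (indicator \<Omega> x *\<^sub>R E x)) \<in> borel_measurable lebesgue" by (rule measurable_compose[OF _ borel_measurable_norm])
  from completion_ex_borel_measurable_real[OF this] obtain g0 where g0: "g0 \<in> borel_measurable lborel"
    "AE x in lborel. norm (indicator \<Omega> x *\<^sub>R E x) = g0 x" by blast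
  \<comment> \<open>The Borel function \<open>g0\<close> is known to be nonnegative only almost
    everywhere.\<close>
  define g where "g x = \<bar>g0 x\<bar>" for x
  have gm[measurable]: "g \<in> borel_measurable borel" using g0(1) by (simp add: g_def[abs_def])
  have gE: "AE x in lebesgue. g x = indicator \<Omega> x * norm (E x)"
  proof (rule AE_completion)
    show "AE x in lborel. g x = indicator \<Omega> x * norm (E x)"
      using g0(2)
    proof eventually_elim
      case (elim x)
      show ?case unfolding g_def elim[symmetric] by simp
    qed
  qed
  have "(\<integral>\<^sup>+y. ennreal (g y powr p) \<partial>lborel) = (\<integral>\<^sup>+y. ennreal (norm (E y) powr p) \<partial>lebesgue_on \<Omega>)" if "p > 0" for p
  proof -
    have "(\<integral>\<^sup>+y. ennreal (g y powr p) \<partial>lborel) = (\<integral>\<^sup>+y. ennreal (g y powr p) \<partial>lebesgue)"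
      by (rule nn_integral_completion[symmetric])
    also have "\<dots> = (\<integral>\<^sup>+y. ennreal (norm (E y) powr p) * indicator \<Omega> y \<partial>lebesgue)"
      by (rule nn_integral_cong_AE) (use gE in \<open>auto elim!: eventually_mono simp: indicator_def\<close>)
    also have "\<dots> = (\<integral>\<^sup>+y. ennreal (norm (E y) powr p) \<partial>lebesgue_on \<Omega>)"
      by (rule nn_integral_restrict_space[symmetric]) (use \<Omega> in auto)
    finally show ?thesis .
  qed
  moreover have "sym_grad_bound \<Omega> u (\<lambda>w. ennreal (g w))"
    unfolding sym_grad_bound_def
  proof (intro ballI allI impI)
    fix \<phi> v assume \<phi>: "\<phi> \<in> test_functions \<Omega>" and \<phi>0: "\<forall>x. 0 \<le> \<phi> x"
    define K where "K = closure {x. \<phi> x \<noteq> 0}"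
    note tf = test_function_facts[OF \<phi>, folded K_def]
    have iu: "set_integrable lebesgue \<Omega> (\<lambda>w. u w $ i * partial j \<phi> w)" for i j
      by (rule set_integrable_compact_support[OF tf(1,2)])
         (auto intro!: continuous_intros continuous_on_subset[OF u tf(2)] continuous_on_subset[OF tf(4)] simp: tf(6))
    have iE: "set_integrable lebesgue \<Omega> (\<lambda>w. E w $ i $ j * \<phi> w)" for i j
    proof -
      have "set_integrable lebesgue K E" using EL tf(1,2) by (auto simp: L1_loc_def)
      hence iK: "integrable lebesgue (\<lambda>w. indicator K w *\<^sub>R E w)" by (simp add: set_integrable_def)
      have "bounded (\<phi> ` K)" by (intro compact_imp_bounded compact_continuous_image tf(1) continuous_on_subset[OF tf(3)]) auto
      then obtain B where B: "\<And>w. w \<in> K \<Longrightarrow> \<bar>\<phi> w\<bar> \<le> B" by (auto simp: bounded_iff)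
      have "integrable lebesgue (\<lambda>w. indicator K w *\<^sub>R E w $ i $ j * \<phi> w)"
      proof (rule Bochner_Integration.integrable_bound)
        show "integrable lebesgue (\<lambda>w. \<bar>B\<bar> *\<^sub>R (indicator K w *\<^sub>R E w))" by (intro integrable_scaleR_right iK)
        have 1: "(\<lambda>w. indicator K w *\<^sub>R E w) \<in> borel_measurable lebesgue" using iK by (rule borel_measurable_integrable)
        have 2: "(\<lambda>A::real^'n^'n. A $ i $ j) \<in> borel_measurable borel"
          by (intro borel_measurable_continuous_onI continuous_intros)
        have 3: "\<phi> \<in> borel_measurable lebesgue"
          using tf(3) by (intro measurable_completion) (simp add: borel_measurable_continuous_onI)
        show "(\<lambda>w. indicator K w *\<^sub>R E w $ i $ j * \<phi> w) \<in> borel_measurable lebesgue"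
          using borel_measurable_times[OF measurable_compose[OF 1 2] 3] by simp
        show "AE w in lebesgue. norm (indicator K w *\<^sub>R E w $ i $ j * \<phi> w) \<le> norm (\<bar>B\<bar> *\<^sub>R (indicator K w *\<^sub>R E w))"
        proof (intro AE_I2)
          fix w
          show "norm (indicator K w *\<^sub>R E w $ i $ j * \<phi> w) \<le> norm (\<bar>B\<bar> *\<^sub>R (indicator K w *\<^sub>R E w))"
          proof (cases "w \<in> K")
            case True
            have "\<bar>E w $ i $ j\<bar> \<le> norm (E w)" using component_le_norm_cart[of "E w $ i" j] Finite_Cartesian_Product.norm_nth_le[of "E w" i]
              by linarith
            hence "\<bar>E w $ i $ j\<bar> * \<bar>\<phi> w\<bar> \<le> norm (E w) * \<bar>B\<bar>" using B[OF True] by (intro mult_mono) auto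
            thus ?thesis using True by (simp add: abs_mult mult.commute)
          qed simp
        qed
      qed
      also have "(\<lambda>w. indicator K w *\<^sub>R E w $ i $ j * \<phi> w) = (\<lambda>w. indicator \<Omega> w *\<^sub>R (E w $ i $ j * \<phi> w))"
        using tf(2,5) by (auto simp: fun_eq_iff indicator_def)
      finally show ?thesis by (simp add: set_integrable_def)
    qed
    have "(LINT w:\<Omega>|lebesgue. (u w \<bullet> v) * frechet_derivative \<phi> (at w) v)
       = (LINT w:\<Omega>|lebesgue. \<Sum>i\<in>UNIV. \<Sum>j\<in>UNIV. v $ i * v $ j * (u w $ i * partial j \<phi> w))"
    proof -
      have "(u w \<bullet> v) * frechet_derivative \<phi> (at w) v
          = (\<Sum>i\<in>UNIV. \<Sum>j\<in>UNIV. v $ i * v $ j * (u w $ i * partial j \<phi> w))" for w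
        unfolding tf(7) inner_vec_def sum_product by (intro sum.cong refl) simp
      thus ?thesis by (simp only:)
    qed
    also have "\<dots> = (\<Sum>i\<in>UNIV. \<Sum>j\<in>UNIV. v $ i * v $ j * (LINT w:\<Omega>|lebesgue. u w $ i * partial j \<phi> w))"
      using iu by (simp add: set_lebesgue_integral_def set_integrable_def sum_distrib_left mult.left_commute[of "indicator \<Omega> _"]
          Bochner_Integration.integral_sum Bochner_Integration.integrable_sum)
    also have "\<dots> = - (\<Sum>i\<in>UNIV. \<Sum>j\<in>UNIV. v $ i * v $ j * dist_grad \<Omega> u i j \<phi>)"
      by (simp add: dist_grad_def sum_negf)
    \<comment> \<open>Exchanging the two indices leaves the weights unchanged.\<close>
    also have "(\<Sum>i\<in>UNIV. \<Sum>j\<in>UNIV. v $ i * v $ j * dist_grad \<Omega> u i j \<phi>) = (\<Sum>i\<in>UNIV. \<Sum>j\<in>UNIV. v $ i * v $ j * dist_sym_grad \<Omega> u i j \<phi>)"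
    proof -
      have "(\<Sum>i\<in>UNIV. \<Sum>j\<in>UNIV. v $ i * v $ j * dist_grad \<Omega> u i j \<phi>) = (\<Sum>i\<in>UNIV. \<Sum>j\<in>UNIV. v $ i * v $ j * dist_grad \<Omega> u j i \<phi>)"
        by (subst sum.swap) (simp add: mult_ac)
      thus ?thesis by (simp add: dist_sym_grad_def distrib_left add_divide_distrib sum.distrib sum_divide_distrib[symmetric])
    qed
    also have "\<dots> = (\<Sum>i\<in>UNIV. \<Sum>j\<in>UNIV. v $ i * v $ j * (LINT w:\<Omega>|lebesgue. E w $ i $ j * \<phi> w))"
      by (simp add: rep[OF \<phi>])
    also have "\<dots> = (LINT w:\<Omega>|lebesgue. \<Sum>i\<in>UNIV. \<Sum>j\<in>UNIV. v $ i * v $ j * (E w $ i $ j * \<phi> w))"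
      using iE by (simp add: set_lebesgue_integral_def set_integrable_def sum_distrib_left mult.left_commute[of "indicator \<Omega> _"]
          Bochner_Integration.integral_sum Bochner_Integration.integrable_sum)
    finally have eq: "\<bar>LINT w:\<Omega>|lebesgue. (u w \<bullet> v) * frechet_derivative \<phi> (at w) v\<bar>
       = \<bar>LINT w:\<Omega>|lebesgue. \<Sum>i\<in>UNIV. \<Sum>j\<in>UNIV. v $ i * v $ j * (E w $ i $ j * \<phi> w)\<bar>" by simp
    let ?q = "\<lambda>w. indicator \<Omega> w *\<^sub>R (\<Sum>i\<in>UNIV. \<Sum>j\<in>UNIV. v $ i * v $ j * (E w $ i $ j * \<phi> w))"
    have "integrable lebesgue ?q"
      using iE by (simp add: set_integrable_def sum_distrib_left mult.left_commute[of "indicator \<Omega> _"] Bochner_Integration.integrable_sum)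
    hence "ennreal \<bar>LINT w|lebesgue. ?q w\<bar> \<le> (\<integral>\<^sup>+w. ennreal (norm (?q w)) \<partial>lebesgue)"
      using integral_norm_bound_ennreal[of lebesgue ?q] by simp
    also have "\<dots> \<le> (\<integral>\<^sup>+w. ennreal ((norm v)\<^sup>2) * (ennreal (g w) * ennreal (\<phi> w)) \<partial>lebesgue)"
    proof (rule nn_integral_mono_AE)
      show "AE w in lebesgue. ennreal (norm (?q w)) \<le> ennreal ((norm v)\<^sup>2) * (ennreal (g w) * ennreal (\<phi> w))"
        using gE
      proof eventually_elim
        case (elim w)
        have "(\<Sum>i\<in>UNIV. \<Sum>j\<in>UNIV. v $ i * v $ j * (E w $ i $ j * \<phi> w)) = (\<Sum>i\<in>UNIV. \<Sum>j\<in>UNIV. v $ i * v $ j * E w $ i $ j) * \<phi> w"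
          by (simp add: sum_distrib_right mult.assoc)
        hence "norm (?q w) = indicator \<Omega> w * (\<bar>\<Sum>i\<in>UNIV. \<Sum>j\<in>UNIV. v $ i * v $ j * E w $ i $ j\<bar> * \<phi> w)"
          using \<phi>0 by (simp add: abs_mult)
        also have "\<dots> \<le> indicator \<Omega> w * (((norm v)\<^sup>2 * norm (E w)) * \<phi> w)"
          using \<phi>0 by (intro mult_left_mono mult_right_mono quadratic_form_le) auto
        also have "\<dots> = (norm v)\<^sup>2 * (g w * \<phi> w)" by (simp add: elim mult_ac)
        finally have "norm (?q w) \<le> (norm v)\<^sup>2 * (g w * \<phi> w)" .
        hence "ennreal (norm (?q w)) \<le> ennreal ((norm v)\<^sup>2 * (g w * \<phi> w))" by (rule ennreal_leI)
        also have "\<dots> = ennreal ((norm v)\<^sup>2) * (ennreal (g w) * ennreal (\<phi> w))"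
          using \<phi>0 by (simp add: ennreal_mult g_def)
        finally show ?case .
      qed
    qed
    also have "\<dots> = (\<integral>\<^sup>+w. ennreal ((norm v)\<^sup>2) * (ennreal (g w) * ennreal (\<phi> w)) \<partial>lborel)"
      by (rule nn_integral_completion)
    also have "\<dots> = ennreal ((norm v)\<^sup>2) * (\<integral>\<^sup>+w. ennreal (g w) * ennreal (\<phi> w) \<partial>lborel)"
      by (rule nn_integral_cmult) (use borel_measurable_continuous_onI[OF tf(3)] in measurable)
    finally show "ennreal \<bar>LINT w:\<Omega>|lebesgue. (u w \<bullet> v) * frechet_derivative \<phi> (at w) v\<bar>
          \<le> ennreal ((norm v)\<^sup>2) * (\<integral>\<^sup>+w. ennreal (g w) * ennreal (\<phi> w) \<partial>lborel)"
      unfolding eq by (simp only: set_lebesgue_integral_def)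
  qed
  ultimately show ?thesis using gm by (intro exI[of _ g]) (auto simp: g_def)
qed

section \<open>Compactness\<close>

lemma lborel_integral_scale:
  fixes f :: "'a::euclidean_space \<Rightarrow> 'b::{banach, second_countable_topology}"
  assumes [measurable]: "f \<in> borel_measurable borel" and c: "c > 0"
  shows "(LINT y|lborel. f y) = c ^ DIM('a) *\<^sub>R (LINT v|lborel. f (x + c *\<^sub>R v))"
  by (subst lborel_affine[of c x]) (use c in \<open>auto simp: integral_density integral_distr\<close>)

text \<open>The integrand of \<open>tent_average\<close> with the field value as a separate
  argument. After a substitution the base point occurs only in \<open>z\<close>, so regularity of
  averages comes from the kernel and not from \<open>u\<close>.\<close>

definition tent_kernel :: "'a::euclidean_space \<Rightarrow> 'a \<Rightarrow> 'a" where
  "tent_kernel z \<xi> = tent z *\<^sub>R ((\<xi> \<bullet> z) *\<^sub>R z)"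

lemma tent_lipschitz: "\<bar>tent z - tent z'\<bar> \<le> norm (z - z')"
  unfolding tent_def using norm_triangle_ineq3[of z z'] by (auto simp: max_def abs_if split: if_splits)

lemma norm_tent_kernel_le: "norm (tent_kernel z \<xi>) \<le> norm \<xi>"
proof (cases "norm z < 1")
  case True
  have "\<bar>\<xi> \<bullet> z\<bar> \<le> norm \<xi> * 1"
    using Cauchy_Schwarz_ineq2[of \<xi> z] mult_left_mono[of "norm z" 1 "norm \<xi>"] True by simp
  hence "tent z * (\<bar>\<xi> \<bullet> z\<bar> * norm z) \<le> 1 * ((norm \<xi> * 1) * 1)"
    using tent_bounds[of z] True by (intro mult_mono) auto
  thus ?thesis using tent_bounds[of z] by (simp add: tent_kernel_def abs_mult mult.assoc)
qed (simp add: tent_kernel_def tent_bounds(3))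

text \<open>On the unit ball the kernel is a product of three factors, the weight, the inner product
  and \<open>z\<close>, each contributing one unit to the constant \<open>3\<close>. If
  \<open>z'\<close> lies outside, its weight is \<open>0\<close>, and \<open>tent z\<close> itself
  is at most \<open>norm (z - z')\<close>.\<close>

lemma tent_kernel_lipschitz:
  "norm (tent_kernel z \<xi> - tent_kernel z' \<xi>) \<le> 3 * norm (z - z') * norm \<xi>"
proof -
  have main: "norm (tent_kernel z \<xi> - tent_kernel z' \<xi>) \<le> 3 * norm (z - z') * norm \<xi>"
    if z: "norm z \<le> 1" for z z' :: 'a
  proof (cases "norm z' \<le> 1")
    case True
    have 1: "\<bar>\<xi> \<bullet> y\<bar> \<le> norm \<xi>" if "norm y \<le> 1" for y
      using Cauchy_Schwarz_ineq2[of \<xi> y] mult_left_mono[OF that, of "norm \<xi>"] by simp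
    have eq: "tent_kernel z \<xi> - tent_kernel z' \<xi> = (tent z - tent z') *\<^sub>R ((\<xi> \<bullet> z) *\<^sub>R z)
        + tent z' *\<^sub>R ((\<xi> \<bullet> (z - z')) *\<^sub>R z + (\<xi> \<bullet> z') *\<^sub>R (z - z'))"
      by (simp add: tent_kernel_def algebra_simps inner_diff_right)
    have a: "norm ((tent z - tent z') *\<^sub>R ((\<xi> \<bullet> z) *\<^sub>R z)) \<le> norm (z - z') * (norm \<xi> * 1)"
      unfolding norm_scaleR by (intro mult_mono tent_lipschitz 1 z) auto
    have b: "norm ((\<xi> \<bullet> (z - z')) *\<^sub>R z) \<le> (norm \<xi> * norm (z - z')) * 1"
      unfolding norm_scaleR by (intro mult_mono Cauchy_Schwarz_ineq2 z) auto
    have c: "norm ((\<xi> \<bullet> z') *\<^sub>R (z - z')) \<le> norm \<xi> * norm (z - z')"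
      unfolding norm_scaleR by (intro mult_right_mono 1 True) auto
    have "norm (tent z' *\<^sub>R ((\<xi> \<bullet> (z - z')) *\<^sub>R z + (\<xi> \<bullet> z') *\<^sub>R (z - z')))
        \<le> 1 * (norm \<xi> * norm (z - z') + norm \<xi> * norm (z - z'))"
      unfolding norm_scaleR using tent_bounds[of z'] b c
      by (intro mult_mono norm_triangle_le) auto
    thus ?thesis unfolding eq using a by (intro norm_triangle_le) (simp add: algebra_simps)
  next
    case False
    hence 0: "tent z' = 0" by (intro tent_bounds) simp
    have "norm (tent_kernel z \<xi>) = \<bar>tent z\<bar> * (\<bar>\<xi> \<bullet> z\<bar> * norm z)" by (simp add: tent_kernel_def abs_mult)
    also have "\<dots> \<le> norm (z - z') * ((norm \<xi> * 1) * 1)"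
    proof (intro mult_mono)
      show "\<bar>tent z\<bar> \<le> norm (z - z')" using tent_lipschitz[of z z'] 0 by simp
      show "\<bar>\<xi> \<bullet> z\<bar> \<le> norm \<xi> * 1" using Cauchy_Schwarz_ineq2[of \<xi> z] mult_left_mono[OF z, of "norm \<xi>"] by simp
    qed (use z in auto)
    also have "\<dots> \<le> 3 * norm (z - z') * norm \<xi>" by (simp add: mult_right_mono)
    finally show ?thesis using 0 by (simp add: tent_kernel_def)
  qed
  show ?thesis
  proof (cases "norm z \<le> 1 \<or> norm z' \<le> 1")
    case True
    thus ?thesis using main[of z z'] main[of z' z] by (auto simp: norm_minus_commute)
  qed (simp add: tent_kernel_def tent_bounds(3))
qed

lemma continuous_on_tent_kernel:
  "continuous_on S f \<Longrightarrow> continuous_on S h \<Longrightarrow> continuous_on S (\<lambda>x. tent_kernel (f x) (h x))"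
  unfolding tent_kernel_def by (intro continuous_intros continuous_on_tent)

definition local_average :: "real \<Rightarrow> ('a::euclidean_space \<Rightarrow> 'a) \<Rightarrow> 'a \<Rightarrow> 'a" where
  "local_average e u x = tent_average (\<lambda>v. u (x + e *\<^sub>R v))"

text \<open>The substitution \<open>y = x + e *\<^sub>R v\<close>. The domain of integration is a
  fixed set \<open>K\<close>, so that averages at different points can be subtracted under one
  integral.\<close>

lemma local_average_eq:
  fixes u :: "'a::euclidean_space \<Rightarrow> 'a"
  assumes K: "compact K" "continuous_on K u" and e: "e > 0" and x: "cball x e \<subseteq> K"
  shows "local_average e u x = (1 / e ^ DIM('a)) *\<^sub>R (LINT y|lborel. indicator K y *\<^sub>R tent_kernel ((1 / e) *\<^sub>R (y - x)) (u y))"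
    and "integrable lborel (\<lambda>y. indicator K y *\<^sub>R tent_kernel ((1 / e) *\<^sub>R (y - x)) (u y))"
proof -
  let ?f = "\<lambda>y. indicator K y *\<^sub>R tent_kernel ((1 / e) *\<^sub>R (y - x)) (u y)"
  show int: "integrable lborel ?f"
    by (intro borel_integrable_compact K continuous_on_tent_kernel continuous_intros)
  have "(LINT y|lborel. ?f y) = e ^ DIM('a) *\<^sub>R (LINT v|lborel. ?f (x + e *\<^sub>R v))"
    by (rule lborel_integral_scale) (use int e in \<open>auto dest: borel_measurable_integrable\<close>)
  also have "(LINT v|lborel. ?f (x + e *\<^sub>R v)) = local_average e u x"
    unfolding local_average_def tent_average_def
  proof (intro Bochner_Integration.integral_cong refl)
    fix v
    show "?f (x + e *\<^sub>R v) = tent v *\<^sub>R ((u (x + e *\<^sub>R v) \<bullet> v) *\<^sub>R v)"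
    proof (cases "norm v \<le> 1")
      case True
      hence "x + e *\<^sub>R v \<in> cball x e" using e by (simp add: dist_norm mult_left_le)
      thus ?thesis using x e by (auto simp: tent_kernel_def)
    qed (use e in \<open>simp add: tent_kernel_def tent_bounds(3)\<close>)
  qed
  finally show "local_average e u x = (1 / e ^ DIM('a)) *\<^sub>R (LINT y|lborel. ?f y)" using e by simp
qed

text \<open>Only the integral of \<open>norm u\<close> over \<open>K\<close> enters, so a bound
  uniform in the sequence makes the averages uniformly bounded and equicontinuous for fixed
  \<open>e\<close>.\<close>

lemma local_average_bounds:
  fixes u :: "'a::euclidean_space \<Rightarrow> 'a"
  assumes K: "compact K" "continuous_on K u" and e: "e > 0" and x: "cball x e \<subseteq> K" "cball y e \<subseteq> K"
    and L: "(\<integral>\<^sup>+z. indicator K z * ennreal (norm (u z)) \<partial>lborel) \<le> ennreal L" "0 \<le> L"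
  shows "norm (local_average e u x) \<le> L / e ^ DIM('a)"
    and "norm (local_average e u x - local_average e u y) \<le> 3 * L / e ^ (DIM('a) + 1) * norm (x - y)"
proof -
  let ?f = "\<lambda>x y. indicator K y *\<^sub>R tent_kernel ((1 / e) *\<^sub>R (y - x)) (u y)"
  have bound: "norm (LINT z|lborel. h z) \<le> c * L"
    if h: "integrable lborel h" "\<And>z. norm (h z) \<le> c * (indicator K z * norm (u z))" "c \<ge> 0" for h :: "'a \<Rightarrow> 'a" and c
  proof -
    have [measurable]: "(\<lambda>z. indicator K z *\<^sub>R u z) \<in> borel_measurable borel"
      using borel_measurable_integrable[OF borel_integrable_compact[OF K]] by simp
    have "(\<lambda>z. ennreal (norm (indicator K z *\<^sub>R u z))) \<in> borel_measurable borel" by measurable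
    hence m: "(\<lambda>z. indicator K z * ennreal (norm (u z))) \<in> borel_measurable lborel"
      by (simp add: ennreal_mult ennreal_indicator)
    have "ennreal (norm (LINT z|lborel. h z)) \<le> (\<integral>\<^sup>+z. ennreal (norm (h z)) \<partial>lborel)"
      by (rule integral_norm_bound_ennreal[OF h(1)])
    also have "\<dots> \<le> (\<integral>\<^sup>+z. ennreal c * (indicator K z * ennreal (norm (u z))) \<partial>lborel)"
    proof (rule nn_integral_mono)
      fix z
      have "ennreal (norm (h z)) \<le> ennreal (c * (indicator K z * norm (u z)))" by (rule ennreal_leI[OF h(2)])
      also have "\<dots> = ennreal c * (indicator K z * ennreal (norm (u z)))" using h(3) by (simp add: ennreal_mult ennreal_indicator)
      finally show "ennreal (norm (h z)) \<le> ennreal c * (indicator K z * ennreal (norm (u z)))" .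
    qed
    also have "\<dots> = ennreal c * (\<integral>\<^sup>+z. indicator K z * ennreal (norm (u z)) \<partial>lborel)"
      by (rule nn_integral_cmult[OF m])
    also have "\<dots> \<le> ennreal c * ennreal L" by (intro mult_left_mono L) simp
    also have "\<dots> = ennreal (c * L)" using h(3) L by (simp add: ennreal_mult)
    finally show ?thesis using h(3) L by simp
  qed
  note i = local_average_eq(2)[OF K e]
  have "norm (LINT z|lborel. ?f x z) \<le> 1 * L"
    by (rule bound[OF i[OF x(1)]]) (auto simp: indicator_def norm_tent_kernel_le)
  thus "norm (local_average e u x) \<le> L / e ^ DIM('a)"
    unfolding local_average_eq(1)[OF K e x(1)] using e by (simp add: divide_right_mono)
  have "norm (LINT z|lborel. ?f x z - ?f y z) \<le> (3 * norm (x - y) / e) * L"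
  proof (rule bound)
    show "integrable lborel (\<lambda>z. ?f x z - ?f y z)" by (intro Bochner_Integration.integrable_diff i x)
    fix z
    have "norm ((1 / e) *\<^sub>R (z - x) - (1 / e) *\<^sub>R (z - y)) = norm (x - y) / e"
      using e by (simp add: scaleR_right_diff_distrib[symmetric] norm_minus_commute)
    hence "norm (tent_kernel ((1 / e) *\<^sub>R (z - x)) (u z) - tent_kernel ((1 / e) *\<^sub>R (z - y)) (u z)) \<le> 3 * (norm (x - y) / e) * norm (u z)"
      using tent_kernel_lipschitz[of "(1 / e) *\<^sub>R (z - x)" "u z" "(1 / e) *\<^sub>R (z - y)"] by simp
    thus "norm (?f x z - ?f y z) \<le> (3 * norm (x - y) / e) * (indicator K z * norm (u z))"
      by (auto simp: indicator_def)
  qed (use e in auto)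
  note bnd = this
  have "local_average e u x - local_average e u y = (1 / e ^ DIM('a)) *\<^sub>R (LINT z|lborel. ?f x z) - (1 / e ^ DIM('a)) *\<^sub>R (LINT z|lborel. ?f y z)"
    by (simp only: local_average_eq(1)[OF K e x(1)] local_average_eq(1)[OF K e x(2)])
  also have "\<dots> = (1 / e ^ DIM('a)) *\<^sub>R ((LINT z|lborel. ?f x z) - (LINT z|lborel. ?f y z))"
    by (rule scaleR_right_diff_distrib[symmetric])
  also have "(LINT z|lborel. ?f x z) - (LINT z|lborel. ?f y z) = (LINT z|lborel. ?f x z - ?f y z)"
    by (rule Bochner_Integration.integral_diff[OF i[OF x(1)] i[OF x(2)], symmetric])
  finally have eq: "local_average e u x - local_average e u y = (1 / e ^ DIM('a)) *\<^sub>R (LINT z|lborel. ?f x z - ?f y z)" .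
  have "norm (local_average e u x - local_average e u y) = (1 / e ^ DIM('a)) * norm (LINT z|lborel. ?f x z - ?f y z)"
    unfolding eq norm_scaleR using e by simp
  also have "\<dots> \<le> (1 / e ^ DIM('a)) * ((3 * norm (x - y) / e) * L)"
    by (rule mult_left_mono[OF bnd]) (use e in simp)
  also have "\<dots> = 3 * L / e ^ (DIM('a) + 1) * norm (x - y)" by (simp add: mult_ac)
  finally show "norm (local_average e u x - local_average e u y) \<le> 3 * L / e ^ (DIM('a) + 1) * norm (x - y)" .
qed

lemma tent_average_deviation:
  fixes u :: "real^'n \<Rightarrow> real^'n"
  assumes sgb: "sym_grad_bound \<Omega> u g" and u: "continuous_on \<Omega> u" and \<Omega>: "open \<Omega>"
    and g: "g \<in> borel_measurable borel" and e: "e > 0" and ball: "cball x e \<subseteq> \<Omega>"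
  shows "ennreal (norm (tent_average (\<lambda>_. u x) - local_average e u x))
    \<le> ennreal (kernel_const TYPE(real^'n)) * (\<integral>\<^sup>+w. indicator (ball x (2 * e)) w * (g w * newton (w - x)) \<partial>lborel)"
proof -
  have c: "continuous_on (cball 0 1) (\<lambda>v. u (x + e *\<^sub>R v))"
  proof (rule continuous_on_compose2[OF u])
    show "(\<lambda>v. x + e *\<^sub>R v) ` cball 0 1 \<subseteq> \<Omega>"
      using ball e by (force simp: dist_norm subset_eq mult_left_le)
  qed (intro continuous_intros)
  have eq: "tent_average (\<lambda>_. u x) - local_average e u x = tent_average (\<lambda>v. u x - u (x + e *\<^sub>R v))"
    unfolding local_average_def by (rule tent_average_diff[symmetric]) (auto intro: c)
  have "ennreal (norm (tent_average (\<lambda>_. u x) - local_average e u x))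
      \<le> (\<integral>\<^sup>+v. indicator (ball 0 1) v * ennreal \<bar>(u x - u (x + e *\<^sub>R v)) \<bullet> v\<bar> \<partial>lborel)"
    unfolding eq by (intro norm_tent_average_le continuous_intros c)
  also have "\<dots> = (\<integral>\<^sup>+v. indicator (ball 0 1) v * ennreal \<bar>u (x + e *\<^sub>R v) \<bullet> v - u x \<bullet> v\<bar> \<partial>lborel)"
    by (simp add: inner_diff_left abs_minus_commute)
  also note local_oscillation_bound[OF sgb u \<Omega> g e ball]
  finally show ?thesis .
qed

text \<open>\<open>P n s\<close> says that all pairs along \<open>s\<close> are closer than
  \<open>1 / (n + 1)\<close>. This passes to subsequences, so the diagonal sequence satisfies it
  from index \<open>Suc n\<close> on.\<close>

lemma diagonal_Cauchy:
  fixes d :: "nat \<Rightarrow> nat \<Rightarrow> ennreal"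
  assumes "\<And>\<eta> s. \<eta> > 0 \<Longrightarrow> strict_mono (s :: nat \<Rightarrow> nat) \<Longrightarrow>
      \<exists>r :: nat \<Rightarrow> nat. strict_mono r \<and> (\<forall>j k. d (s (r j)) (s (r k)) < ennreal \<eta>)"
  shows "\<exists>r. strict_mono r \<and> (\<forall>\<eta>>0. \<exists>N::nat. \<forall>j\<ge>N. \<forall>k\<ge>N. d (r j) (r k) < ennreal \<eta>)"
proof -
  define P where "P n s \<longleftrightarrow> (\<forall>j k. d (s j) (s k) < ennreal (inverse (real (Suc n))))" for n and s :: "nat \<Rightarrow> nat"
  interpret subseqs P
  proof
    fix n and s :: "nat \<Rightarrow> nat" assume s: "strict_mono s"
    have "0 < inverse (real (Suc n))" by simp
    from assms[OF this s] show "\<exists>r'. strict_mono r' \<and> P n (s \<circ> r')" unfolding P_def o_def by blast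
  qed
  have hold: "P k (diagseq \<circ> ((+) (Suc k)))" for k
    by (rule diagseq_holds) (auto simp: P_def)
  show ?thesis
  proof (intro exI[of _ diagseq] conjI subseq_diagseq allI impI)
    fix \<eta> :: real assume "\<eta> > 0"
    then obtain n where n: "inverse (real (Suc n)) < \<eta>" using reals_Archimedean by blast
    show "\<exists>N. \<forall>j\<ge>N. \<forall>k\<ge>N. d (diagseq j) (diagseq k) < ennreal \<eta>"
    proof (intro exI[of _ "Suc n"] allI impI)
      fix j k assume "Suc n \<le> j" "Suc n \<le> k"
      moreover have "d (diagseq (Suc n + a)) (diagseq (Suc n + b)) < ennreal (inverse (real (Suc n)))" for a b
        using hold[of n] unfolding P_def o_def by blast
      note this[of "j - Suc n" "k - Suc n"]
      ultimately have "d (diagseq j) (diagseq k) < ennreal (inverse (real (Suc n)))"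
        by (simp only: le_add_diff_inverse)
      also have "\<dots> \<le> ennreal \<eta>" using n by (intro ennreal_leI) simp
      finally show "d (diagseq j) (diagseq k) < ennreal \<eta>" .
    qed
  qed
qed

text \<open>Fubini's theorem leaves the integral of the kernel over a ball of radius
  \<open>2 * e\<close> in the measure \<open>M\<close>. The exponent \<open>n - 1\<close> is below
  \<alpha>, so \<open>riesz_near\<close> applies and yields a positive power of
  \<open>e\<close>.\<close>

lemma local_potential_integral:
  fixes g :: "'a::euclidean_space \<Rightarrow> real"
  assumes M: "sets M = sets borel" "emeasure M UNIV < \<infinity>" and C: "C \<ge> 0"
    and growth: "\<And>y r. r > 0 \<Longrightarrow> emeasure M (ball y r) \<le> ennreal (C * r powr \<alpha>)"
    and \<alpha>: "real DIM('a) - 1 < \<alpha>" and e: "e > 0"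
    and K: "K \<in> sets borel" "K' \<in> sets borel" "\<And>x. x \<in> K \<Longrightarrow> ball x (2 * e) \<subseteq> K'"
    and g[measurable]: "g \<in> borel_measurable borel" "\<And>y. 0 \<le> g y"
    and L: "(\<integral>\<^sup>+w. indicator K' w * ennreal (g w) \<partial>lborel) \<le> ennreal L"
  shows "(\<integral>\<^sup>+x. indicator K x * (\<integral>\<^sup>+w. indicator (ball x (2 * e)) w * (ennreal (g w) * newton (w - x)) \<partial>lborel) \<partial>M)
    \<le> ennreal (C * 2 powr (real DIM('a) - 1) * (2 * e) powr (\<alpha> - (real DIM('a) - 1)) / (1 - 2 powr (real DIM('a) - 1 - \<alpha>))) * ennreal L"
proof -
  let ?B = "C * 2 powr (real DIM('a) - 1) * (2 * e) powr (\<alpha> - (real DIM('a) - 1)) / (1 - 2 powr (real DIM('a) - 1 - \<alpha>))"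
  note [measurable_cong] = M(1)
  note [measurable] = K(1,2)
  have sp: "space M = UNIV" using sets_eq_imp_space_eq[OF M(1)] by simp
  interpret M: finite_measure M using M(2) by (intro finite_measureI) (auto simp: sp)
  interpret pair_sigma_finite M "lborel :: 'a measure" ..
  have "(\<integral>\<^sup>+x. indicator K x * (\<integral>\<^sup>+w. indicator (ball x (2 * e)) w * (ennreal (g w) * newton (w - x)) \<partial>lborel) \<partial>M)
     = (\<integral>\<^sup>+x. (\<integral>\<^sup>+w. indicator K x * (indicator {z. norm z < 2 * e} (w - x) * (ennreal (g w) * newton (w - x))) \<partial>lborel) \<partial>M)"
  proof (rule nn_integral_cong)
    fix x
    have "(\<integral>\<^sup>+w. indicator K x * (indicator {z. norm z < 2 * e} (w - x) * (ennreal (g w) * newton (w - x))) \<partial>lborel)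
        = indicator K x * (\<integral>\<^sup>+w. indicator {z. norm z < 2 * e} (w - x) * (ennreal (g w) * newton (w - x)) \<partial>lborel)"
      by (rule nn_integral_cmult) measurable
    moreover have "indicator {z. norm z < 2 * e} (w - x) = (indicator (ball x (2 * e)) w :: ennreal)" for w
      by (auto simp: indicator_def dist_norm norm_minus_commute)
    ultimately show "indicator K x * (\<integral>\<^sup>+w. indicator (ball x (2 * e)) w * (ennreal (g w) * newton (w - x)) \<partial>lborel)
      = (\<integral>\<^sup>+w. indicator K x * (indicator {z. norm z < 2 * e} (w - x) * (ennreal (g w) * newton (w - x))) \<partial>lborel)"
      by (simp only:)
  qed
  also have "\<dots> = (\<integral>\<^sup>+w. (\<integral>\<^sup>+x. indicator K x * (indicator {z. norm z < 2 * e} (w - x) * (ennreal (g w) * newton (w - x))) \<partial>M) \<partial>lborel)"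
    by (rule Fubini'[symmetric]) measurable
  also have "\<dots> \<le> (\<integral>\<^sup>+w. ennreal ?B * (indicator K' w * ennreal (g w)) \<partial>lborel)"
  proof (rule nn_integral_mono)
    fix w
    have "(\<integral>\<^sup>+x. indicator K x * (indicator {z. norm z < 2 * e} (w - x) * (ennreal (g w) * newton (w - x))) \<partial>M)
       \<le> (\<integral>\<^sup>+x. (indicator K' w * ennreal (g w)) * (indicator (ball w (2 * e)) x * newton (x - w)) \<partial>M)"
      using K(3) by (intro nn_integral_mono)
        (auto simp: indicator_def dist_norm norm_minus_commute riesz_minus_commute[of _ w] subset_eq mult_ac)
    also have "\<dots> = (indicator K' w * ennreal (g w)) * (\<integral>\<^sup>+x. indicator (ball w (2 * e)) x * newton (x - w) \<partial>M)"
      by (rule nn_integral_cmult) measurable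
    also have "\<dots> \<le> (indicator K' w * ennreal (g w)) * ennreal ?B"
      using \<alpha> e C DIM_positive[where 'a='a]
      by (intro mult_left_mono riesz_near[OF M(1) growth C]) (auto simp: Suc_le_eq)
    finally show "(\<integral>\<^sup>+x. indicator K x * (indicator {z. norm z < 2 * e} (w - x) * (ennreal (g w) * newton (w - x))) \<partial>M)
        \<le> ennreal ?B * (indicator K' w * ennreal (g w))" by (simp add: mult.commute)
  qed
  also have "\<dots> = ennreal ?B * (\<integral>\<^sup>+w. indicator K' w * ennreal (g w) \<partial>lborel)"
    by (rule nn_integral_cmult) measurable
  also have "\<dots> \<le> ennreal ?B * ennreal L" by (intro mult_left_mono L) simp
  finally show ?thesis .
qed

lemma norm_diff_le_averages:
  fixes u v :: "'a::euclidean_space \<Rightarrow> 'a"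
  shows "coercive_const TYPE('a) * norm (u x - v x)
    \<le> norm (tent_average (\<lambda>_. u x) - local_average e u x) + norm (tent_average (\<lambda>_. v x) - local_average e v x)
      + norm (local_average e u x - local_average e v x)"
proof -
  let ?A = "\<lambda>\<xi>::'a. tent_average (\<lambda>_. \<xi>)"
  have "coercive_const TYPE('a) * norm (u x - v x) \<le> norm (?A (u x - v x))" by (rule coercive_const(2))
  also have "?A (u x - v x) = ?A (u x) - ?A (v x)" by (rule linear_diff[OF linear_tent_average])
  also have "\<dots> = (?A (u x) - local_average e u x) - (?A (v x) - local_average e v x) + (local_average e u x - local_average e v x)" by simp
  also have "norm \<dots> \<le> norm (?A (u x) - local_average e u x) + norm (?A (v x) - local_average e v x)
      + norm (local_average e u x - local_average e v x)"
    by (intro norm_triangle_le add_right_mono norm_triangle_ineq4)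
  finally show ?thesis .
qed

lemma local_average_subsequence:
  fixes u :: "nat \<Rightarrow> 'a::euclidean_space \<Rightarrow> 'a"
  assumes K: "compact K" and K': "compact K'" "\<And>m. continuous_on K' (u m)" and e: "e > 0" and sub: "\<And>x. x \<in> K \<Longrightarrow> cball x e \<subseteq> K'"
    and L: "\<And>m. (\<integral>\<^sup>+z. indicator K' z * ennreal (norm (u m z)) \<partial>lborel) \<le> ennreal L" "0 \<le> L" and d: "d > 0"
  shows "\<exists>r :: nat \<Rightarrow> nat. strict_mono r \<and>
    (\<forall>j k. \<forall>x\<in>K. norm (local_average e (u (r j)) x - local_average e (u (r k)) x) \<le> d)"
proof -
  note b = local_average_bounds[OF K' e sub sub L]
  have "\<exists>\<delta>>0. \<forall>n y. y \<in> K \<and> norm (x - y) < \<delta> \<longrightarrow> norm (local_average e (u n) x - local_average e (u n) y) < \<epsilon>"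
    if x: "x \<in> K" and \<epsilon>: "\<epsilon> > 0" for x \<epsilon>
  proof -
    \<comment> \<open>The added \<open>1\<close> keeps \<open>H\<close> positive when
      \<open>L = 0\<close>.\<close>
    define H where "H = 3 * L / e ^ (DIM('a) + 1) + 1"
    have H: "H > 0" using e L by (simp add: H_def add_nonneg_pos)
    show ?thesis
    proof (intro exI[of _ "\<epsilon> / H"] conjI allI impI)
      show "\<epsilon> / H > 0" using H \<epsilon> by simp
      fix n y assume y: "y \<in> K \<and> norm (x - y) < \<epsilon> / H"
      have "norm (local_average e (u n) x - local_average e (u n) y) \<le> 3 * L / e ^ (DIM('a) + 1) * norm (x - y)"
        using b(2)[OF x, of y n] y by simp
      also have "\<dots> \<le> H * norm (x - y)" by (intro mult_right_mono) (auto simp: H_def)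
      also have "\<dots> < H * (\<epsilon> / H)" using y H by (intro mult_strict_left_mono) auto
      finally show "norm (local_average e (u n) x - local_average e (u n) y) < \<epsilon>" using H by simp
    qed
  qed
  moreover have "norm (local_average e (u n) x) \<le> L / e ^ DIM('a)" if "x \<in> K" for n x
    using b(1)[OF that that] .
  ultimately obtain g r where r: "strict_mono (r :: nat \<Rightarrow> nat)"
    "\<And>\<epsilon>. 0 < \<epsilon> \<Longrightarrow> \<exists>N. \<forall>n x. n \<ge> N \<and> x \<in> K \<longrightarrow> norm (local_average e (u (r n)) x - g x) < \<epsilon>"
    using Arzela_Ascoli[OF K, of "\<lambda>n. local_average e (u n)"] by metis
  obtain N where N: "\<And>n x. n \<ge> N \<Longrightarrow> x \<in> K \<Longrightarrow> norm (local_average e (u (r n)) x - g x) < d / 2"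
    using r(2)[of "d / 2"] d by auto
  show ?thesis
  \<comment> \<open>Dropping the first \<open>N\<close> terms makes the estimate hold for all pairs
    of indices.\<close>
  proof (intro exI[of _ "\<lambda>j. r (j + N)"] conjI allI ballI)
    show "strict_mono (\<lambda>j. r (j + N))" using r(1) by (simp add: strict_mono_def)
    fix j k x assume x: "x \<in> K"
    have "norm (local_average e (u (r (j + N))) x - local_average e (u (r (k + N))) x)
       \<le> norm (local_average e (u (r (j + N))) x - g x) + norm (local_average e (u (r (k + N))) x - g x)"
      using norm_triangle_ineq4[of "local_average e (u (r (j + N))) x - g x" "local_average e (u (r (k + N))) x - g x"] by simp
    also have "\<dots> \<le> d / 2 + d / 2" using N[OF _ x] by (intro add_mono less_imp_le) auto
    finally show "norm (local_average e (u (r (j + N))) x - local_average e (u (r (k + N))) x) \<le> d" by simp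
  qed
qed

text \<open>The scale \<open>e\<close> is fixed before any subsequence is taken: it makes the
  deviation from the local averages small for all members at once. Only then does compactness of the
  averages at this scale give the subsequence. Both depend on \<eta>; the diagonal argument comes
  later.\<close>

lemma L1_subsequence_compact:
  fixes u :: "nat \<Rightarrow> real^'n \<Rightarrow> real^'n"
  assumes M: "sets M = sets borel" "emeasure M UNIV < \<infinity>" and C: "C \<ge> 0"
    and growth: "\<And>y r. r > 0 \<Longrightarrow> emeasure M (ball y r) \<le> ennreal (C * r powr \<alpha>)"
    and \<alpha>: "real CARD('n) - 1 < \<alpha>" and \<Omega>: "open \<Omega>" and K: "compact K" "K \<subseteq> \<Omega>"
    and u: "\<And>m. continuous_on \<Omega> (u m)" and sgb: "\<And>m. sym_grad_bound \<Omega> (u m) (\<lambda>w. ennreal (g m w))"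
    and g[measurable]: "\<And>m. g m \<in> borel_measurable borel" and g0: "\<And>m w. 0 \<le> g m w"
    and loc: "\<And>K'. compact K' \<Longrightarrow> K' \<subseteq> \<Omega> \<Longrightarrow> \<exists>L\<ge>0. \<forall>m. (\<integral>\<^sup>+w. indicator K' w * ennreal (g m w) \<partial>lborel) \<le> ennreal L
        \<and> (\<integral>\<^sup>+w. indicator K' w * ennreal (norm (u m w)) \<partial>lborel) \<le> ennreal L"
    and \<eta>: "\<eta> > 0"
  shows "\<exists>r :: nat \<Rightarrow> nat. strict_mono r \<and>
    (\<forall>j k. (\<integral>\<^sup>+x. indicator K x * ennreal (norm (u (r j) x - u (r k) x)) \<partial>M) \<le> ennreal \<eta>)"
proof -
  note [measurable_cong] = M(1)
  have sp: "space M = UNIV" using sets_eq_imp_space_eq[OF M(1)] by simp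
  have Kb[measurable]: "K \<in> sets borel" using K(1) by (simp add: compact_imp_closed)
  obtain e0 where e0: "e0 > 0" "(\<Union>x\<in>K. cball x e0) \<subseteq> \<Omega>"
    using compact_subset_open_imp_cball_epsilon_subset[OF K(1) \<Omega> K(2)] by blast
  \<comment> \<open>Since \<open>e < e0 / 2\<close> below, the balls of radius \<open>2 * e\<close>
    around points of \<open>K\<close> remain in \<open>K'\<close>.\<close>
  define K' where "K' = (\<Union>x\<in>K. cball x e0)"
  have K'_eq: "K' = (\<lambda>(x, z). x + z) ` (K \<times> cball 0 e0)"
    unfolding K'_def by (force simp: dist_norm image_iff norm_minus_commute Bex_def)
  have cK': "compact K'"
    unfolding K'_eq split_beta by (intro compact_continuous_image continuous_intros compact_Times K(1) compact_cball)
  have K'b: "K' \<in> sets borel" using cK' by (simp add: compact_imp_closed)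
  have K'O: "K' \<subseteq> \<Omega>" using e0(2) by (simp add: K'_def)
  obtain L where L: "L \<ge> 0" "\<And>m. (\<integral>\<^sup>+w. indicator K' w * ennreal (g m w) \<partial>lborel) \<le> ennreal L"
    "\<And>m. (\<integral>\<^sup>+w. indicator K' w * ennreal (norm (u m w)) \<partial>lborel) \<le> ennreal L"
    using loc[OF cK' K'O] by blast
  obtain N where N: "emeasure M UNIV = ennreal N" "N \<ge> 0" using M(2) by (cases "emeasure M UNIV") auto
  define c where "c = coercive_const TYPE(real^'n)"
  define k where "k = kernel_const TYPE(real^'n)"
  let ?n = "real CARD('n)"
  have c: "c > 0" by (simp add: c_def coercive_const)
  have k: "k \<ge> 0" by (simp add: k_def kernel_const_nonneg)
  define B where "B e = C * 2 powr (?n - 1) * (2 * e) powr (\<alpha> - (?n - 1)) / (1 - 2 powr (?n - 1 - \<alpha>))" for e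
  have B0: "B e \<ge> 0" for e
  proof -
    have "2 powr (?n - 1 - \<alpha>) < 1" using \<alpha> by (simp add: powr_less_one)
    thus ?thesis unfolding B_def using C by (intro divide_nonneg_nonneg mult_nonneg_nonneg) auto
  qed
  \<comment> \<open>The exponent of \<open>2 * e\<close> in \<open>B\<close> is \<alpha> - (n - 1),
    which is positive.\<close>
  have "(B \<longlongrightarrow> C * 2 powr (?n - 1) * 0 / (1 - 2 powr (?n - 1 - \<alpha>))) (at_right 0)"
  proof -
    have "((\<lambda>e. 2 * e) \<longlongrightarrow> 2 * 0) (at_right (0::real))" by (intro tendsto_intros)
    hence "((\<lambda>e. (2 * e) powr (\<alpha> - (?n - 1))) \<longlongrightarrow> 0) (at_right 0)"
      using \<alpha> by (intro tendsto_zero_powrI[where b = "\<alpha> - (?n - 1)"]) (auto intro!: tendsto_const eventually_at_right_less[THEN eventually_mono])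
    moreover have "1 - 2 powr (?n - 1 - \<alpha>) \<noteq> 0" using \<alpha> powr_less_one[of 2 "?n - 1 - \<alpha>"] by auto
    ultimately show ?thesis unfolding B_def by (intro tendsto_intros)
  qed
  hence "((\<lambda>e. 2 * k * L * B e) \<longlongrightarrow> 2 * k * L * 0) (at_right 0)" by (intro tendsto_intros) simp
  hence "\<forall>\<^sub>F e in at_right 0. 2 * k * L * B e < c * \<eta> / 2"
    using c \<eta> by (intro order_tendstoD) auto
  moreover have "\<forall>\<^sub>F e in at_right (0::real). e < e0 / 2 \<and> 0 < e"
    using eventually_at_right_real[of 0 "e0 / 2"] e0(1) by (auto elim: eventually_mono)
  ultimately have "\<forall>\<^sub>F e in at_right 0. 2 * k * L * B e < c * \<eta> / 2 \<and> e < e0 / 2 \<and> 0 < e"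
    by eventually_elim auto
  then obtain e where e: "2 * k * L * B e < c * \<eta> / 2" "e < e0 / 2" "0 < e"
    using eventually_happens[of _ "at_right (0::real)"] trivial_limit_at_right_real by blast
  \<comment> \<open>Half of the budget \<open>c * \<eta>\<close>, spread over the total mass;
    \<open>N + 1\<close> avoids a division by \<open>0\<close>. The other half is reserved for the
    deviations of the two functions compared.\<close>
  define d where "d = c * \<eta> / (2 * (N + 1))"
  have d: "d > 0" using c \<eta> N by (simp add: d_def)
  have sub: "cball x e \<subseteq> K'" "ball x (2 * e) \<subseteq> K'" if "x \<in> K" for x
    using that e by (auto simp: K'_def intro!: bexI[of _ x])
  have uK': "continuous_on K' (u m)" for m by (rule continuous_on_subset[OF u K'O])
  have "\<exists>r :: nat \<Rightarrow> nat. strict_mono r \<and>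
      (\<forall>j k. \<forall>x\<in>K. norm (local_average e (u (r j)) x - local_average e (u (r k)) x) \<le> d)"
    by (rule local_average_subsequence[OF K(1) cK' uK' e(3) sub(1) L(3) L(1) d])
  then obtain r where r: "strict_mono (r :: nat \<Rightarrow> nat)"
    "\<And>j k x. x \<in> K \<Longrightarrow> norm (local_average e (u (r j)) x - local_average e (u (r k)) x) \<le> d"
    by blast
  define V where "V m x = (\<integral>\<^sup>+w. indicator (ball x (2 * e)) w * (ennreal (g m w) * newton (w - x)) \<partial>lborel)" for m and x :: "real^'n"
  \<comment> \<open>The ball is rewritten as a condition on \<open>w - x\<close>, which makes the
    integrand visibly measurable in the pair.\<close>
  have Vm[measurable]: "V m \<in> borel_measurable borel" for m
  proof -
    have "V m = (\<lambda>x. \<integral>\<^sup>+w. indicator {z. norm z < 2 * e} (w - x) * (ennreal (g m w) * newton (w - x)) \<partial>lborel)"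
      unfolding V_def by (intro ext nn_integral_cong) (auto simp: indicator_def dist_norm norm_minus_commute)
    thus ?thesis by simp
  qed
  have Vint: "(\<integral>\<^sup>+x. indicator K x * V m x \<partial>M) \<le> ennreal (B e) * ennreal L" for m
    unfolding V_def B_def
    using local_potential_integral[OF M C growth _ e(3) Kb K'b sub(2) g g0 L(2), of m] \<alpha> by simp
  have dev: "ennreal (norm (tent_average (\<lambda>_. u m x) - local_average e (u m) x)) \<le> ennreal k * V m x" if "x \<in> K" for m x
    unfolding k_def V_def
    by (rule tent_average_deviation[OF sgb u \<Omega> _ e(3)]) (use sub(1)[OF that] K'O in auto)
  show ?thesis
  proof (intro exI[of _ r] conjI r(1) allI)
    fix i j
    have pt: "ennreal c * (indicator K x * ennreal (norm (u (r i) x - u (r j) x)))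
       \<le> ennreal k * (indicator K x * V (r i) x) + ennreal k * (indicator K x * V (r j) x) + ennreal d" for x
    proof (cases "x \<in> K")
      case True
      have "ennreal (c * norm (u (r i) x - u (r j) x)) \<le> ennreal (norm (tent_average (\<lambda>_. u (r i) x) - local_average e (u (r i)) x)
          + norm (tent_average (\<lambda>_. u (r j) x) - local_average e (u (r j)) x) + norm (local_average e (u (r i)) x - local_average e (u (r j)) x))"
        unfolding c_def by (intro ennreal_leI norm_diff_le_averages)
      also have "\<dots> = ennreal (norm (tent_average (\<lambda>_. u (r i) x) - local_average e (u (r i)) x))
          + ennreal (norm (tent_average (\<lambda>_. u (r j) x) - local_average e (u (r j)) x)) + ennreal (norm (local_average e (u (r i)) x - local_average e (u (r j)) x))"
        by (simp add: ennreal_plus)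
      also have "\<dots> \<le> ennreal k * V (r i) x + ennreal k * V (r j) x + ennreal d"
        by (intro add_mono dev True ennreal_leI r(2))
      finally show ?thesis using True c by (simp add: ennreal_mult)
    qed simp
    have "(\<integral>\<^sup>+x. ennreal c * (indicator K x * ennreal (norm (u (r i) x - u (r j) x))) \<partial>M)
      \<le> (\<integral>\<^sup>+x. ennreal k * (indicator K x * V (r i) x) + ennreal k * (indicator K x * V (r j) x) + ennreal d \<partial>M)"
      by (intro nn_integral_mono pt)
    also have "\<dots> = ennreal k * (\<integral>\<^sup>+x. indicator K x * V (r i) x \<partial>M) + ennreal k * (\<integral>\<^sup>+x. indicator K x * V (r j) x \<partial>M) + ennreal d * ennreal N"
      by (simp add: nn_integral_add nn_integral_cmult sp N)
    also have "\<dots> \<le> ennreal k * (ennreal (B e) * ennreal L) + ennreal k * (ennreal (B e) * ennreal L) + ennreal d * ennreal N"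
      by (intro add_mono mult_left_mono Vint) auto
    also have "\<dots> = ennreal (2 * k * L * B e + d * N)"
    proof -
      have "2 * k * L * B e + d * N = k * (B e * L) + k * (B e * L) + d * N" by simp
      thus ?thesis using k B0 L(1) d N by (simp only: ennreal_plus ennreal_mult mult_nonneg_nonneg add_nonneg_nonneg less_imp_le)
    qed
    also have "\<dots> \<le> ennreal (c * \<eta>)"
    proof (rule ennreal_leI)
      have "d * N \<le> d * (N + 1)" using d by simp
      also have "\<dots> = c * \<eta> / 2" using N by (simp add: d_def field_simps)
      finally show "2 * k * L * B e + d * N \<le> c * \<eta>" using e(1) by simp
    qed
    finally have le: "(\<integral>\<^sup>+x. ennreal c * (indicator K x * ennreal (norm (u (r i) x - u (r j) x))) \<partial>M) \<le> ennreal (c * \<eta>)" .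
    have m: "(\<lambda>x. indicator K x * ennreal (norm (u (r i) x - u (r j) x))) \<in> borel_measurable M"
    proof -
      have "continuous_on K (\<lambda>x. u (r i) x - u (r j) x)"
        by (intro continuous_intros continuous_on_subset[OF u K(2)])
      from closure_restrict_measurable[OF this Kb]
      have "(\<lambda>x. ennreal (norm (indicator K x *\<^sub>R (u (r i) x - u (r j) x)))) \<in> borel_measurable M" by measurable
      thus ?thesis by (simp add: ennreal_mult ennreal_indicator)
    qed
    have "ennreal c * (\<integral>\<^sup>+x. indicator K x * ennreal (norm (u (r i) x - u (r j) x)) \<partial>M) \<le> ennreal c * ennreal \<eta>"
      using le c \<eta> by (simp add: nn_integral_cmult[OF m] ennreal_mult)
    thus "(\<integral>\<^sup>+x. indicator K x * ennreal (norm (u (r i) x - u (r j) x)) \<partial>M) \<le> ennreal \<eta>"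
      using c by (simp add: ennreal_mult_le_mult_iff)
  qed
qed

section \<open>From exponent \<open>1\<close> on a compact set to exponent \<open>q\<close> on
  \<Omega>\<close>

lemma finite_measure_inner_compact:
  fixes \<Omega> :: "'a::euclidean_space set"
  assumes M: "sets M = sets borel" "emeasure M UNIV < \<infinity>" and \<Omega>: "open \<Omega>" and \<delta>: "\<delta> > 0"
  shows "\<exists>K. compact K \<and> K \<subseteq> \<Omega> \<and> emeasure M (\<Omega> - K) \<le> ennreal \<delta>"
proof -
  obtain C where C: "\<And>n. compact (C n)" "\<And>n. C n \<subseteq> \<Omega>" "\<And>n. C n \<subseteq> interior (C (Suc n))" "\<Union>(range C) = \<Omega>"
    using open_Union_compact_subsets[OF \<Omega>] by metis
  have mono: "C n \<subseteq> C (Suc n)" for n using C(3) interior_subset by blast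
  have "(\<lambda>n. emeasure M (\<Omega> - C n)) \<longlonglongrightarrow> emeasure M (\<Inter>n. \<Omega> - C n)"
  proof (rule Lim_emeasure_decseq)
    show "range (\<lambda>n. \<Omega> - C n) \<subseteq> sets M" unfolding M(1) by (intro image_subsetI sets.Diff borel_open[OF \<Omega>] borel_closed compact_imp_closed C(1))
    show "decseq (\<lambda>n. \<Omega> - C n)" using mono by (intro decseq_SucI) blast
    show "emeasure M (\<Omega> - C n) \<noteq> \<infinity>" for n
    proof -
      have "emeasure M (\<Omega> - C n) \<le> emeasure M UNIV" by (rule emeasure_mono) (auto simp: M(1))
      thus ?thesis using M(2) by (auto simp: top_unique)
    qed
  qed
  moreover have "(\<Inter>n. \<Omega> - C n) = {}" using C(4) by auto
  ultimately have "(\<lambda>n. emeasure M (\<Omega> - C n)) \<longlonglongrightarrow> 0" by (simp only: emeasure_empty)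
  hence "\<forall>\<^sub>F n in sequentially. emeasure M (\<Omega> - C n) < ennreal \<delta>" using \<delta> by (intro order_tendstoD) auto
  then obtain n where "emeasure M (\<Omega> - C n) < ennreal \<delta>" by (auto simp: eventually_sequentially)
  thus ?thesis using C(1,2) by (intro exI[of _ "C n"]) auto
qed

lemma powr_neg_small:
  fixes a b W :: real
  assumes "a < 0" "b > 0"
  shows "\<exists>x\<ge>1. W * x powr a < b"
proof -
  have "((\<lambda>x. W * x powr a) \<longlongrightarrow> W * 0) at_top"
    by (intro tendsto_intros tendsto_neg_powr assms filterlim_ident)
  hence "\<forall>\<^sub>F x in at_top. W * x powr a < b" using assms by (intro order_tendstoD) auto
  hence "\<forall>\<^sub>F x in at_top. W * x powr a < b \<and> x \<ge> 1" using eventually_ge_at_top[of 1] by eventually_elim auto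
  thus ?thesis using eventually_happens[of _ "at_top :: real filter"] by auto
qed

text \<open>For \<open>t \<le> L\<close> the first term alone suffices, for \<open>t > L\<close> the
  second.\<close>

lemma powr_truncation:
  fixes t L :: real
  assumes "0 \<le> t" "0 < L" "r \<le> q" "q \<le> s"
  shows "t powr q \<le> L powr (q - r) * t powr r + L powr (q - s) * t powr s"
proof (cases "t \<le> L")
  case True
  show ?thesis
  proof (cases "t = 0")
    case False
    have "t powr q = t powr (q - r) * t powr r" using False by (simp add: powr_add[symmetric])
    also have "\<dots> \<le> L powr (q - r) * t powr r" using True assms by (intro mult_right_mono powr_mono2) auto
    finally show ?thesis by (smt (verit) mult_nonneg_nonneg powr_ge_zero)
  qed simp
next
  case False
  have "t powr q = t powr (q - s) * t powr s" using False assms by (simp add: powr_add[symmetric])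
  also have "\<dots> \<le> L powr (q - s) * t powr s" using False assms by (intro mult_right_mono powr_mono2') auto
  finally show ?thesis by (smt (verit) mult_nonneg_nonneg powr_ge_zero)
qed

text \<open>Values above a level \<open>L\<close> are absorbed by the bound for the power
  \<open>s\<close>; below it \<open>w powr q\<close> is at most \<open>c * w\<close>. Off
  \<open>K\<close> no smallness of \<open>w\<close> is known, so there \<open>w\<close> is truncated
  again, at a level \<open>G\<close>, and the small measure of \<open>\<Omega> - K\<close> takes
  over. \<delta> precedes \<open>K\<close> and \<open>w\<close>, so the compact set can be chosen
  after it and kept for all pairs of functions.\<close>

lemma Lq_small_of_L1_small:
  fixes M :: "'a::euclidean_space measure"
  assumes M: "sets M = sets borel" and \<Omega>: "\<Omega> \<in> sets borel" and q: "1 \<le> q" "q < s" and W: "0 \<le> W" and \<eta>: "\<eta> > 0"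
  shows "\<exists>\<delta>>0. \<forall>K w. K \<in> sets borel \<longrightarrow> K \<subseteq> \<Omega> \<longrightarrow> emeasure M (\<Omega> - K) \<le> ennreal \<delta> \<longrightarrow>
     (\<lambda>x. indicator \<Omega> x * w x) \<in> borel_measurable borel \<longrightarrow> (\<forall>x. 0 \<le> w x) \<longrightarrow>
     (\<integral>\<^sup>+x. indicator \<Omega> x * ennreal (w x powr s) \<partial>M) \<le> ennreal W \<longrightarrow>
     (\<integral>\<^sup>+x. indicator K x * ennreal (w x) \<partial>M) \<le> ennreal \<delta> \<longrightarrow>
     (\<integral>\<^sup>+x. indicator \<Omega> x * ennreal (w x powr q) \<partial>M) < ennreal \<eta>"
proof -
  note [measurable_cong] = M
  obtain L where L: "L \<ge> 1" "W * L powr (q - s) < \<eta> / 4" using powr_neg_small[of "q - s" "\<eta> / 4" W] q \<eta> by auto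
  define c where "c = L powr (q - 1)"
  have c: "c > 0" using L by (simp add: c_def)
  obtain G where G: "G \<ge> 1" "(c * W) * G powr (1 - s) < \<eta> / 4" using powr_neg_small[of "1 - s" "\<eta> / 4" "c * W"] q \<eta> by auto
  \<comment> \<open>Makes \<open>c * \<delta> + c * G * \<delta>\<close> equal to
    \<open>\<eta> / 8\<close>; the tails at the levels \<open>L\<close> and \<open>G\<close> take
    less than \<open>\<eta> / 4\<close> each.\<close>
  define \<delta> where "\<delta> = \<eta> / (8 * (c * (1 + G)))"
  have \<delta>: "\<delta> > 0" using \<eta> c G by (simp add: \<delta>_def)
  define H where "H = c * G powr (1 - s) + L powr (q - s)"
  have H: "H \<ge> 0" using c by (simp add: H_def)
  show ?thesis
  proof (intro exI[of _ \<delta>] conjI \<delta> allI impI)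
    fix K and w :: "'a \<Rightarrow> real"
    assume K[measurable]: "K \<in> sets borel" and KO: "K \<subseteq> \<Omega>" and KM: "emeasure M (\<Omega> - K) \<le> ennreal \<delta>"
      and wm: "(\<lambda>x. indicator \<Omega> x * w x) \<in> borel_measurable borel" and w0: "\<forall>x. 0 \<le> w x"
      and ws: "(\<integral>\<^sup>+x. indicator \<Omega> x * ennreal (w x powr s) \<partial>M) \<le> ennreal W"
      and wK: "(\<integral>\<^sup>+x. indicator K x * ennreal (w x) \<partial>M) \<le> ennreal \<delta>"
    have m1: "(\<lambda>x. indicator \<Omega> x * ennreal (w x powr s)) \<in> borel_measurable M"
    proof -
      have "(\<lambda>x. ennreal ((indicator \<Omega> x * w x) powr s)) \<in> borel_measurable borel" using wm by measurable
      also have "(\<lambda>x. ennreal ((indicator \<Omega> x * w x) powr s)) = (\<lambda>x. indicator \<Omega> x * ennreal (w x powr s))"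
        by (auto simp: fun_eq_iff indicator_def)
      finally show ?thesis by simp
    qed
    have m2: "(\<lambda>x. indicator K x * ennreal (w x)) \<in> borel_measurable M"
    proof -
      have "(\<lambda>x. indicator K x * ennreal (indicator \<Omega> x * w x)) \<in> borel_measurable borel" using wm by measurable
      also have "(\<lambda>x. indicator K x * ennreal (indicator \<Omega> x * w x)) = (\<lambda>x. indicator K x * ennreal (w x))"
        using KO by (auto simp: fun_eq_iff indicator_def)
      finally show ?thesis by simp
    qed
    have pt: "indicator \<Omega> x * ennreal (w x powr q) \<le> ennreal c * (indicator K x * ennreal (w x))
        + ennreal (c * G) * indicator (\<Omega> - K) x + ennreal H * (indicator \<Omega> x * ennreal (w x powr s))" for x
    proof (cases "x \<in> \<Omega>")
      case True
      have w: "w x \<ge> 0" using w0 by simp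
      have 1: "w x powr q \<le> c * w x + L powr (q - s) * w x powr s"
        using powr_truncation[OF w, of L 1 q s] q L w by (simp add: c_def)
      show ?thesis
      proof (cases "x \<in> K")
        case True
        have "w x powr q \<le> c * w x + H * w x powr s"
        proof -
          have "0 \<le> c * (G powr (1 - s) * w x powr s)" using c by simp
          thus ?thesis using 1 by (simp add: H_def algebra_simps)
        qed
        hence "ennreal (w x powr q) \<le> ennreal (c * w x + H * w x powr s)" by (rule ennreal_leI)
        also have "\<dots> = ennreal c * ennreal (w x) + ennreal H * ennreal (w x powr s)"
          using c w H by (simp add: ennreal_mult ennreal_plus)
        finally show ?thesis using \<open>x \<in> \<Omega>\<close> True by simp
      next
        case False
        have "w x \<le> G + G powr (1 - s) * w x powr s"
          using powr_truncation[OF w, of G 0 1 s] q G w by (cases "w x = 0") auto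
        hence "c * w x \<le> c * (G + G powr (1 - s) * w x powr s)" using c by (intro mult_left_mono) auto
        hence "w x powr q \<le> c * G + H * w x powr s" using 1 by (simp add: H_def algebra_simps)
        hence "ennreal (w x powr q) \<le> ennreal (c * G + H * w x powr s)" by (rule ennreal_leI)
        also have "\<dots> = ennreal (c * G) + ennreal H * ennreal (w x powr s)"
          using c w H G by (simp add: ennreal_mult ennreal_plus)
        finally show ?thesis using \<open>x \<in> \<Omega>\<close> False by simp
      qed
    qed simp
    have "(\<integral>\<^sup>+x. indicator \<Omega> x * ennreal (w x powr q) \<partial>M)
       \<le> (\<integral>\<^sup>+x. ennreal c * (indicator K x * ennreal (w x))
        + ennreal (c * G) * indicator (\<Omega> - K) x + ennreal H * (indicator \<Omega> x * ennreal (w x powr s)) \<partial>M)"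
      by (intro nn_integral_mono pt)
    also have "\<dots> = ennreal c * (\<integral>\<^sup>+x. indicator K x * ennreal (w x) \<partial>M) + ennreal (c * G) * emeasure M (\<Omega> - K)
        + ennreal H * (\<integral>\<^sup>+x. indicator \<Omega> x * ennreal (w x powr s) \<partial>M)"
      using \<Omega> m1 m2 by (simp add: nn_integral_add nn_integral_cmult nn_integral_cmult_indicator M)
    also have "\<dots> \<le> ennreal c * ennreal \<delta> + ennreal (c * G) * ennreal \<delta> + ennreal H * ennreal W"
      by (intro add_mono mult_left_mono wK KM ws) auto
    also have "\<dots> = ennreal (c * \<delta> + c * G * \<delta> + H * W)"
      using c G \<delta> H W by (simp add: ennreal_mult ennreal_plus)
    also have "\<dots> < ennreal \<eta>"
    proof (rule ennreal_lessI[OF \<eta>])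
      have "c * \<delta> + c * G * \<delta> = \<eta> / 8"
      proof -
        have "c * \<delta> + c * G * \<delta> = (c * (1 + G)) * \<delta>" by (simp add: algebra_simps)
        thus ?thesis using c G by (simp add: \<delta>_def)
      qed
      moreover have "H * W < \<eta> / 4 + \<eta> / 4" using L(2) G(2) by (simp add: H_def algebra_simps)
      ultimately show "c * \<delta> + c * G * \<delta> + H * W < \<eta>" using \<eta> by simp
    qed
    finally show "(\<integral>\<^sup>+x. indicator \<Omega> x * ennreal (w x powr q) \<partial>M) < ennreal \<eta>" .
  qed
qed

lemma nn_integral_powr_le_of_Lp_norm:
  assumes "Lp_norm p M f \<le> ennreal S" "p > 0" "S \<ge> 0"
  shows "(\<integral>\<^sup>+x. ennreal (norm (f x) powr p) \<partial>M) \<le> ennreal (S powr p)"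
proof -
  let ?I = "\<integral>\<^sup>+x. ennreal (norm (f x) powr p) \<partial>M"
  have fin: "?I \<noteq> \<infinity>" using assms(1) by (auto simp: Lp_norm_def Let_def top_unique)
  then obtain i where i: "?I = ennreal i" "i \<ge> 0" by (cases ?I) auto
  have "i powr (1 / p) \<le> S"
    using assms i by (simp add: Lp_norm_def Let_def)
  hence "(i powr (1 / p)) powr p \<le> S powr p" using assms by (intro powr_mono2) auto
  hence "i \<le> S powr p" using assms i by (simp add: powr_powr)
  thus ?thesis unfolding i by (rule ennreal_leI)
qed

lemma Lp_norm_less:
  assumes "(\<integral>\<^sup>+x. ennreal (norm (f x) powr p) \<partial>M) < ennreal (e powr p)" "p > 0" "e > 0"
  shows "Lp_norm p M f < ennreal e"
proof -
  let ?I = "\<integral>\<^sup>+x. ennreal (norm (f x) powr p) \<partial>M"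
  have fin: "?I \<noteq> \<infinity>" using assms(1) by auto
  then obtain i where i: "?I = ennreal i" "i \<ge> 0" by (cases ?I) auto
  have "i < e powr p" using assms(1) i by (simp add: ennreal_less_iff)
  hence "i powr (1 / p) < (e powr p) powr (1 / p)" using assms i by (intro powr_less_mono2) auto
  hence "i powr (1 / p) < e" using assms by (simp add: powr_powr)
  thus ?thesis using fin i assms by (simp add: Lp_norm_def Let_def ennreal_lessI)
qed

lemma powr_add_le:
  fixes a b s :: real
  assumes "0 \<le> a" "0 \<le> b" "0 \<le> s"
  shows "(a + b) powr s \<le> 2 powr s * (a powr s + b powr s)"
proof -
  have "(a + b) powr s \<le> (2 * max a b) powr s" using assms by (intro powr_mono2) auto
  also have "\<dots> = 2 powr s * max a b powr s" using assms by (simp add: powr_mult)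
  also have "\<dots> \<le> 2 powr s * (a powr s + b powr s)" by (intro mult_left_mono) (auto simp: max_def)
  finally show ?thesis .
qed

text \<open>Lebesgue measure restricted to \<open>K\<close> has growth exponent \<open>n\<close>, so
  \<open>Ls_bound\<close> applies with \<alpha> = n and s = \<sigma>; this is admissible because
  \<sigma> < n * p / (n - p). Then \<open>t \<le> 1 + t powr r\<close> lowers the exponents to
  \<open>1\<close>, as \<open>K\<close> has finite measure.\<close>

lemma local_L1_bound:
  fixes \<Omega> :: "(real^'n) set"
  defines "n \<equiv> real CARD('n)"
  assumes card: "CARD('n) \<ge> 2" and \<Omega>: "open \<Omega>" and p: "1 < p" "p < n" and N: "0 \<le> N1" "0 \<le> N2"
    and K: "compact K" "K \<subseteq> \<Omega>"
    and eb: "\<And>m::nat. energy_bounded \<Omega> p N1 N2 (u m) (g m)"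
  shows "\<exists>L\<ge>0. \<forall>m. (\<integral>\<^sup>+w. indicator K w * ennreal (g m w) \<partial>lborel) \<le> ennreal L
        \<and> (\<integral>\<^sup>+w. indicator K w * ennreal (norm (u m w)) \<partial>lborel) \<le> ennreal L"
proof -
  have u: "\<And>m. u m \<in> C_b (closure \<Omega>)" and g[measurable]: "\<And>m. g m \<in> borel_measurable borel"
    and g0: "\<And>m w. 0 \<le> g m w" and gp: "\<And>m. (\<integral>\<^sup>+y. ennreal (g m y powr p) \<partial>lborel) \<le> ennreal N1"
    using eb by (auto simp: energy_bounded_def)
  have Kb[measurable]: "K \<in> sets borel" using K(1) by (simp add: compact_imp_closed)
  obtain V where V: "emeasure lborel K = ennreal V" "V \<ge> 0"
    using emeasure_bounded_finite[OF compact_imp_bounded[OF K(1)]] by (cases "emeasure lborel K") auto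
  define \<sigma> where "\<sigma> = p * (n - 1) / (n - p)"
  have \<sigma>p: "p \<le> \<sigma>"
    unfolding \<sigma>_def by (rule trace_exponent_ge[OF p])
  have \<sigma>n: "\<sigma> < n * p / (n - p)"
    unfolding \<sigma>_def using p by (intro divide_strict_right_mono) (auto simp: algebra_simps)
  define M where "M = density lborel (indicator K :: real^'n \<Rightarrow> ennreal)"
  have eM: "emeasure M A = emeasure lborel (K \<inter> A)" if "A \<in> sets borel" for A
    unfolding M_def by (rule emeasure_restricted) (use that in auto)
  have "\<exists>L\<ge>0. \<forall>u g. energy_bounded \<Omega> p N1 N2 u g
     \<longrightarrow> (\<integral>\<^sup>+x. indicator \<Omega> x * ennreal (norm (u x) powr \<sigma>) \<partial>M) \<le> ennreal L"
  proof (rule Ls_bound[OF card \<Omega> p(1), where \<alpha> = n and C = "unit_ball_vol n", folded n_def])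
    show "emeasure M UNIV < \<infinity>" using V by (simp add: eM)
    show "emeasure M (ball y r) \<le> ennreal (unit_ball_vol n * r powr n)" if "r > 0" for y r
    proof -
      have "emeasure M (ball y r) \<le> emeasure lborel (ball y r)" by (simp add: eM emeasure_mono)
      also have "\<dots> \<le> ennreal (unit_ball_vol n * r powr n)" using lborel_ball_growth[OF that, of y] by (simp add: n_def)
      finally show ?thesis .
    qed
    show "p * (n - 1) / (n - p) \<le> \<sigma>" by (simp add: \<sigma>_def)
    show "0 \<le> unit_ball_vol n" by (simp add: n_def)
    show "sets M = sets borel" by (simp add: M_def)
  qed (use p N \<sigma>p \<sigma>n in simp_all)
  then obtain L where L: "L \<ge> 0" "\<And>m. (\<integral>\<^sup>+x. indicator \<Omega> x * ennreal (norm (u m x) powr \<sigma>) \<partial>M) \<le> ennreal L"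
    using eb by blast
  have le1: "t \<le> 1 + t powr r" if "0 \<le> t" "1 < r" for t r :: real
    using powr_truncation[of t 1 0 1 r] that by (cases "t = 0") auto
  have A: "(\<integral>\<^sup>+w. indicator K w * ennreal (g m w) \<partial>lborel) \<le> ennreal (V + N1)" for m
  proof -
    have "(\<integral>\<^sup>+w. indicator K w * ennreal (g m w) \<partial>lborel) \<le> (\<integral>\<^sup>+w. indicator K w + ennreal (g m w powr p) \<partial>lborel)"
    proof (rule nn_integral_mono)
      fix w
      have "ennreal (g m w) \<le> ennreal (1 + g m w powr p)" by (intro ennreal_leI le1 g0 p)
      thus "indicator K w * ennreal (g m w) \<le> indicator K w + ennreal (g m w powr p)"
        by (auto simp: indicator_def ennreal_plus)
    qed
    also have "\<dots> = ennreal V + (\<integral>\<^sup>+w. ennreal (g m w powr p) \<partial>lborel)" by (simp add: nn_integral_add V)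
    also have "\<dots> \<le> ennreal V + ennreal N1" by (intro add_left_mono gp)
    finally show ?thesis using V N by (simp add: ennreal_plus)
  qed
  have B: "(\<integral>\<^sup>+w. indicator K w * ennreal (norm (u m w)) \<partial>lborel) \<le> ennreal (V + L)" for m
  proof -
    have "continuous_on K (u m)" using u[of m] K(2) closure_subset[of \<Omega>] by (auto simp: C_b_def intro: continuous_on_subset)
    from closure_restrict_measurable[OF this Kb]
    have "(\<lambda>w. ennreal (norm (indicator K w *\<^sub>R u m w) powr \<sigma>)) \<in> borel_measurable borel" by measurable
    also have "(\<lambda>w. ennreal (norm (indicator K w *\<^sub>R u m w) powr \<sigma>)) = (\<lambda>w. indicator K w * ennreal (norm (u m w) powr \<sigma>))"
      by (auto simp: fun_eq_iff indicator_def)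
    finally have [measurable]: "(\<lambda>w. indicator K w * ennreal (norm (u m w) powr \<sigma>)) \<in> borel_measurable borel" .
    have uO: "continuous_on \<Omega> (u m)" using u[of m] closure_subset[of \<Omega>] by (auto simp: C_b_def intro: continuous_on_subset)
    have "(\<lambda>w. ennreal (norm (indicator \<Omega> w *\<^sub>R u m w) powr \<sigma>)) \<in> borel_measurable borel"
      using closure_restrict_measurable[OF uO] \<Omega> by measurable
    also have "(\<lambda>w. ennreal (norm (indicator \<Omega> w *\<^sub>R u m w) powr \<sigma>)) = (\<lambda>w. indicator \<Omega> w * ennreal (norm (u m w) powr \<sigma>))"
      by (auto simp: fun_eq_iff indicator_def)
    finally have mO: "(\<lambda>w. indicator \<Omega> w * ennreal (norm (u m w) powr \<sigma>)) \<in> borel_measurable borel" .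
    have "(\<integral>\<^sup>+w. indicator K w * ennreal (norm (u m w)) \<partial>lborel) \<le> (\<integral>\<^sup>+w. indicator K w + indicator K w * ennreal (norm (u m w) powr \<sigma>) \<partial>lborel)"
    proof (rule nn_integral_mono)
      fix w
      have "ennreal (norm (u m w)) \<le> ennreal (1 + norm (u m w) powr \<sigma>)" using \<sigma>p p by (intro ennreal_leI le1) auto
      thus "indicator K w * ennreal (norm (u m w)) \<le> indicator K w + indicator K w * ennreal (norm (u m w) powr \<sigma>)"
        by (auto simp: indicator_def ennreal_plus)
    qed
    also have "\<dots> = ennreal V + (\<integral>\<^sup>+w. indicator K w * ennreal (norm (u m w) powr \<sigma>) \<partial>lborel)" by (simp add: nn_integral_add V)
    also have "(\<integral>\<^sup>+w. indicator K w * ennreal (norm (u m w) powr \<sigma>) \<partial>lborel) = (\<integral>\<^sup>+w. indicator \<Omega> w * ennreal (norm (u m w) powr \<sigma>) \<partial>M)"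
      unfolding M_def using K(2) mO by (subst nn_integral_density) (auto intro!: nn_integral_cong simp: indicator_def)
    also have "ennreal V + \<dots> \<le> ennreal V + ennreal L" by (intro add_left_mono L)
    finally show ?thesis using V L by (simp add: ennreal_plus)
  qed
  show ?thesis
  proof (intro exI[of _ "V + N1 + L"] conjI allI)
    fix m
    show "(\<integral>\<^sup>+w. indicator K w * ennreal (g m w) \<partial>lborel) \<le> ennreal (V + N1 + L)"
      using L by (intro order_trans[OF A] ennreal_leI) simp
    show "(\<integral>\<^sup>+w. indicator K w * ennreal (norm (u m w)) \<partial>lborel) \<le> ennreal (V + N1 + L)"
      using N by (intro order_trans[OF B] ennreal_leI) simp
  qed (use V N L in simp)
qed

section \<open>Transfer to the whole space, uniform bounds and the diagonal subsequence\<close>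

theorem theorem4p2:
  fixes \<Omega> :: "(real^'n) set"
    and \<mu> :: "(real^'n) measure"
    and \<alpha> C\<mu> p q :: real
    and u :: "nat \<Rightarrow> real^'n \<Rightarrow> real^'n"
  defines "n \<equiv> real CARD('n)"
  assumes "CARD('n) \<ge> 2"
    and "open \<Omega>"
    and "sets \<mu> = sets (restrict_space borel \<Omega>)"
    and "n - 1 < \<alpha>" and "\<alpha> \<le> n" and "C\<mu> > 0"
    and "\<And>x r. x \<in> \<Omega> \<Longrightarrow> r > 0 \<Longrightarrow> emeasure \<mu> (ball x r \<inter> \<Omega>) \<le> ennreal (C\<mu> * r powr \<alpha>)"
    and "1 < p" and "p < n"
    and "emeasure \<mu> \<Omega> < \<infinity>"
    and "1 \<le> q" and "q < \<alpha> * p / (n - p)"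
    and "\<And>m. u m \<in> C_b (closure \<Omega>)"
    and "\<And>m. u m \<in> E1p p \<Omega>"
    and "\<And>m. u m \<in> Lp_space (p * (n - 1) / (n - p)) (boundary_measure \<Omega>)"
    and "(SUP m. Lp_norm p (lebesgue_on \<Omega>) (sym_grad \<Omega> (u m))
              + Lp_norm (p * (n - 1) / (n - p)) (boundary_measure \<Omega>) (u m)) < \<infinity>"
  shows "\<exists>r. strict_mono r \<and> Lp_Cauchy q \<mu> (\<lambda>k. u (r k))"
proof -
  note card = assms(2) and \<Omega> = assms(3) and sets_\<mu> = assms(4) and \<alpha> = assms(5) and C\<mu> = assms(7) and growth = assms(8)
    and p = assms(9,10) and fin = assms(11) and q = assms(12,13) and u = assms(14) and E = assms(15) and sup = assms(17)
  have \<Omega>b[measurable]: "\<Omega> \<in> sets borel" using \<Omega> by simp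
  have sp\<mu>: "space \<mu> = \<Omega>" using sets_eq_imp_space_eq[OF sets_\<mu>] by (simp add: space_restrict_space)
  have id: "(\<lambda>x. x) \<in> measurable \<mu> borel"
  proof -
    have "(\<lambda>x. x) \<in> measurable (restrict_space borel \<Omega>) borel" by (rule measurable_restrict_space1) simp
    thus ?thesis using measurable_cong_sets[OF sets_\<mu> refl] by blast
  qed
  \<comment> \<open>The push-forward to the whole space, where balls with arbitrary centres are
    measurable.\<close>
  define M where "M = distr \<mu> borel (\<lambda>x. x)"
  have sM: "sets M = sets borel" by (simp add: M_def)
  have eM: "emeasure M A = emeasure \<mu> (A \<inter> \<Omega>)" if "A \<in> sets borel" for A
    unfolding M_def using that by (subst emeasure_distr[OF id]) (auto simp: sp\<mu>)
  have Mfin: "emeasure M UNIV < \<infinity>" using fin by (simp add: eM)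
  have int_M: "(\<integral>\<^sup>+x. ennreal (h x) \<partial>\<mu>) = (\<integral>\<^sup>+x. indicator \<Omega> x * ennreal (h x) \<partial>M)"
    if "(\<lambda>x. indicator \<Omega> x * ennreal (h x)) \<in> borel_measurable borel" for h
  proof -
    have "(\<integral>\<^sup>+x. indicator \<Omega> x * ennreal (h x) \<partial>M) = (\<integral>\<^sup>+x. indicator \<Omega> x * ennreal (h x) \<partial>\<mu>)"
      unfolding M_def by (rule nn_integral_distr[OF id]) (use that in simp)
    also have "\<dots> = (\<integral>\<^sup>+x. ennreal (h x) \<partial>\<mu>)" by (rule nn_integral_cong) (simp add: sp\<mu>)
    finally show ?thesis by simp
  qed
  have \<alpha>0: "\<alpha> > 0" using \<alpha> card by (simp add: n_def)
  \<comment> \<open>The growth condition is given only for centres in \<Omega>. A ball that meets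
    \<Omega> at \<open>x\<close> lies in the ball around \<open>x\<close> of twice the radius, which
    costs the factor \<open>2 powr \<alpha>\<close>.\<close>
  have Mgrowth: "emeasure M (ball y r) \<le> ennreal ((C\<mu> * 2 powr \<alpha>) * r powr \<alpha>)" if r: "r > 0" for y r
  proof (cases "ball y r \<inter> \<Omega> = {}")
    case False
    then obtain x where x: "x \<in> ball y r" "x \<in> \<Omega>" by blast
    have "ball y r \<subseteq> ball x (2 * r)"
    proof
      fix z assume "z \<in> ball y r"
      thus "z \<in> ball x (2 * r)" using x(1) dist_triangle2[of x z y] by (simp add: dist_commute)
    qed
    hence "emeasure \<mu> (ball y r \<inter> \<Omega>) \<le> emeasure \<mu> (ball x (2 * r) \<inter> \<Omega>)"
      by (intro emeasure_mono) (auto simp: sets_\<mu> sets_restrict_space_iff)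
    also have "\<dots> \<le> ennreal (C\<mu> * (2 * r) powr \<alpha>)" using r by (intro growth x) simp
    also have "C\<mu> * (2 * r) powr \<alpha> = (C\<mu> * 2 powr \<alpha>) * r powr \<alpha>" using r by (simp add: powr_mult)
    finally show ?thesis by (simp add: eM)
  qed (simp add: eM)
  define \<sigma> where "\<sigma> = p * (n - 1) / (n - p)"
  have \<sigma>p: "p \<le> \<sigma>"
    unfolding \<sigma>_def by (rule trace_exponent_ge[OF p])
  have \<sigma>\<alpha>: "\<sigma> < \<alpha> * p / (n - p)"
  proof -
    have "p * (n - 1) < \<alpha> * p" using \<alpha> p by (subst mult.commute) (intro mult_strict_right_mono; simp)
    thus ?thesis unfolding \<sigma>_def using p by (intro divide_strict_right_mono) auto
  qed
  \<comment> \<open>\<open>s\<close> has to exceed \<open>q\<close> for the interpolation and to be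
    at least \<sigma> for \<open>Ls_bound\<close>.\<close>
  have "max q \<sigma> < \<alpha> * p / (n - p)" using q \<sigma>\<alpha> by simp
  then obtain s where s: "max q \<sigma> < s" "s < \<alpha> * p / (n - p)" using dense by blast
  have qs: "q < s" and \<sigma>s: "\<sigma> \<le> s" using s(1) by auto
  obtain S where S: "(SUP m. Lp_norm p (lebesgue_on \<Omega>) (sym_grad \<Omega> (u m)) + Lp_norm \<sigma> (boundary_measure \<Omega>) (u m)) = ennreal S" "S \<ge> 0"
  proof -
    have "\<exists>S\<ge>0. X = ennreal S" if "X < \<infinity>" for X using that by (cases X) auto
    from this[OF sup] that show ?thesis unfolding \<sigma>_def by blast
  qed
  have S_le: "Lp_norm p (lebesgue_on \<Omega>) (sym_grad \<Omega> (u m)) \<le> ennreal S" "Lp_norm \<sigma> (boundary_measure \<Omega>) (u m) \<le> ennreal S" for m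
  proof -
    have *: "Lp_norm p (lebesgue_on \<Omega>) (sym_grad \<Omega> (u m)) + Lp_norm \<sigma> (boundary_measure \<Omega>) (u m) \<le> ennreal S"
      unfolding S(1)[symmetric] by (rule SUP_upper) simp
    show "Lp_norm p (lebesgue_on \<Omega>) (sym_grad \<Omega> (u m)) \<le> ennreal S" by (rule order_trans[OF _ *]) simp
    show "Lp_norm \<sigma> (boundary_measure \<Omega>) (u m) \<le> ennreal S" by (rule order_trans[OF _ *]) simp
  qed
  have uO: "continuous_on \<Omega> (u m)" for m
    using u[of m] closure_subset[of \<Omega>] by (auto simp: C_b_def intro: continuous_on_subset)
  \<comment> \<open>\<open>sym_grad\<close> is the chosen representative, not necessarily the one
    that witnesses membership in \<open>E1p\<close>. The finite supremum concerns the chosen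
    one.\<close>
  have rep: "represents_sym_grad \<Omega> (u m) (sym_grad \<Omega> (u m))" for m
    unfolding sym_grad_def using E[of m] by (intro someI_ex[where P = "represents_sym_grad \<Omega> (u m)"]) (auto simp: E1p_def)
  have "\<forall>m. \<exists>g. g \<in> borel_measurable borel \<and> (\<forall>w. 0 \<le> g w) \<and> sym_grad_bound \<Omega> (u m) (\<lambda>w. ennreal (g w))
     \<and> (\<integral>\<^sup>+y. ennreal (g y powr p) \<partial>lborel) \<le> ennreal (S powr p)"
  proof
    fix m
    obtain g where g: "g \<in> borel_measurable borel" "\<forall>w. 0 \<le> g w" "sym_grad_bound \<Omega> (u m) (\<lambda>w. ennreal (g w))"
      "\<forall>p>0. (\<integral>\<^sup>+y. ennreal (g y powr p) \<partial>lborel) = (\<integral>\<^sup>+y. ennreal (norm (sym_grad \<Omega> (u m) y) powr p) \<partial>lebesgue_on \<Omega>)"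
      using represents_sym_grad_bound[OF \<Omega> uO rep, of m] by blast
    have "(\<integral>\<^sup>+y. ennreal (g y powr p) \<partial>lborel) \<le> ennreal (S powr p)"
      using g(4) p nn_integral_powr_le_of_Lp_norm[OF S_le(1)] S(2) by simp
    thus "\<exists>g. g \<in> borel_measurable borel \<and> (\<forall>w. 0 \<le> g w) \<and> sym_grad_bound \<Omega> (u m) (\<lambda>w. ennreal (g w))
     \<and> (\<integral>\<^sup>+y. ennreal (g y powr p) \<partial>lborel) \<le> ennreal (S powr p)" using g by blast
  qed
  then obtain g where g: "\<And>m. g m \<in> borel_measurable borel" "\<And>m w. 0 \<le> g m w"
    "\<And>m. sym_grad_bound \<Omega> (u m) (\<lambda>w. ennreal (g m w))"
    "\<And>m. (\<integral>\<^sup>+y. ennreal (g m y powr p) \<partial>lborel) \<le> ennreal (S powr p)" by metis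
  have ub: "(\<integral>\<^sup>+y. ennreal (norm (u m y) powr \<sigma>) \<partial>boundary_measure \<Omega>) \<le> ennreal (S powr \<sigma>)" for m
    by (rule nn_integral_powr_le_of_Lp_norm[OF S_le(2)]) (use \<sigma>p p S in auto)
  have eb: "energy_bounded \<Omega> p (S powr p) (S powr \<sigma>) (u m) (g m)" for m
    using u g ub[of m] by (simp add: energy_bounded_def \<sigma>_def n_def)
  have "\<exists>K\<ge>0. \<forall>u g. energy_bounded \<Omega> p (S powr p) (S powr \<sigma>) u g
     \<longrightarrow> (\<integral>\<^sup>+x. indicator \<Omega> x * ennreal (norm (u x) powr s) \<partial>M) \<le> ennreal K"
  proof (rule Ls_bound[OF card \<Omega> p(1), where C = "C\<mu> * 2 powr \<alpha>", folded n_def])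
    show "p * (n - 1) / (n - p) \<le> s" using \<sigma>s unfolding \<sigma>_def .
    show "p \<le> s" using \<sigma>p \<sigma>s by simp
    show "s < \<alpha> * p / (n - p)" by (rule s)
    show "emeasure M (ball y r) \<le> ennreal (C\<mu> * 2 powr \<alpha> * r powr \<alpha>)" if "0 < r" for y r by (rule Mgrowth[OF that])
    show "p < n" "n - 1 < \<alpha>" "sets M = sets borel" "emeasure M UNIV < \<infinity>" by fact+
  qed (use C\<mu> in simp_all)
  then obtain K where K: "K \<ge> 0" "\<And>m. (\<integral>\<^sup>+x. indicator \<Omega> x * ennreal (norm (u m x) powr s) \<partial>M) \<le> ennreal K"
    using eb by blast
  have indm: "(\<lambda>x. indicator \<Omega> x * norm (h x)) \<in> borel_measurable borel" if "continuous_on \<Omega> h" for h :: "real^'n \<Rightarrow> real^'n"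
  proof -
    have "(\<lambda>x. norm (indicator \<Omega> x *\<^sub>R h x)) \<in> borel_measurable borel"
      using closure_restrict_measurable[OF that \<Omega>b] by measurable
    thus ?thesis by simp
  qed
  have powm: "(\<lambda>x. indicator \<Omega> x * ennreal (norm (h x) powr t)) \<in> borel_measurable borel" if "continuous_on \<Omega> h" for h :: "real^'n \<Rightarrow> real^'n" and t
  proof -
    have "(\<lambda>x. ennreal ((indicator \<Omega> x * norm (h x)) powr t)) \<in> borel_measurable borel" using indm[OF that] by measurable
    also have "(\<lambda>x. ennreal ((indicator \<Omega> x * norm (h x)) powr t)) = (\<lambda>x. indicator \<Omega> x * ennreal (norm (h x) powr t))"
      by (auto simp: fun_eq_iff indicator_def)
    finally show ?thesis .
  qed
  define W where "W = 2 powr s * (K + K)"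
  have W: "W \<ge> 0" using K by (simp add: W_def)
  note [measurable_cong] = sM
  have ws: "(\<integral>\<^sup>+x. indicator \<Omega> x * ennreal (norm (u i x - u j x) powr s) \<partial>M) \<le> ennreal W" for i j
  proof -
    have "(\<integral>\<^sup>+x. indicator \<Omega> x * ennreal (norm (u i x - u j x) powr s) \<partial>M)
      \<le> (\<integral>\<^sup>+x. ennreal (2 powr s) * (indicator \<Omega> x * ennreal (norm (u i x) powr s) + indicator \<Omega> x * ennreal (norm (u j x) powr s)) \<partial>M)"
    proof (rule nn_integral_mono)
      fix x
      have "norm (u i x - u j x) powr s \<le> (norm (u i x) + norm (u j x)) powr s"
        using qs q by (intro powr_mono2 norm_triangle_ineq4) auto
      also have "\<dots> \<le> 2 powr s * (norm (u i x) powr s + norm (u j x) powr s)" using qs q by (intro powr_add_le) auto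
      finally have "ennreal (norm (u i x - u j x) powr s) \<le> ennreal (2 powr s * (norm (u i x) powr s + norm (u j x) powr s))" by (rule ennreal_leI)
      also have "\<dots> = ennreal (2 powr s) * (ennreal (norm (u i x) powr s) + ennreal (norm (u j x) powr s))"
        by (simp add: ennreal_mult ennreal_plus)
      finally show "indicator \<Omega> x * ennreal (norm (u i x - u j x) powr s)
        \<le> ennreal (2 powr s) * (indicator \<Omega> x * ennreal (norm (u i x) powr s) + indicator \<Omega> x * ennreal (norm (u j x) powr s))"
        by (auto simp: indicator_def)
    qed
    also have "\<dots> = ennreal (2 powr s) * ((\<integral>\<^sup>+x. indicator \<Omega> x * ennreal (norm (u i x) powr s) \<partial>M) + (\<integral>\<^sup>+x. indicator \<Omega> x * ennreal (norm (u j x) powr s) \<partial>M))"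
      using powm[OF uO, of i s] powm[OF uO, of j s] by (simp add: nn_integral_cmult nn_integral_add)
    also have "\<dots> \<le> ennreal (2 powr s) * (ennreal K + ennreal K)" by (intro mult_left_mono add_mono K) simp
    also have "\<dots> = ennreal W" unfolding W_def using K(1) by (simp only: ennreal_mult ennreal_plus powr_ge_zero add_nonneg_nonneg)
    finally show ?thesis .
  qed
  define d where "d i j = (\<integral>\<^sup>+x. indicator \<Omega> x * ennreal (norm (u i x - u j x) powr q) \<partial>M)" for i j
  \<comment> \<open>The order of choices: \<delta> for the given \<eta>, then the compact set
    \<open>F\<close> that misses at most \<delta> of the measure, then a subsequence that is close
    on \<open>F\<close>.\<close>
  have "\<exists>r :: nat \<Rightarrow> nat. strict_mono r \<and> (\<forall>j k. d (\<tau> (r j)) (\<tau> (r k)) < ennreal \<eta>)"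
    if \<eta>: "\<eta> > 0" and \<tau>: "strict_mono \<tau>" for \<eta> and \<tau> :: "nat \<Rightarrow> nat"
  proof -
    obtain \<delta> where \<delta>: "\<delta> > 0" "\<And>K w. K \<in> sets borel \<Longrightarrow> K \<subseteq> \<Omega> \<Longrightarrow> emeasure M (\<Omega> - K) \<le> ennreal \<delta> \<Longrightarrow>
       (\<lambda>x. indicator \<Omega> x * w x) \<in> borel_measurable borel \<Longrightarrow> (\<forall>x. 0 \<le> w x) \<Longrightarrow>
       (\<integral>\<^sup>+x. indicator \<Omega> x * ennreal (w x powr s) \<partial>M) \<le> ennreal W \<Longrightarrow>
       (\<integral>\<^sup>+x. indicator K x * ennreal (w x) \<partial>M) \<le> ennreal \<delta> \<Longrightarrow>
       (\<integral>\<^sup>+x. indicator \<Omega> x * ennreal (w x powr q) \<partial>M) < ennreal \<eta>"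
      using Lq_small_of_L1_small[OF sM \<Omega>b q(1) qs W \<eta>] by blast
    obtain F where F: "compact F" "F \<subseteq> \<Omega>" "emeasure M (\<Omega> - F) \<le> ennreal \<delta>"
      using finite_measure_inner_compact[OF sM Mfin \<Omega> \<delta>(1)] by blast
    have "\<exists>r :: nat \<Rightarrow> nat. strict_mono r \<and>
      (\<forall>j k. (\<integral>\<^sup>+x. indicator F x * ennreal (norm ((u \<circ> \<tau>) (r j) x - (u \<circ> \<tau>) (r k) x)) \<partial>M) \<le> ennreal \<delta>)"
    proof (rule L1_subsequence_compact[OF sM Mfin _ Mgrowth _ \<Omega> F(1,2), where g = "g \<circ> \<tau>"])
      fix K' assume K': "compact K'" "K' \<subseteq> \<Omega>"
      show "\<exists>L\<ge>0. \<forall>m. (\<integral>\<^sup>+w. indicator K' w * ennreal ((g \<circ> \<tau>) m w) \<partial>lborel) \<le> ennreal L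
        \<and> (\<integral>\<^sup>+w. indicator K' w * ennreal (norm ((u \<circ> \<tau>) m w)) \<partial>lborel) \<le> ennreal L"
        by (rule local_L1_bound[OF card \<Omega> p(1) _ _ _ K', where ?N1.0 = "S powr p" and ?N2.0 = "S powr \<sigma>", folded n_def])
           (use p eb in auto)
    qed (use \<alpha> C\<mu> uO g \<delta> in \<open>simp_all add: n_def\<close>)
    then obtain r where r: "strict_mono (r :: nat \<Rightarrow> nat)"
      "\<And>j k. (\<integral>\<^sup>+x. indicator F x * ennreal (norm (u (\<tau> (r j)) x - u (\<tau> (r k)) x)) \<partial>M) \<le> ennreal \<delta>" by auto
    have "d (\<tau> (r j)) (\<tau> (r k)) < ennreal \<eta>" for j k
      unfolding d_def
      by (rule \<delta>(2)[OF _ F(2,3) _ _ ws r(2)])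
         (use F in \<open>auto intro!: indm continuous_intros uO borel_closed compact_imp_closed\<close>)
    thus ?thesis using r(1) by blast
  qed
  from diagonal_Cauchy[of d, OF this] obtain r where r: "strict_mono (r :: nat \<Rightarrow> nat)"
    "\<And>\<eta>. \<eta> > 0 \<Longrightarrow> \<exists>N. \<forall>j\<ge>N. \<forall>k\<ge>N. d (r j) (r k) < ennreal \<eta>" by blast
  have "u m \<in> Lp_space q \<mu>" for m
  proof -
    have "(\<lambda>x. indicator \<Omega> x *\<^sub>R u m x) \<in> borel_measurable \<mu>"
      by (rule measurable_compose[OF id closure_restrict_measurable[OF uO \<Omega>b]])
    hence meas: "u m \<in> borel_measurable \<mu>"
      by (rule measurable_cong[THEN iffD1, rotated]) (simp add: sp\<mu>)
    have "(\<integral>\<^sup>+x. ennreal (norm (u m x) powr q) \<partial>\<mu>) = (\<integral>\<^sup>+x. indicator \<Omega> x * ennreal (norm (u m x) powr q) \<partial>M)"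
      by (rule int_M[OF powm[OF uO]])
    \<comment> \<open>The power \<open>q\<close> is dominated by \<open>1\<close> plus the power
      \<open>s\<close>, and \<open>M\<close> is finite; this gives membership in the space
      itself.\<close>
    also have "\<dots> \<le> (\<integral>\<^sup>+x. indicator \<Omega> x * ennreal (norm (u m x) powr s) + 1 \<partial>M)"
    proof (rule nn_integral_mono)
      fix x
      have "norm (u m x) powr q \<le> 1 + norm (u m x) powr s"
        using powr_truncation[of "norm (u m x)" 1 0 q s] qs q by (cases "u m x = 0") auto
      hence "ennreal (norm (u m x) powr q) \<le> ennreal (1 + norm (u m x) powr s)" by (rule ennreal_leI)
      thus "indicator \<Omega> x * ennreal (norm (u m x) powr q) \<le> indicator \<Omega> x * ennreal (norm (u m x) powr s) + 1"
        by (auto simp: indicator_def ennreal_plus add.commute)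
    qed
    also have "\<dots> = (\<integral>\<^sup>+x. indicator \<Omega> x * ennreal (norm (u m x) powr s) \<partial>M) + emeasure M UNIV"
      using powm[OF uO, of m s] sets_eq_imp_space_eq[OF sM] by (simp add: nn_integral_add)
    also have "\<dots> < \<infinity>" using le_less_trans[OF K(2)[of m]] Mfin by simp
    finally have "Lp_norm q \<mu> (u m) < \<infinity>" by (simp add: Lp_norm_def Let_def)
    thus ?thesis using meas by (simp add: Lp_space_def)
  qed
  moreover have "\<exists>N. \<forall>j\<ge>N. \<forall>k\<ge>N. Lp_norm q \<mu> (\<lambda>x. u (r j) x - u (r k) x) < ennreal \<epsilon>" if \<epsilon>: "\<epsilon> > 0" for \<epsilon>
  proof -
    obtain N where N: "\<And>j k. j \<ge> N \<Longrightarrow> k \<ge> N \<Longrightarrow> d (r j) (r k) < ennreal (\<epsilon> powr q)"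
      using r(2)[of "\<epsilon> powr q"] \<epsilon> by auto
    have "Lp_norm q \<mu> (\<lambda>x. u (r j) x - u (r k) x) < ennreal \<epsilon>" if "j \<ge> N" "k \<ge> N" for j k
    proof (rule Lp_norm_less)
      have c: "continuous_on \<Omega> (\<lambda>x. u (r j) x - u (r k) x)" by (intro continuous_intros uO)
      show "(\<integral>\<^sup>+x. ennreal (norm (u (r j) x - u (r k) x) powr q) \<partial>\<mu>) < ennreal (\<epsilon> powr q)"
        using N[OF that] unfolding d_def int_M[OF powm[OF c]] .
    qed (use q \<epsilon> in auto)
    thus ?thesis by blast
  qed
  ultimately show ?thesis using r(1) unfolding Lp_Cauchy_def by blast
qed

end
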